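(* Let $H$ be a Krull monoid that is not half-factorial, with finite cyclic class group of order $n\ge 250$. Then: (i) $H$ is $(n-2)$-congruence half-factorial if and only if exactly two non-zero classes, say $g_1$ and $g_2$, contain prime divisors, they are of order $n$, and $g_1=-g_2$; (ii) $H$ is $\frac{n-2}{2}$-congruence half-factorial if and only if exactly two non-zero classes of order $n$, say $g_1$ and $g_2$, contain prime divisors, they satisfy $g_1=-g_2$, and the only other non-zero class that might contain prime divisors is the class of order $2$; (iii) $H$ is $\frac{n-3}{2}$-congruence half-factorial if and only if exactly two non-zero classes, say $g_1$ and $g_2$, contain prime divisors, they are of order $n$, and $g_1=-2g_2$ (or $g_2=-2g_1$); (iv) $H$ is $\frac{n-4}{2}$-congruence half-factorial if and only if either a class $g_1$ of order $n$ contains prime divisors, as does the class $-2g_1$, and the only other non-zero class that might contain prime divisors is $2g_1$; or exactly three non-zero classes contain prime divisors, two of them, say $g_1$ and $g_2$, are of order $n/2$ and satisfy $g_1=-g_2$, the third is of order $2$, and $4\nmid n$.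
   Context: A monoid is a commutative cancellative semigroup with identity. For a monoid $H$ and $a\in H$, $\mathsf L(a)$ is the set of all $\ell\ge 0$ such that $a$ is a product of $\ell$ irreducible elements (atoms) of $H$ (for units, $\mathsf L(a)=\{0\}$). $H$ is half-factorial if $|\mathsf L(a)|=1$ for all $a\in H$. For $d\in\mathbb N$, $H$ is $d$-congruence half-factorial if for every $a\in H$ and all $\ell,\ell'\in\mathsf L(a)$ one has $\ell\equiv\ell'\pmod d$. $H$ is a Krull monoid if there is a homomorphism $\varphi:H\to\mathcal F(P)$ into a free abelian monoid with basis $P$ such that $a\mid b$ in $H$ iff $\varphi(a)\mid\varphi(b)$; it then has a divisor theory (such a $\varphi$ where each $p\in P$ is the gcd of finitely many elements of $\varphi(H)$), unique up to isomorphism. The class group is $\mathsf q(\mathcal F(P))/\mathsf q(\varphi(H))$ for a divisor theory $\varphi$; elements of $P$ are prime divisors, and a class contains prime divisors if it contains some $p\in P$. The statements in (i)–(iv) are to be read only when the respective quotient is an integer. *)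

theory Defs
  imports
    "HOL-Algebra.Divisibility"
    "HOL-Algebra.Multiplicative_Group"
    "HOL-Algebra.Free_Abelian_Groups"
    "HOL-Number_Theory.Cong"
begin

text \<open>Monoids are commutative and cancellative throughout, that is, instances of
  \<^locale>\<open>comm_monoid_cancel\<close>, written multiplicatively.\<close>

text \<open>Units need a separate clause because \<^const>\<open>factors\<close> asks for an exact product, so that a unit
  other than the identity is not the product of the empty list. For a non-unit the list is never
  empty, and exact factorizations have the same lengths as factorizations up to units.\<close>

definition length_set :: "('a, 'm) monoid_scheme \<Rightarrow> 'a \<Rightarrow> nat set" where
  "length_set H a =
     (if a \<in> Units H then {0}
      else {length fs | fs. set fs \<subseteq> carrier H \<and> factors H fs a})"

definition half_factorial :: "('a, 'm) monoid_scheme \<Rightarrow> bool" where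
  "half_factorial H \<longleftrightarrow> (\<forall>a\<in>carrier H. card (length_set H a) = 1)"

definition congruence_half_factorial :: "nat \<Rightarrow> ('a, 'm) monoid_scheme \<Rightarrow> bool" where
  "congruence_half_factorial d H \<longleftrightarrow>
     (\<forall>a\<in>carrier H. \<forall>l\<in>length_set H a. \<forall>l'\<in>length_set H a. [l = l'] (mod d))"

text \<open>The free abelian monoid on \<open>P\<close> is realised inside its quotient group, the free abelian group
  on \<open>P\<close>, as the elements with non-negative coefficients; the basis element given by \<open>p\<close> is
  \<open>frag_of p\<close>.\<close>

definition free_abelian_monoid :: "'p set \<Rightarrow> ('p \<Rightarrow>\<^sub>0 int) monoid" where
  "free_abelian_monoid P = (free_Abelian_group P)
     \<lparr>carrier := {x \<in> carrier (free_Abelian_group P). \<forall>p. 0 \<le> Poly_Mapping.lookup x p}\<rparr>"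

definition divisor_homomorphism ::
    "('a, 'm) monoid_scheme \<Rightarrow> 'p set \<Rightarrow> ('a \<Rightarrow> ('p \<Rightarrow>\<^sub>0 int)) \<Rightarrow> bool" where
  "divisor_homomorphism H P \<phi> \<longleftrightarrow>
     \<phi> \<in> hom H (free_abelian_monoid P) \<and>
     (\<forall>a\<in>carrier H. \<forall>b\<in>carrier H.
        a divides\<^bsub>H\<^esub> b \<longleftrightarrow> \<phi> a divides\<^bsub>free_abelian_monoid P\<^esub> \<phi> b)"

text \<open>Taking the basis inside the element type \<open>'a\<close> is no restriction. The basis can be cut down to
  the elements occurring in \<open>\<phi>(H)\<close>; there are at most \<open>|H|\<close> of them if \<open>H\<close> is infinite, and none if
  \<open>H\<close> is finite, since then \<open>H\<close> is a group.\<close>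

definition krull_monoid :: "('a, 'm) monoid_scheme \<Rightarrow> bool" where
  "krull_monoid H \<longleftrightarrow> comm_monoid_cancel H \<and>
     (\<exists>(P :: 'a set) \<phi>. divisor_homomorphism H P \<phi>)"

text \<open>Greatest common divisors of finite sets are greatest lower bounds for divisibility.\<close>

definition divisor_theory ::
    "('a, 'm) monoid_scheme \<Rightarrow> 'p set \<Rightarrow> ('a \<Rightarrow> ('p \<Rightarrow>\<^sub>0 int)) \<Rightarrow> bool" where
  "divisor_theory H P \<phi> \<longleftrightarrow> divisor_homomorphism H P \<phi> \<and>
     (\<forall>p\<in>P. \<exists>A. finite A \<and> A \<noteq> {} \<and> A \<subseteq> \<phi> ` carrier H \<and>
        is_glb (division_rel (free_abelian_monoid P)) (frag_of p) A)"

text \<open>The subgroup factored out is the quotient group \<open>q(\<phi>(H))\<close> of the image. The library writes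
  factor groups multiplicatively, so the zero class is \<open>\<one>\<close>, and \<open>-g\<close> and \<open>2g\<close> become \<open>inv g\<close> and
  \<open>g [^] 2\<close>.\<close>

definition class_group ::
    "('a, 'm) monoid_scheme \<Rightarrow> 'p set \<Rightarrow> ('a \<Rightarrow> ('p \<Rightarrow>\<^sub>0 int)) \<Rightarrow> ('p \<Rightarrow>\<^sub>0 int) set monoid" where
  "class_group H P \<phi> =
     free_Abelian_group P Mod {\<phi> a - \<phi> b | a b. a \<in> carrier H \<and> b \<in> carrier H}"

definition nonzero_prime_classes ::
    "('a, 'm) monoid_scheme \<Rightarrow> 'p set \<Rightarrow> ('a \<Rightarrow> ('p \<Rightarrow>\<^sub>0 int)) \<Rightarrow> ('p \<Rightarrow>\<^sub>0 int) set set" where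
  "nonzero_prime_classes H P \<phi> =
     {g \<in> carrier (class_group H P \<phi>).
        g \<noteq> \<one>\<^bsub>class_group H P \<phi>\<^esub> \<and> (\<exists>p\<in>P. frag_of p \<in> g)}"

end

theory Submission imports Defs begin

text \<open>Identify the class group with the residues modulo \<open>n\<close>, the zero class being \<open>n\<close> itself.
  Lengths in \<open>H\<close> are lengths of factorizations of zero-sum multisets over the set \<open>G\<close> of classes
  containing primes into minimal ones.

  Fix \<open>g\<close> in \<open>G\<close> of order \<open>m = n / r\<close>. If \<open>S\<close> is minimal among the multisets with sum in the subgroup
  generated by \<open>g\<close>, say with sum \<open>x g\<close> and \<open>1 \<le> x \<le> m\<close>, then \<open>S\<close> together with \<open>m - x\<close> copies of \<open>g\<close>
  is an atom. Hence \<open>d\<close>-congruence half-factoriality makes the total \<open>x\<close>-weight of any splitting of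
  a zero-sum multiset congruent, modulo \<open>d m\<close>, to \<open>m\<close> times the number of atoms. The Davenport
  constants \<open>r\<close> and \<open>m\<close> bound these weights, so that for \<open>r, m \<le> d\<close> the congruences become equalities
  and everything is half-factorial. As \<open>n \<le> 2 d + 4\<close>, only elements of order \<open>1\<close>, \<open>2\<close>, \<open>n / 2\<close> and \<open>n\<close>
  survive.

  If \<open>G\<close> contains a generator, take it as \<open>1\<close>: then every atom has integer sum \<open>s n\<close> with \<open>s \<equiv> 1\<close>
  modulo \<open>d\<close>. Applied to the powers of a single element this leaves the divisors of \<open>n\<close> and at most
  three further residues. If only divisors occurred, every atom would have sum \<open>n\<close> and \<open>H\<close> would be
  half-factorial; with one of the other residues present, a few explicit atoms exclude all but the
  sets in the theorem.\<close>

section \<open>Block monoids over residues\<close>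

text \<open>The bound n \<le> 2 * d + 4 is common to the moduli n - 2, (n - 2) / 2, (n - 3) / 2 and
  (n - 4) / 2, so one analysis in terms of \<open>d\<close> serves the four parts; n \<ge> 250 then
  gives d \<ge> 123, ample room in every linear estimate. Residues are natural numbers in 1..n, not
  elements of a quotient, because the sum of representatives is an additive weight: a congruence
  between lengths modulo \<open>d\<close> lifts to one between integers modulo \<open>d * n\<close>,
  and an integer confined to an interval of that length is then determined. With n representing
  zero, a prime of trivial class is an atom of sum n like many others. The obstacle in the subgroup
  argument is that the weight of a long decomposition exceeds the modulus; only decompositions into
  few pieces fit into one period, and long ones are compared by exchanging pieces. Which generator
  is called 1 is free, so it is a class containing primes whenever one of order n does.\<close>

definition block_atom :: "nat \<Rightarrow> nat multiset \<Rightarrow> bool" where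
  "block_atom n A \<longleftrightarrow> A \<noteq> {#} \<and> n dvd \<Sum>\<^sub># A \<and>
     (\<forall>B. B \<subseteq># A \<longrightarrow> n dvd \<Sum>\<^sub># B \<longrightarrow> B = {#} \<or> B = A)"

definition block_fact :: "nat \<Rightarrow> nat set \<Rightarrow> nat multiset multiset \<Rightarrow> bool" where
  "block_fact n G F \<longleftrightarrow> (\<forall>A\<in>#F. block_atom n A \<and> set_mset A \<subseteq> G)"

text \<open>Congruence modulo \<open>0\<close> is equality, so the case \<open>d = 0\<close> expresses half-factoriality.\<close>

definition block_chf :: "nat \<Rightarrow> nat \<Rightarrow> nat set \<Rightarrow> bool" where
  "block_chf d n G \<longleftrightarrow> (\<forall>F F'. block_fact n G F \<longrightarrow> block_fact n G F' \<longrightarrow>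
     \<Sum>\<^sub># F = \<Sum>\<^sub># F' \<longrightarrow> [size F = size F'] (mod d))"

lemma block_chfD:
  "block_chf d n G \<Longrightarrow> block_fact n G F \<Longrightarrow> block_fact n G F' \<Longrightarrow> \<Sum>\<^sub># F = \<Sum>\<^sub># F'
    \<Longrightarrow> [size F = size F'] (mod d)"
  unfolding block_chf_def by blast

lemma block_fact_simps [simp]:
  "block_fact n G {#}"
  "block_fact n G (add_mset A F) \<longleftrightarrow> block_atom n A \<and> set_mset A \<subseteq> G \<and> block_fact n G F"
  "block_fact n G (F + F') \<longleftrightarrow> block_fact n G F \<and> block_fact n G F'"
  by (auto simp: block_fact_def)

lemma block_fact_replicate:
  "block_atom n A \<Longrightarrow> set_mset A \<subseteq> G \<Longrightarrow> block_fact n G (replicate_mset k A)"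
  by (auto simp: block_fact_def split: if_splits)

lemma block_atomI:
  assumes "A \<noteq> {#}" "n dvd \<Sum>\<^sub># A"
    and "\<And>B. B \<subseteq># A \<Longrightarrow> n dvd \<Sum>\<^sub># B \<Longrightarrow> B \<noteq> {#} \<Longrightarrow> B = A"
  shows "block_atom n A"
  using assms unfolding block_atom_def by blast

lemma block_atomD:
  "block_atom n A \<Longrightarrow> B \<subseteq># A \<Longrightarrow> n dvd \<Sum>\<^sub># B \<Longrightarrow> B \<noteq> {#} \<Longrightarrow> B = A"
  unfolding block_atom_def by blast

lemma block_atom_dvd: "block_atom n A \<Longrightarrow> n dvd \<Sum>\<^sub># A"
  and block_atom_nonempty: "block_atom n A \<Longrightarrow> A \<noteq> {#}"
  by (simp_all add: block_atom_def)

lemma dvd_sum_mset_diff: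
  fixes n :: nat
  assumes "C \<subseteq># B" "n dvd \<Sum>\<^sub># B" "n dvd \<Sum>\<^sub># C"
  shows "n dvd \<Sum>\<^sub># (B - C)"
proof -
  have "\<Sum>\<^sub># B = \<Sum>\<^sub># C + \<Sum>\<^sub># (B - C)"
    using assms(1) by (metis subset_mset.add_diff_inverse sum_mset.union)
  then show ?thesis using assms(2,3) by (simp add: dvd_add_right_iff)
qed

lemma sum_Union_mset: "\<Sum>\<^sub># (\<Sum>\<^sub># F) = (\<Sum>A\<in>#F. \<Sum>\<^sub># A)" for F :: "nat multiset multiset"
  by (induction F) auto

lemma subset_mset_plus_split:
  assumes "T \<subseteq># A + B"
  obtains T1 T2 where "T = T1 + T2" "T1 \<subseteq># A" "T2 \<subseteq># B"
proof
  show "T = (T \<inter># A) + (T - A)"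
    by (auto simp: multiset_eq_iff)
  show "T \<inter># A \<subseteq># A" by simp
  show "T - A \<subseteq># B" using assms by (simp add: subset_eq_diff_conv add.commute)
qed

lemma subset_replicate_msetE:
  assumes "T \<subseteq># replicate_mset k a"
  obtains j where "j \<le> k" "T = replicate_mset j a"
  using assms by (metis msubseteq_replicate_msetE)

lemma ex_block_fact:
  assumes "set_mset B \<subseteq> G" "n dvd \<Sum>\<^sub># B"
  shows "\<exists>F. block_fact n G F \<and> \<Sum>\<^sub># F = B"
  using assms
proof (induction "size B" arbitrary: B rule: less_induct)
  case less
  show ?case
  proof (cases "B = {#}")
    case True
    then show ?thesis by (intro exI[of _ "{#}"]) auto
  next
    case nonempty: False
    show ?thesis
    proof (cases "block_atom n B")
      case True
      then show ?thesis using less.prems by (intro exI[of _ "{#B#}"]) auto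
    next
      case False
      then obtain C where C: "C \<subseteq># B" "n dvd \<Sum>\<^sub># C" "C \<noteq> {#}" "C \<noteq> B"
        using nonempty less.prems unfolding block_atom_def by blast
      have B: "B = C + (B - C)" using C(1) by simp
      have "n dvd \<Sum>\<^sub># (B - C)"
        by (rule dvd_sum_mset_diff[OF C(1) less.prems(2) C(2)])
      moreover have "size C < size B" using C by (simp add: mset_subset_size subset_mset.less_le)
      moreover have "size (B - C) < size B"
        using C(1,3) size_mset_mono[OF C(1)] nonempty
        by (simp add: size_Diff_submset nonempty_has_size)
      moreover have "set_mset C \<subseteq> G" "set_mset (B - C) \<subseteq> G"
        using less.prems(1) C(1) by (auto dest: in_diffD mset_subset_eqD)
      ultimately obtain F F' where "block_fact n G F" "\<Sum>\<^sub># F = C"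
        "block_fact n G F'" "\<Sum>\<^sub># F' = B - C"
        using less.hyps C(2) by metis
      then show ?thesis using B by (intro exI[of _ "F + F'"]) auto
    qed
  qed
qed

text \<open>The Davenport constant of a cyclic group of order \<open>r\<close> is at most
  \<open>r\<close>: if there are more than \<open>r\<close> elements, two of the prefix sums at
  positions 0, ..., r agree modulo \<open>r\<close>, and the stretch between them is a zero-sum part
  of length at most \<open>r\<close>, hence proper.\<close>

lemma block_atom_size_le:
  assumes "block_atom r A" "r > 0"
  shows "size A \<le> r"
proof (rule ccontr)
  assume "\<not> size A \<le> r"
  obtain xs where xs: "mset xs = A" using ex_mset by blast
  then have len: "length xs > r" using \<open>\<not> size A \<le> r\<close> by auto
  have "\<not> inj_on (\<lambda>i. sum_list (take i xs) mod r) {..r}"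
  proof
    assume "inj_on (\<lambda>i. sum_list (take i xs) mod r) {..r}"
    then have "card {..r} \<le> card {..<r}"
      by (rule card_inj_on_le) (use assms(2) in auto)
    then show False by simp
  qed
  then obtain i j where ij: "i < j" "j \<le> r"
    "sum_list (take i xs) mod r = sum_list (take j xs) mod r"
    unfolding inj_on_def by (metis atMost_iff linorder_neqE_nat)
  define ys where "ys = drop i (take j xs)"
  have tk: "take j xs = take i xs @ ys"
    using ij(1) by (metis append_take_drop_id less_imp_le min.absorb1 take_take ys_def)
  have "r dvd sum_list (take j xs) - sum_list (take i xs)"
    using ij(3) tk by (metis mod_eq_dvd_iff_nat le_add1 sum_list_append)
  then have "r dvd sum_list ys" by (simp add: tk)
  moreover have xs': "xs = take i xs @ ys @ drop j xs"
    using tk by (metis append.assoc append_take_drop_id)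
  moreover have "mset ys \<subseteq># A"
    unfolding xs[symmetric] by (subst xs') auto
  moreover have "length ys = j - i" using ij len by (simp add: ys_def)
  ultimately have "mset ys = A"
    using block_atomD[OF assms(1), of "mset ys"] ij by (force simp: sum_mset_sum_list)
  then have "length ys = length xs" using xs by (metis size_mset)
  then show False using \<open>length ys = j - i\<close> ij len by linarith
qed

text \<open>An additive weight counts atoms: its total over the product is \<open>N\<close> times
  the length modulo \<open>N * d\<close>, for each factorization, and the factor \<open>N\<close>
  cancels. With \<open>d = 0\<close> this proves half-factoriality, with positive \<open>d\<close>
  the sufficiency of the conditions in the theorem.\<close>

lemma block_chf_weights:
  assumes "N > 0"
    and "\<And>A. block_atom n A \<Longrightarrow> set_mset A \<subseteq> G \<Longrightarrow> [(\<Sum>a\<in>#A. w a) = N] (mod N * d)"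
  shows "block_chf d n G"
  unfolding block_chf_def
proof (intro allI impI)
  have w: "[(\<Sum>a\<in>#\<Sum>\<^sub># F. w a) = N * size F] (mod N * d)" if "block_fact n G F" for F
    using that
  proof (induction F)
    case (add A F)
    then show ?case using cong_add[OF assms(2)[of A] add.IH] by simp
  qed simp
  fix F F' assume "block_fact n G F" "block_fact n G F'" "\<Sum>\<^sub># F = \<Sum>\<^sub># F'"
  then have "[N * size F = N * size F'] (mod N * d)"
    using w[of F] w[of F'] by (metis cong_sym cong_trans)
  then show "[size F = size F'] (mod d)"
    using assms(1) by (simp add: cong_def mod_mult_mult1)
qed

section \<open>Additive values are determined by short decompositions\<close>

lemma subset_Union_mset:
  assumes "U \<subseteq># \<Sum>\<^sub># F"
  shows "\<exists>F'. F' \<subseteq># F \<and> size F' \<le> size U \<and> U \<subseteq># \<Sum>\<^sub># F'"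
  using assms
proof (induction F arbitrary: U)
  case empty
  then show ?case by (intro exI[of _ "{#}"]) auto
next
  case (add S F)
  then have "U \<subseteq># S + \<Sum>\<^sub># F" by simp
  then obtain U1 U2 where U: "U = U1 + U2" "U1 \<subseteq># S" "U2 \<subseteq># \<Sum>\<^sub># F"
    by (rule subset_mset_plus_split)
  then obtain F' where F': "F' \<subseteq># F" "size F' \<le> size U2" "U2 \<subseteq># \<Sum>\<^sub># F'"
    using add.IH by blast
  show ?case
  proof (cases "U1 = {#}")
    case True
    then show ?thesis using F' U by (intro exI[of _ F'])
      (auto intro: subset_mset.order_trans)
  next
    case False
    then have "size U1 \<ge> 1" by (simp add: Suc_leI nonempty_has_size)
    then show ?thesis using F' U
      by (intro exI[of _ "add_mset S F'"]) (auto intro: subset_mset.add_mono)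
  qed
qed

text \<open>Two decompositions with a common atom are compared by cancelling it and using induction
  on the size of the product. A decomposition with more than \<open>r\<close> atoms is linked to any
  other through a third one that shares an atom with each; the Davenport bound \<open>r\<close> on
  the size of an atom is what leaves room for this.\<close>

lemma block_fact_value_unique:
  fixes f :: "nat multiset \<Rightarrow> nat"
  assumes "r > 0"
    and small: "\<And>F F'. block_fact r G F \<Longrightarrow> block_fact r G F' \<Longrightarrow> \<Sum>\<^sub># F = \<Sum>\<^sub># F' \<Longrightarrow>
      size F \<le> r \<Longrightarrow> size F' \<le> r \<Longrightarrow> (\<Sum>S\<in>#F. f S) = (\<Sum>S\<in>#F'. f S)"
    and "block_fact r G F" "block_fact r G F'" "\<Sum>\<^sub># F = \<Sum>\<^sub># F'"
  shows "(\<Sum>S\<in>#F. f S) = (\<Sum>S\<in>#F'. f S)"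
  using assms(3-5)
proof (induction "size (\<Sum>\<^sub># F)" arbitrary: F F' rule: less_induct)
  case less
  have share: "(\<Sum>S\<in>#K. f S) = (\<Sum>S\<in>#L. f S)"
    if prm: "W \<in># K" "W \<in># L" "block_fact r G K" "block_fact r G L"
      "\<Sum>\<^sub># K = \<Sum>\<^sub># F" "\<Sum>\<^sub># L = \<Sum>\<^sub># F" for W K L
  proof -
    obtain K' L' where KL: "K = add_mset W K'" "L = add_mset W L'"
      using prm(1,2) by (meson multi_member_split)
    have "W \<noteq> {#}" using prm(3) KL by (auto simp: block_atom_def)
    then have lt: "size (\<Sum>\<^sub># K') < size (\<Sum>\<^sub># F)"
      unfolding prm(5)[symmetric] KL by (simp add: nonempty_has_size)
    have "W + \<Sum>\<^sub># K' = W + \<Sum>\<^sub># L'"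
    proof (rule trans[OF _ sym])
      show "W + \<Sum>\<^sub># K' = \<Sum>\<^sub># F" using prm(5) KL(1) by simp
      show "W + \<Sum>\<^sub># L' = \<Sum>\<^sub># F" using prm(6) KL(2) by simp
    qed
    then have eq: "\<Sum>\<^sub># K' = \<Sum>\<^sub># L'" by (rule add_left_imp_eq)
    have "block_fact r G K'" "block_fact r G L'" using prm(3,4) KL by auto
    then show ?thesis using less.hyps[OF lt _ _ eq] KL by simp
  qed
  have large: "(\<Sum>S\<in>#K. f S) = (\<Sum>S\<in>#L. f S)"
    if K: "block_fact r G K" "\<Sum>\<^sub># K = \<Sum>\<^sub># F" "size K > r"
      and L: "block_fact r G L" "\<Sum>\<^sub># L = \<Sum>\<^sub># F" for K L
  proof -
    obtain W0 where "W0 \<in># K" using K(3) by fastforce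
    then have "\<Sum>\<^sub># K \<noteq> {#}" using K(1) by (auto simp: block_fact_def block_atom_def)
    then obtain U where U: "U \<in># L" using K(2) L(2) by fastforce
    then have Uat: "block_atom r U" "set_mset U \<subseteq> G" using L(1) by (auto simp: block_fact_def)
    obtain L' where "L = add_mset U L'" using U by (meson multi_member_split)
    then have "U \<subseteq># \<Sum>\<^sub># L" by simp
    then have "U \<subseteq># \<Sum>\<^sub># K" by (simp only: K(2) L(2))
    then obtain K' where K': "K' \<subseteq># K" "size K' \<le> size U" "U \<subseteq># \<Sum>\<^sub># K'"
      using subset_Union_mset by blast
    have "size K' \<le> r" using K'(2) block_atom_size_le[OF Uat(1) assms(1)] by simp
    define K2 where "K2 = K - K'"
    have Keq: "K = K' + K2" using K'(1) by (simp add: K2_def)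
    have "K2 \<noteq> {#}" using \<open>size K' \<le> r\<close> K(3) Keq by auto
    then obtain W where W: "W \<in># K2" by blast
    have bK: "block_fact r G K'" "block_fact r G K2" using K(1) Keq by auto
    have "r dvd \<Sum>\<^sub># (\<Sum>\<^sub># K')"
      using bK(1) by (induction K') (auto simp: block_atom_def)
    then have "r dvd \<Sum>\<^sub># (\<Sum>\<^sub># K' - U)"
      using block_atom_dvd[OF Uat(1)] dvd_sum_mset_diff[OF K'(3)] by blast
    moreover have "set_mset (\<Sum>\<^sub># K' - U) \<subseteq> G"
      using bK(1) by (auto simp: block_fact_def dest!: in_diffD)
    ultimately obtain V where V: "block_fact r G V" "\<Sum>\<^sub># V = \<Sum>\<^sub># K' - U"
      using ex_block_fact by blast
    have eq: "\<Sum>\<^sub># K' = U + (\<Sum>\<^sub># K' - U)" using K'(3) by simp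
    define Q where "Q = add_mset U V + K2"
    have "\<Sum>\<^sub># Q = (U + (\<Sum>\<^sub># K' - U)) + \<Sum>\<^sub># K2" using V(2) by (simp add: Q_def)
    also have "\<dots> = \<Sum>\<^sub># K" unfolding eq[symmetric] by (simp add: Keq)
    finally have Q: "block_fact r G Q" "\<Sum>\<^sub># Q = \<Sum>\<^sub># F"
      using V(1) bK(2) Uat K(2) by (simp_all add: Q_def)
    have "(\<Sum>S\<in>#K. f S) = (\<Sum>S\<in>#Q. f S)"
      using share[of W K Q] W K Q Keq by (auto simp: Q_def)
    also have "\<dots> = (\<Sum>S\<in>#L. f S)"
      using share[of U Q L] U L Q by (auto simp: Q_def)
    finally show ?thesis .
  qed
  show ?case
    using small[of F F'] large[of F F'] large[of F' F] less.prems by (metis linorder_not_le)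
qed

section \<open>Atoms modulo a subgroup\<close>

lemma dvd_mult_gcd_iff:
  fixes n g :: nat
  assumes "n > 0"
  shows "n dvd j * g \<longleftrightarrow> n div gcd g n dvd j"
proof -
  obtain g' m where gm: "g = g' * gcd g n" "n = m * gcd g n" "coprime g' m"
    using gcd_coprime_exists[of g n] assms by auto
  define r where "r = gcd g n"
  have r: "r > 0" using assms by (simp add: r_def)
  have "n div r = m" using gm(2) r by (metis r_def nonzero_mult_div_cancel_right less_not_refl)
  moreover have "n dvd j * g \<longleftrightarrow> m * r dvd (j * g') * r"
    using gm r_def by (metis mult.assoc)
  moreover have "\<dots> \<longleftrightarrow> m dvd j * g'" using r by simp
  moreover have "\<dots> \<longleftrightarrow> m dvd j" using gm(3) coprime_commute coprime_dvd_mult_left_iff by blast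
  ultimately show ?thesis by (simp add: r_def)
qed

lemma block_atom_replicate:
  assumes "n > 0"
  shows "block_atom n (replicate_mset (n div gcd g n) g)"
proof (rule block_atomI)
  have m: "n div gcd g n > 0" using assms by (simp add: div_greater_zero_iff)
  then show "replicate_mset (n div gcd g n) g \<noteq> {#}" by simp
  show "n dvd \<Sum>\<^sub># (replicate_mset (n div gcd g n) g)"
    using dvd_mult_gcd_iff[OF assms] by (simp add: sum_mset_replicate_mset)
  fix B assume B: "B \<subseteq># replicate_mset (n div gcd g n) g" "n dvd \<Sum>\<^sub># B" "B \<noteq> {#}"
  obtain j where j: "j \<le> n div gcd g n" "B = replicate_mset j g"
    using B(1) by (rule subset_replicate_msetE)
  then have "n div gcd g n dvd j" "j > 0"
    using B dvd_mult_gcd_iff[OF assms] by auto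
  then have "j = n div gcd g n" using j(1) dvd_imp_le by (simp add: le_antisym)
  then show "B = replicate_mset (n div gcd g n) g" using j(2) by simp
qed

lemma subset_mset_plus_replicateE:
  assumes "B \<subseteq># A + replicate_mset k g"
  obtains B1 j where "B = B1 + replicate_mset j g" "B1 \<subseteq># A" "j \<le> k"
proof -
  obtain B1 B2 where B: "B = B1 + B2" "B1 \<subseteq># A" "B2 \<subseteq># replicate_mset k g"
    using assms by (rule subset_mset_plus_split)
  obtain j where "j \<le> k" "B2 = replicate_mset j g" using B(3) by (rule subset_replicate_msetE)
  with B(1,2) show thesis by (intro that) simp_all
qed

lemma replicate_mset_add: "replicate_mset (i + j) a = replicate_mset i a + replicate_mset j a"
  by (simp add: multiset_eq_iff)

text \<open>The multiples of \<open>r\<close> are, modulo \<open>n\<close>, the subgroup generated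
  by \<open>g\<close>, of order \<open>m\<close>, and \<open>x y\<close> is the index of
  \<open>y\<close> with respect to \<open>g\<close>. Taking it in 1..m rather than 0..m - 1 gives
  every block positive weight, and fewer than \<open>m\<close> copies of \<open>g\<close> complete a
  block, too few to contain a zero-sum part of their own.\<close>

locale index_map =
  fixes n g m r d :: nat and G :: "nat set" and x :: "nat \<Rightarrow> nat"
  assumes n_pos: "n > 0" and r_def: "r = gcd g n" and n_eq: "n = m * r" and g_in: "g \<in> G"
    and chf: "block_chf d n G"
    and x_bounds: "\<And>y. r dvd y \<Longrightarrow> 1 \<le> x y \<and> x y \<le> m"
    and x_cong: "\<And>y. r dvd y \<Longrightarrow> [x y * g = y] (mod n)"
begin

definition weight :: "nat multiset multiset \<Rightarrow> nat" where
  "weight F = (\<Sum>S\<in>#F. x (\<Sum>\<^sub># S))"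

lemma r_pos: "r > 0" using n_pos by (simp add: r_def)

lemma m_pos: "m > 0" using n_pos unfolding n_eq by simp

lemma m_eq: "m = n div gcd g n"
  unfolding r_def[symmetric] using r_pos by (subst n_eq) simp

lemma r_dvd_g: "r dvd g" and r_dvd_n: "r dvd n" by (simp_all add: r_def)

lemma dvd_mult_g_iff: "n dvd j * g \<longleftrightarrow> m dvd j"
  using dvd_mult_gcd_iff[OF n_pos, of j g] m_eq by simp

lemma weight_simps [simp]:
  "weight {#} = 0" "weight (add_mset S F) = x (\<Sum>\<^sub># S) + weight F"
  "weight (F + F') = weight F + weight F'"
  by (simp_all add: weight_def)

lemma weight_cong:
  assumes "block_fact r G F"
  shows "[weight F * g = \<Sum>\<^sub># (\<Sum>\<^sub># F)] (mod n)"
  using assms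
proof (induction F)
  case (add S F)
  then have "r dvd \<Sum>\<^sub># S" by (auto dest: block_atom_dvd)
  then show ?case using cong_add[OF x_cong add.IH] add.prems by (simp add: distrib_right)
qed simp

lemma weight_bounds:
  assumes "block_fact r G F"
  shows "size F \<le> weight F" "weight F \<le> m * size F"
  using assms
proof (induction F)
  case (add S F)
  {
    case 1
    then have "r dvd \<Sum>\<^sub># S" by (auto dest: block_atom_dvd)
    then show ?case using add.IH x_bounds[of "\<Sum>\<^sub># S"] 1 by simp
  next
    case 2
    then have "r dvd \<Sum>\<^sub># S" by (auto dest: block_atom_dvd)
    then show ?case using add.IH x_bounds[of "\<Sum>\<^sub># S"] 2 by simp
  }
qed auto

text \<open>The part of a zero-sum subset that lies in \<open>S\<close> has sum divisible by
  \<open>r\<close>, since \<open>g\<close> and \<open>n\<close> are, so it is empty or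
  \<open>S\<close>. In the first case fewer than \<open>m\<close> copies of \<open>g\<close> would
  have to sum to zero; in the second all \<open>m - x\<close> copies are required.\<close>

lemma extended_block_atom:
  assumes S: "block_atom r S"
  shows "block_atom n (S + replicate_mset (m - x (\<Sum>\<^sub># S)) g)"
proof (rule block_atomI)
  let ?x = "x (\<Sum>\<^sub># S)"
  have rS: "r dvd \<Sum>\<^sub># S" using S by (rule block_atom_dvd)
  have xb: "1 \<le> ?x" "?x \<le> m" using x_bounds[OF rS] by auto
  have iff: "n dvd \<Sum>\<^sub># S + j * g \<longleftrightarrow> m dvd ?x + j" for j
  proof -
    have "[(?x + j) * g = \<Sum>\<^sub># S + j * g] (mod n)"
      using cong_add[OF x_cong[OF rS] cong_refl[of "j * g" n]] by (simp add: distrib_right)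
    then show ?thesis using cong_dvd_iff dvd_mult_g_iff by blast
  qed
  show "S + replicate_mset (m - ?x) g \<noteq> {#}" using S block_atom_nonempty by auto
  show "n dvd \<Sum>\<^sub># (S + replicate_mset (m - ?x) g)"
    using iff[of "m - ?x"] xb by (simp add: sum_mset_replicate_mset)
  fix B assume B: "B \<subseteq># S + replicate_mset (m - ?x) g" "n dvd \<Sum>\<^sub># B" "B \<noteq> {#}"
  obtain B1 j where B12: "B = B1 + replicate_mset j g" "B1 \<subseteq># S" "j \<le> m - ?x"
    using B(1) by (rule subset_mset_plus_replicateE)
  have nB: "n dvd \<Sum>\<^sub># B1 + j * g" using B(2) by (simp add: B12(1) sum_mset_replicate_mset)
  then have "r dvd \<Sum>\<^sub># B1 + j * g" using r_dvd_n dvd_trans by blast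
  then have "r dvd \<Sum>\<^sub># B1" using r_dvd_g dvd_add_left_iff dvd_mult by blast
  then consider "B1 = {#}" | "B1 = S" using block_atomD[OF S B12(2)] by blast
  then show "B = S + replicate_mset (m - ?x) g"
  proof cases
    case 1
    then have "m dvd j" using nB dvd_mult_g_iff by simp
    moreover have "j < m" using B12(3) xb by linarith
    ultimately have "j = 0" using nat_dvd_not_less by blast
    then show ?thesis using B(3) B12(1) 1 by simp
  next
    case 2
    then have "m dvd ?x + j" using nB iff by simp
    then have "m \<le> ?x + j" using xb by (intro dvd_imp_le) auto
    then have "j = m - ?x" using B12(3) by linarith
    then show ?thesis using B12(1) 2 by simp
  qed
qed

text \<open>Completing each block of \<open>F\<close> by copies of \<open>g\<close> gives
  \<open>size F\<close> atoms. The same product arises from \<open>A\<close> and the added copies,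
  whose number is a multiple \<open>m * c\<close> and which form \<open>c\<close> atoms of
  \<open>m\<close> copies each. Thus \<open>size F\<close> is congruent to \<open>size A + c\<close>
  modulo \<open>d\<close>; multiplication by \<open>m\<close> and
  \<open>p F + weight F = m * size F\<close> eliminate \<open>c\<close>.\<close>

lemma weight_block_fact:
  assumes F: "block_fact r G F" and A: "block_fact n G A" and eq: "\<Sum>\<^sub># F = \<Sum>\<^sub># A"
  shows "[weight F = m * size A] (mod d * m)"
proof -
  \<comment> \<open>\<open>p F\<close> is the number of copies of \<open>g\<close> that complete all
    blocks of \<open>F\<close>, and \<open>ext F\<close> consists of the completed blocks.\<close>
  define p where "p = (\<lambda>F. \<Sum>S\<in>#F. m - x (\<Sum>\<^sub># S))"
  define ext where "ext = image_mset (\<lambda>S. S + replicate_mset (m - x (\<Sum>\<^sub># S)) g)"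
  have ext: "block_fact n G (ext F) \<and> \<Sum>\<^sub># (ext F) = \<Sum>\<^sub># F + replicate_mset (p F) g \<and>
      p F + weight F = m * size F"
    using F
  proof (induction F)
    case (add S F)
    have xle: "x (\<Sum>\<^sub># S) \<le> m"
      using add.prems x_bounds[of "\<Sum>\<^sub># S"] block_atom_dvd[of r S] by simp
    have padd: "p (add_mset S F) = (m - x (\<Sum>\<^sub># S)) + p F" by (simp add: p_def)
    then have rep: "replicate_mset (p (add_mset S F)) g =
        replicate_mset (m - x (\<Sum>\<^sub># S)) g + replicate_mset (p F) g"
      by (simp only: replicate_mset_add)
    define S' where "S' = S + replicate_mset (m - x (\<Sum>\<^sub># S)) g"
    have ext_add: "ext (add_mset S F) = add_mset S' (ext F)" by (simp add: ext_def S'_def)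
    have S: "block_atom r S" "set_mset S \<subseteq> G" and F: "block_fact r G F" using add.prems by auto
    have "block_atom n S'" using extended_block_atom[OF S(1)] by (simp add: S'_def)
    moreover have "set_mset S' \<subseteq> G" using S(2) g_in by (auto simp: S'_def)
    ultimately have "block_fact n G (ext (add_mset S F))" using add.IH[OF F] ext_add by simp
    moreover have "\<Sum>\<^sub># (ext (add_mset S F)) = \<Sum>\<^sub># (add_mset S F) + replicate_mset (p (add_mset S F)) g"
      unfolding rep ext_add sum_mset.add_mset using add.IH[OF F] by (simp add: S'_def)
    moreover have "p (add_mset S F) + weight (add_mset S F) = m * size (add_mset S F)"
      using add.IH[OF F] xle padd by simp
    ultimately show ?case by blast
  qed (simp add: ext_def p_def)
  have "n dvd \<Sum>\<^sub># (\<Sum>\<^sub># A)"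
    using A by (induction A) (auto dest: block_atom_dvd)
  then have "n dvd weight F * g"
    using cong_dvd_iff[OF weight_cong[OF F]] eq by simp
  then have "m dvd weight F" by (simp add: dvd_mult_g_iff)
  moreover have "m dvd p F + weight F" using ext by simp
  ultimately have "m dvd p F" by (simp add: dvd_add_left_iff)
  then obtain c where c: "p F = m * c" by blast
  define A' where "A' = A + replicate_mset c (replicate_mset m g)"
  have "block_fact n G (replicate_mset c (replicate_mset m g))"
    using block_atom_replicate[OF n_pos, of g] g_in m_eq m_pos
    by (intro block_fact_replicate) auto
  then have "block_fact n G A'" using A by (simp add: A'_def)
  moreover have "\<Sum>\<^sub># (replicate_mset k (replicate_mset m g)) = replicate_mset (m * k) g" for k
  proof (induction k)
    case (Suc k)
    then have "\<Sum>\<^sub># (replicate_mset (Suc k) (replicate_mset m g)) =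
        replicate_mset m g + replicate_mset (m * k) g" by simp
    then show ?case by (simp only: mult_Suc_right replicate_mset_add)
  qed simp
  then have "\<Sum>\<^sub># A' = \<Sum>\<^sub># (ext F)"
    using ext eq c by (simp add: A'_def)
  ultimately have "[size (ext F) = size A'] (mod d)"
    using ext block_chfD[OF chf, of "ext F" A'] by simp
  then have "[size F = size A + c] (mod d)" by (simp add: A'_def ext_def)
  then have "[m * size F = m * (size A + c)] (mod m * d)"
    by (simp add: cong_def mult_mod_right[symmetric] del: distrib_left)
  moreover have "m * size F = weight F + m * c" using ext c by simp
  ultimately have "[weight F + m * c = m * size A + m * c] (mod m * d)"
    by (simp add: distrib_left)
  then show ?thesis by (simp add: cong_add_rcancel_nat mult.commute)
qed

end

lemma ex_index:
  fixes n g m r :: nat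
  assumes "n > 0" "r = gcd g n" "n = m * r"
  shows "\<exists>x. \<forall>y. r dvd y \<longrightarrow> 1 \<le> x y \<and> x y \<le> m \<and> [x y * g = y] (mod n)"
proof -
  have m: "m > 0" using assms(1,3) by (cases m) auto
  have mg: "n dvd m * g" using assms by (metis dvd_refl gcd_dvd1 mult_dvd_mono)
  have "\<exists>k. 1 \<le> k \<and> k \<le> m \<and> [k * g = y] (mod n)" if y: "r dvd y" for y
  proof -
    obtain v where "[g * v = r] (mod n)" using cong_solve_nat[of g n] assms(1,2) by auto
    then have "[y div r * (g * v) = y div r * r] (mod n)" by (rule cong_scalar_left)
    then have v: "[(y div r * v) * g = y] (mod n)" using y by (simp add: ac_simps)
    \<comment> \<open>The index 0 is replaced by \<open>m\<close>, so that \<open>k\<close> lies in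
      1..m.\<close>
    define k where "k = (y div r * v) mod m + (if m dvd y div r * v then m else 0)"
    have dec: "y div r * v + (if m dvd y div r * v then m else 0) = k + m * (y div r * v div m)"
      by (simp add: k_def)
    have drop: "[(j + m * q) * g = j * g] (mod n)" for j q
    proof -
      have "n dvd m * q * g" using dvd_mult2[OF mg, of q] by (simp add: mult_ac)
      then show ?thesis
        using cong_add[OF cong_refl[of "j * g" n], of "m * q * g" 0] by (simp add: distrib_right cong_0_iff)
    qed
    obtain q where q: "(if m dvd y div r * v then m else 0) = m * q"
      by (cases "m dvd y div r * v") auto
    then have "[k * g = (y div r * v) * g] (mod n)"
      using cong_trans[OF cong_sym[OF drop[of k "y div r * v div m"]]]
        drop[of "y div r * v" q] by (simp only: dec[unfolded q, symmetric])
    then have "[k * g = y] (mod n)" using v by (rule cong_trans)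
    moreover have "1 \<le> k" "k \<le> m"
      using m by (auto simp: k_def dvd_eq_mod_eq_0 Suc_le_eq less_imp_le)
    ultimately show ?thesis by blast
  qed
  then show ?thesis by metis
qed

lemma sub_image_mset:
  assumes "B \<subseteq># image_mset f F"
  obtains F' where "F' \<subseteq># F" "B = image_mset f F'"
proof -
  have "image_mset f F = B + (image_mset f F - B)" using assms by simp
  then obtain F' F'' where "F = F' + F''" "image_mset f F' = B"
    using image_mset_eq_plusD by blast
  then show thesis by (intro that[of F']) auto
qed

lemma block_fact_sum_empty:
  assumes "block_fact n G F" "\<Sum>\<^sub># F = {#}"
  shows "F = {#}"
  using assms by (cases F) (auto dest: block_atom_nonempty)

lemma cong_interval_eq:
  fixes a b :: nat
  assumes "[a = b] (mod N)" "1 \<le> a" "a \<le> N" "1 \<le> b" "b \<le> N"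
  shows "a = b"
proof (cases "a \<le> b")
  case True
  then have "N dvd b - a" using assms(1) by (metis cong_altdef_nat cong_sym)
  then show ?thesis using True assms by (auto dest!: dvd_imp_le)
next
  case False
  then have "N dvd a - b" using assms(1) by (simp add: cong_altdef_nat)
  then show ?thesis using False assms by (auto dest!: dvd_imp_le)
qed

context index_map
begin

text \<open>The product of \<open>F\<close> need not be zero-sum modulo \<open>n\<close>, so
  \<open>weight_block_fact\<close> does not apply to it. Since the sum is
  \<open>weight F * g\<close> modulo \<open>n\<close>, adding \<open>(m - 1) * weight F\<close>
  copies of \<open>g\<close> makes it a multiple of \<open>m * g\<close>. Both padded decompositions
  are then compared with one factorization \<open>A\<close>, and the weight of the padding
  cancels.\<close>

lemma weight_cong_unique:
  assumes F: "block_fact r G F" and F': "block_fact r G F'" and eq: "\<Sum>\<^sub># F = \<Sum>\<^sub># F'"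
  shows "[weight F = weight F'] (mod d * m)"
proof -
  define J where "J = replicate_mset ((m - 1) * weight F) {#g#}"
  have "block_atom r {#g#}"
    using r_dvd_g by (auto simp: block_atom_def subset_mset.le_less dest!: mset_subset_size)
  then have J: "block_fact r G J" using g_in by (auto simp: J_def intro: block_fact_replicate)
  have sJ: "\<Sum>\<^sub># (\<Sum>\<^sub># J) = (m - 1) * weight F * g"
    unfolding J_def by (induction "(m - 1) * weight F") (simp_all add: sum_Union_mset)
  have "[\<Sum>\<^sub># (\<Sum>\<^sub># (F + J)) = weight F * g + (m - 1) * weight F * g] (mod n)"
    using cong_add[OF cong_sym[OF weight_cong[OF F]] cong_refl] sJ by simp
  moreover have "weight F * g + (m - 1) * weight F * g = (m * weight F) * g"
    using m_pos by (cases m) (simp_all add: algebra_simps)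
  ultimately have dvd: "n dvd \<Sum>\<^sub># (\<Sum>\<^sub># (F + J))"
    using cong_dvd_iff[of _ _ n] dvd_mult_g_iff[of "m * weight F"] by auto
  moreover have "set_mset (\<Sum>\<^sub># (F + J)) \<subseteq> G"
    using F J by (auto simp: block_fact_def)
  ultimately obtain A where A: "block_fact n G A" "\<Sum>\<^sub># A = \<Sum>\<^sub># (F + J)"
    using ex_block_fact by blast
  have "\<Sum>\<^sub># (F + J) = \<Sum>\<^sub># A" "\<Sum>\<^sub># (F' + J) = \<Sum>\<^sub># A" using A(2) eq by simp_all
  moreover have "block_fact r G (F + J)" "block_fact r G (F' + J)" using F F' J by simp_all
  ultimately have "[weight (F + J) = weight (F' + J)] (mod d * m)"
    using weight_block_fact[of _ A] A(1) by (metis cong_sym cong_trans)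
  then show ?thesis by (simp add: cong_add_rcancel_nat)
qed

text \<open>Nonempty decompositions into at most \<open>r\<close> blocks have weights between 1 and
  \<open>r * m\<close>, hence within one period \<open>d * m\<close>, and congruent weights are
  equal. Longer decompositions follow from \<open>block_fact_value_unique\<close>.\<close>

lemma weight_unique:
  assumes "r \<le> d" and F: "block_fact r G F" and F': "block_fact r G F'" and eq: "\<Sum>\<^sub># F = \<Sum>\<^sub># F'"
  shows "weight F = weight F'"
  unfolding weight_def
proof (rule block_fact_value_unique[OF r_pos _ F F' eq])
  fix K K' assume K: "block_fact r G K" and K': "block_fact r G K'" and eq: "\<Sum>\<^sub># K = \<Sum>\<^sub># K'"
    and sz: "size K \<le> r" "size K' \<le> r"
  have "weight K = weight K'"
  proof (cases "K = {#} \<or> K' = {#}")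
    case True
    then show ?thesis using block_fact_sum_empty[OF K] block_fact_sum_empty[OF K'] eq by auto
  next
    case False
    have b: "1 \<le> weight L \<and> weight L \<le> d * m"
      if "block_fact r G L" "size L \<le> r" "L \<noteq> {#}" for L
    proof
      show "1 \<le> weight L" using weight_bounds(1)[OF that(1)] that(3)
        by (metis One_nat_def Suc_le_eq le_trans nonempty_has_size)
      have "weight L \<le> m * d"
        using weight_bounds(2)[OF that(1)] that(2) assms(1) by (meson le_trans mult_le_mono2)
      then show "weight L \<le> d * m" by (simp add: mult.commute)
    qed
    show ?thesis
      using cong_interval_eq[OF weight_cong_unique[OF K K' eq]] b K K' sz False by blast
  qed
  then show "(\<Sum>S\<in>#K. x (\<Sum>\<^sub># S)) = (\<Sum>S\<in>#K'. x (\<Sum>\<^sub># S))" by (simp add: weight_def)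
qed

text \<open>Subsets of the blocks are zero-sum modulo \<open>n\<close> exactly if their indices sum
  to zero modulo \<open>m\<close>. So the indices of the blocks of an atom form an atom modulo
  \<open>m\<close>, and the Davenport bound for \<open>m\<close> applies.\<close>

lemma size_le_of_block_atom:
  assumes F: "block_fact r G F" and A: "block_atom n (\<Sum>\<^sub># F)"
  shows "size F \<le> m"
proof -
  have iff: "m dvd weight K \<longleftrightarrow> n dvd \<Sum>\<^sub># (\<Sum>\<^sub># K)" if "block_fact r G K" for K
    using cong_dvd_iff[OF weight_cong[OF that]] dvd_mult_g_iff by simp
  define Y where "Y = image_mset (\<lambda>S. x (\<Sum>\<^sub># S)) F"
  have "block_atom m Y"
  proof (rule block_atomI)
    show "Y \<noteq> {#}" using block_atom_nonempty[OF A] by (auto simp: Y_def)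
    show "m dvd \<Sum>\<^sub># Y" using iff[OF F] block_atom_dvd[OF A] by (simp add: Y_def weight_def)
    fix B assume B: "B \<subseteq># Y" "m dvd \<Sum>\<^sub># B" "B \<noteq> {#}"
    obtain F' where F': "F' \<subseteq># F" "B = image_mset (\<lambda>S. x (\<Sum>\<^sub># S)) F'"
      using B(1) unfolding Y_def by (rule sub_image_mset)
    define F'' where "F'' = F - F'"
    have Feq: "F = F' + F''" using F'(1) by (simp add: F''_def)
    have bf: "block_fact r G F'" "block_fact r G F''" using F Feq by simp_all
    have "\<Sum>\<^sub># F' \<noteq> {#}" using block_fact_sum_empty[OF bf(1)] B(3) F'(2) by auto
    moreover have "n dvd \<Sum>\<^sub># (\<Sum>\<^sub># F')" using iff[OF bf(1)] B(2) F'(2) by (simp add: weight_def)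
    moreover have "\<Sum>\<^sub># F' \<subseteq># \<Sum>\<^sub># F" by (simp add: Feq)
    ultimately have "\<Sum>\<^sub># F' = \<Sum>\<^sub># F" using block_atomD[OF A] by blast
    then have "\<Sum>\<^sub># F'' = {#}" by (simp add: Feq)
    then show "B = Y" using block_fact_sum_empty[OF bf(2)] F'(2) by (simp add: Y_def Feq)
  qed
  then show ?thesis using block_atom_size_le m_pos by (fastforce simp: Y_def)
qed

text \<open>At most \<open>m\<close> blocks of index at most \<open>m\<close> have weight at most
  \<open>m * m\<close>, within one period \<open>d * m\<close>; the congruence with \<open>m\<close>
  is therefore an equality.\<close>

lemma weight_block_atom:
  assumes F: "block_fact r G F" and A: "block_atom n (\<Sum>\<^sub># F)" "set_mset (\<Sum>\<^sub># F) \<subseteq> G" and "m \<le> d"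
  shows "weight F = m"
proof (rule cong_interval_eq)
  show "[weight F = m] (mod d * m)"
    using weight_block_fact[OF F, of "{#\<Sum>\<^sub># F#}"] A by simp
  have "F \<noteq> {#}" using block_atom_nonempty[OF A(1)] by auto
  then show "1 \<le> weight F"
    using weight_bounds(1)[OF F] by (metis One_nat_def Suc_le_eq le_trans nonempty_has_size)
  have "weight F \<le> m * d"
    using weight_bounds(2)[OF F] size_le_of_block_atom[OF F A(1)] assms(4) by (meson le_trans mult_le_mono2)
  then show "weight F \<le> d * m" by (simp add: mult.commute)
  show "1 \<le> m" using m_pos by simp
  show "m \<le> d * m" using assms(4) m_pos by simp
qed

text \<open>Splitting every atom of \<open>A\<close> into atoms modulo \<open>r\<close> yields a
  decomposition of weight \<open>m * size A\<close>. As the weight depends only on the product, so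
  does the length.\<close>

lemma half_factorial_if_small:
  assumes "r \<le> d" "m \<le> d"
  shows "block_chf 0 n G"
proof -
  have refine: "\<exists>F. block_fact r G F \<and> \<Sum>\<^sub># F = \<Sum>\<^sub># A \<and> weight F = m * size A"
    if "block_fact n G A" for A
    using that
  proof (induction A)
    case empty
    then show ?case by (intro exI[of _ "{#}"]) simp
  next
    case (add B A)
    then obtain F where F: "block_fact r G F" "\<Sum>\<^sub># F = \<Sum>\<^sub># A" "weight F = m * size A" by auto
    have "r dvd \<Sum>\<^sub># B" using add.prems r_dvd_n by (auto dest!: block_atom_dvd intro: dvd_trans)
    then obtain K where K: "block_fact r G K" "\<Sum>\<^sub># K = B" using ex_block_fact[of B G r] add.prems by auto
    then have "weight K = m" using weight_block_atom[OF K(1)] add.prems assms(2) by simp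
    then show ?case using F K by (intro exI[of _ "K + F"]) simp
  qed
  show ?thesis
    unfolding block_chf_def
  proof (intro allI impI)
    fix A A' assume A: "block_fact n G A" and A': "block_fact n G A'" and eq: "\<Sum>\<^sub># A = \<Sum>\<^sub># A'"
    obtain F where F: "block_fact r G F" "\<Sum>\<^sub># F = \<Sum>\<^sub># A" "weight F = m * size A"
      using refine[OF A] by blast
    obtain F' where F': "block_fact r G F'" "\<Sum>\<^sub># F' = \<Sum>\<^sub># A'" "weight F' = m * size A'"
      using refine[OF A'] by blast
    have "m * size A = m * size A'"
      using weight_unique[OF assms(1) F(1) F'(1)] F F' eq by simp
    then show "[size A = size A'] (mod 0)" using m_pos by simp
  qed
qed

end

lemma block_chf_small_order:
  assumes "n > 0" "g \<in> G" "block_chf d n G" "gcd g n \<le> d" "n div gcd g n \<le> d"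
  shows "block_chf 0 n G"
proof -
  define r m where "r = gcd g n" and "m = n div gcd g n"
  have n: "n = m * r" by (simp add: r_def m_def)
  obtain x where "\<forall>y. r dvd y \<longrightarrow> 1 \<le> x y \<and> x y \<le> m \<and> [x y * g = y] (mod n)"
    using ex_index[OF assms(1) r_def n] by blast
  then interpret index_map n g m r d G x
    by unfold_locales (use assms(1-3) n r_def in blast)+
  show ?thesis using half_factorial_if_small assms(4,5) by (simp add: r_def m_def)
qed

text \<open>Equal gcds mean that \<open>g\<close> and \<open>b\<close> generate the same subgroup.
  The atom of \<open>m\<close> copies of \<open>b\<close> splits into \<open>m\<close> singletons of
  index \<open>x b\<close>, so \<open>m * x b\<close> is congruent to \<open>m\<close> modulo
  \<open>m * d\<close>. This restricts pairs of classes of order n / 2 when no generator is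
  available.\<close>

lemma ex_index_same_gcd:
  assumes "n > 0" "g \<in> G" "b \<in> G" "block_chf d n G" "gcd g n = gcd b n"
  shows "\<exists>y. 1 \<le> y \<and> y \<le> n div gcd g n \<and> [y * g = b] (mod n) \<and> [y = 1] (mod d)"
proof -
  define r m where "r = gcd g n" and "m = n div gcd g n"
  have n: "n = m * r" by (simp add: r_def m_def)
  obtain x where x: "\<And>y. r dvd y \<Longrightarrow> 1 \<le> x y \<and> x y \<le> m \<and> [x y * g = y] (mod n)"
    using ex_index[OF assms(1) r_def n] by blast
  interpret index_map n g m r d G x
  proof
    show "n > 0" "r = gcd g n" "n = m * r" "g \<in> G" "block_chf d n G" by fact+
    show "1 \<le> x y \<and> x y \<le> m" "[x y * g = y] (mod n)" if "r dvd y" for y using x[OF that] by auto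
  qed
  have rb: "r dvd b" by (simp add: r_def assms(5))
  define F where "F = replicate_mset m {#b#}"
  have "block_atom r {#b#}"
    using rb by (auto simp: block_atom_def subset_mset.le_less dest!: mset_subset_size)
  then have "block_fact r G F" using assms(3) by (auto simp: F_def intro: block_fact_replicate)
  moreover have "block_atom n (replicate_mset m b)"
    using block_atom_replicate[OF assms(1), of b] by (simp add: m_def assms(5))
  then have "block_fact n G {#replicate_mset m b#}" using assms(3) by simp
  moreover have "\<Sum>\<^sub># (replicate_mset k {#b#}) = replicate_mset k b" for k by (induction k) simp_all
  then have "\<Sum>\<^sub># F = \<Sum>\<^sub># {#replicate_mset m b#}" by (simp add: F_def)
  ultimately have "[weight F = m * size {#replicate_mset m b#}] (mod d * m)"
    by (rule weight_block_fact)
  moreover have "weight F = m * x b" by (simp add: weight_def F_def)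
  ultimately have "[m * x b = m * 1] (mod m * d)" by (simp add: mult.commute)
  then have "[x b = 1] (mod d)" using m_pos by (simp add: cong_def mult_mod_right[symmetric])
  then show ?thesis using x[OF rb] by (auto simp: m_def)
qed

text \<open>This is the case \<open>g = 1\<close>, where \<open>r = 1\<close> and
  \<open>m = n\<close>: the blocks are singletons, the index of a residue in 1..n is the residue
  itself, and the weight is the integer sum.\<close>

lemma block_atom_sum_cong:
  assumes "G \<subseteq> {1..n}" "1 \<in> G" "block_chf d n G" "block_atom n A" "set_mset A \<subseteq> G"
  shows "[\<Sum>\<^sub># A = n] (mod d * n)"
proof -
  have "n > 0" using assms(1,2) by auto
  \<comment> \<open>Every natural number is a multiple of \<open>r = 1\<close> and must get an
    index; on 1..n the index is the identity, elsewhere the representative in 1..n.\<close>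
  define x where "x = (\<lambda>y. if y \<in> {1..n} then y else if y mod n = 0 then n else y mod n)"
  interpret index_map n 1 n 1 d G x
  proof
    show "n > 0" "1 \<in> G" "block_chf d n G" by fact+
    show "1 \<le> x y \<and> x y \<le> n" "[x y * 1 = y] (mod n)" for y
      using \<open>n > 0\<close> by (auto simp: x_def cong_def Suc_le_eq less_imp_le)
  qed simp_all
  define F where "F = image_mset (\<lambda>a. {#a#}) A"
  have F: "\<Sum>\<^sub># F = A" by (simp add: F_def)
  have "block_atom 1 {#a#}" for a
    by (auto simp: block_atom_def subset_mset.le_less dest!: mset_subset_size)
  then have "block_fact 1 G F" using assms(5) by (auto simp: F_def block_fact_def)
  moreover have "weight F = (\<Sum>a\<in>#A. x a)" by (simp add: weight_def F_def image_mset.compositionality o_def)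
  moreover have "image_mset x A = image_mset id A"
    by (rule image_mset_cong) (use assms(1,5) in \<open>auto simp: x_def\<close>)
  ultimately show ?thesis using weight_block_fact[of F "{#A#}"] F assms(4,5) by simp
qed

section \<open>Block monoids with a generator\<close>

lemma block_atom_quotient_cong:
  assumes "G \<subseteq> {1..n}" "1 \<in> G" "block_chf d n G" "block_atom n A" "set_mset A \<subseteq> G"
    and "\<Sum>\<^sub># A = s * n"
  shows "[s = 1] (mod d)"
proof -
  have "n > 0" using assms(1,2) by auto
  moreover have "[n * s = n * 1] (mod n * d)"
    using block_atom_sum_cong[OF assms(1-5)] assms(6) by (simp add: mult.commute)
  ultimately show ?thesis by (simp add: cong_def mult_mod_right[symmetric])
qed

text \<open>For \<open>t = gcd a n\<close> and \<open>q = a / t\<close>, the atom of n / t copies of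
  \<open>a\<close> has sum \<open>q * n\<close>, so \<open>q = 1 + d * j\<close>. If
  \<open>j = 0\<close>, then \<open>a = t\<close> divides \<open>n\<close>. Otherwise
  \<open>t * (1 + d) \<le> a \<le> 2 * d + 4\<close> allows only \<open>t \<le> 2\<close>, with
  \<open>j \<le> 2\<close> for \<open>t = 1\<close> and \<open>j = 1\<close> for
  \<open>t = 2\<close>.\<close>

lemma element_cases:
  assumes G: "G \<subseteq> {1..n}" "1 \<in> G" "block_chf d n G" and "n \<le> 2 * d + 4" "d \<ge> 4" "a \<in> G"
  shows "a dvd n \<or> a = 1 + d \<and> coprime a n \<or> a = 1 + 2 * d \<and> coprime a n \<or>
    a = 2 + 2 * d \<and> gcd a n = 2"
proof -
  define t where "t = gcd a n"
  have a: "1 \<le> a" "a \<le> n" using assms(1,6) by auto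
  have t: "t > 0" "t dvd a" "t dvd n" using a by (auto simp: t_def)
  obtain q where q: "a = t * q" using t by blast
  obtain m where m: "n = t * m" using t by blast
  have "n div gcd a n = m" unfolding t_def[symmetric] using m t(1) by simp
  then have "block_atom n (replicate_mset m a)"
    using block_atom_replicate[of n a] a by simp
  moreover have "\<Sum>\<^sub># (replicate_mset m a) = q * n" by (simp add: q m)
  ultimately have "[q = 1] (mod d)"
    using block_atom_quotient_cong[OF G, of "replicate_mset m a" q] assms(6) by auto
  moreover have "q \<ge> 1" using q a by (cases q) auto
  ultimately have "d dvd q - 1" by (simp add: cong_altdef_nat)
  then obtain j where "q - 1 = d * j" by blast
  then have qj: "q = 1 + d * j" using \<open>q \<ge> 1\<close> by linarith
  show ?thesis
  proof (cases "j = 0")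
    case True
    then show ?thesis using q qj t by simp
  next
    case False
    have "t * (1 + d) \<le> t * q" using False qj by simp
    then have "t * (1 + d) \<le> 2 * d + 4" using q a assms(4) by linarith
    moreover have "3 * (1 + d) > 2 * d + 4" using assms(5) by simp
    ultimately have "t * (1 + d) < 3 * (1 + d)" by linarith
    then have "t < 3" by (simp only: mult_less_cancel2)
    then consider "t = 1" | "t = 2" using t by linarith
    then show ?thesis
    proof cases
      case 1
      have "j < 3"
      proof (rule ccontr)
        assume "\<not> j < 3"
        then have "d * 3 \<le> d * j" by (intro mult_le_mono2) simp
        moreover have "a = 1 + d * j" using 1 q qj by simp
        ultimately show False using a assms(4,5) by linarith
      qed
      then have "j = 1 \<or> j = 2" using False by auto
      moreover have "coprime a n" using 1 by (simp add: t_def coprime_iff_gcd_eq_1)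
      ultimately show ?thesis using q qj 1 by auto
    next
      case 2
      have "j < 2"
      proof (rule ccontr)
        assume "\<not> j < 2"
        then have "d * 2 \<le> d * j" by (intro mult_le_mono2) simp
        moreover have "a = 2 + 2 * (d * j)" using 2 q qj by simp
        ultimately show False using a assms(4,5) by linarith
      qed
      then have "j = 1" using False by auto
      then show ?thesis using q qj 2 by (simp add: t_def)
    qed
  qed
qed

lemma sum_mset_eq_sum_count:
  fixes A :: "nat multiset"
  assumes "finite T" "set_mset A \<subseteq> T"
  shows "\<Sum>\<^sub># A = (\<Sum>a\<in>T. count A a * a)"
  using assms(2)
proof (induction A)
  case (add b A)
  have "(\<Sum>a\<in>T. count (add_mset b A) a * a) = (\<Sum>a\<in>T. count A a * a + (if a = b then b else 0))"
    by (rule sum.cong) auto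
  then show ?case using add assms(1) by (simp add: sum.distrib)
qed simp

lemma sum_mset_less_card:
  fixes A :: "nat multiset"
  assumes "A \<noteq> {#}" "\<And>a. a \<in># A \<Longrightarrow> count A a * a < n"
  shows "\<Sum>\<^sub># A < n * card (set_mset A)"
proof -
  have "\<Sum>\<^sub># A = (\<Sum>a\<in>set_mset A. count A a * a)"
    by (rule sum_mset_eq_sum_count) auto
  also have "\<dots> < (\<Sum>a\<in>set_mset A. n)"
    by (rule sum_strict_mono) (use assms in auto)
  finally show ?thesis by (simp add: mult.commute)
qed

text \<open>If some \<open>a\<close> contributes at least \<open>n\<close> to the sum of an atom,
  then n / a copies of it have sum \<open>n\<close> and are the whole atom. Otherwise each distinct
  element contributes less than \<open>n\<close>, so the sum is \<open>s * n\<close> with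
  \<open>s\<close> below the number of distinct divisors used. That number is small enough to give
  \<open>s \<le> d\<close>, and \<open>s = 1\<close> follows from the congruence.\<close>

lemma half_factorial_divisors:
  assumes G: "G \<subseteq> {1..n}" "1 \<in> G" "block_chf d n G" and "n \<le> 2 * d + 4" "d \<ge> 10"
    and dvd: "\<And>a. a \<in> G \<Longrightarrow> a dvd n"
  shows "block_chf 0 n G"
proof (rule block_chf_weights[where N = n and w = "\<lambda>a. a"])
  show n: "n > 0" using G by auto
  fix A assume A: "block_atom n A" "set_mset A \<subseteq> G"
  have "\<Sum>\<^sub># A = n"
  proof (cases "\<exists>a\<in>#A. n \<le> count A a * a")
    case True
    then obtain a where a: "a \<in># A" "n \<le> count A a * a" by blast
    then obtain k where k: "n = a * k" using dvd A(2) by blast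
    have "a > 0" using n k by (cases a) auto
    then have "k \<le> count A a" using a(2) k by (simp add: mult.commute)
    then have sub: "replicate_mset k a \<subseteq># A" by (simp add: count_le_replicate_mset_subset_eq)
    moreover have "n dvd \<Sum>\<^sub># (replicate_mset k a)" "replicate_mset k a \<noteq> {#}"
      using k n by auto
    ultimately have "replicate_mset k a = A" using block_atomD[OF A(1)] by blast
    then show ?thesis using k by (metis mult.commute of_nat_id sum_mset_replicate_mset)
  next
    case False
    obtain s where s: "\<Sum>\<^sub># A = s * n" using block_atom_dvd[OF A(1)] by (metis dvd_def mult.commute)
    have "\<Sum>\<^sub># A < n * card (set_mset A)"
      using False by (intro sum_mset_less_card block_atom_nonempty[OF A(1)]) (auto simp: not_le)
    then have "s < card (set_mset A)" using s by (simp add: mult.commute)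
    \<comment> \<open>A divisor of \<open>n\<close> is \<open>n\<close>, n / 2 or at most n / 3;
      this crude count of divisors already suffices.\<close>
    also have "\<dots> \<le> card ({1..n div 3} \<union> {n div 2, n})"
    proof (rule card_mono)
      show "set_mset A \<subseteq> {1..n div 3} \<union> {n div 2, n}"
      proof
        fix a assume "a \<in># A"
        then have "a dvd n" "1 \<le> a" using A(2) dvd G(1) by auto
        then obtain k where k: "n = a * k" by blast
        then have "k > 0" using n by (cases k) auto
        then consider "k = 1" | "k = 2" | "k \<ge> 3" by linarith
        then show "a \<in> {1..n div 3} \<union> {n div 2, n}"
        proof cases
          case 3
          then have "a * 3 \<le> n" unfolding k by (rule mult_le_mono2)
          then show ?thesis using \<open>1 \<le> a\<close> by auto
        qed (use k in auto)
      qed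
    qed simp
    also have "\<dots> \<le> card {1..n div 3} + card {n div 2, n}" by (rule card_Un_le)
    also have "\<dots> \<le> n div 3 + 2" by (simp add: card_insert_if)
    finally have "s \<le> d" using assms(4,5) by linarith
    moreover have "s \<noteq> 0"
    proof
      assume "s = 0"
      then have "\<And>a. a \<in># A \<Longrightarrow> a = 0" using s by simp
      then show False using A(2) G(1) block_atom_nonempty[OF A(1)]
        by (metis atLeastAtMost_iff multiset_nonemptyE not_one_le_zero subsetD)
    qed
    ultimately have "s = 1"
      using cong_interval_eq[OF block_atom_quotient_cong[OF G A s]] assms(5) by simp
    then show ?thesis using s by simp
  qed
  then show "[(\<Sum>a\<in>#A. a) = n] (mod n * 0)" by simp
qed

section \<open>Explicit atoms and the residues they exclude\<close>

lemma block_atom_add_replicate: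
  fixes a b :: nat
  assumes "n dvd a + k * b" "\<And>j. 0 < j \<Longrightarrow> j \<le> k \<Longrightarrow> \<not> n dvd j * b"
    and "\<And>j. j < k \<Longrightarrow> \<not> n dvd a + j * b"
  shows "block_atom n (add_mset a (replicate_mset k b))"
proof (rule block_atomI)
  fix B assume B: "B \<subseteq># add_mset a (replicate_mset k b)" "n dvd \<Sum>\<^sub># B" "B \<noteq> {#}"
  have "B \<subseteq># {#a#} + replicate_mset k b" using B(1) by simp
  then obtain B1 j where B1: "B = B1 + replicate_mset j b" "B1 \<subseteq># {#a#}" "j \<le> k"
    by (rule subset_mset_plus_replicateE)
  consider "B1 = {#}" | "B1 = {#a#}" using B1(2) by (auto simp: subset_mset.le_less dest!: mset_subset_size)
  then show "B = add_mset a (replicate_mset k b)"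
  proof cases
    case 1
    then have "j > 0" "n dvd j * b" using B B1 by auto
    then show ?thesis using assms(2) B1(3) by blast
  next
    case 2
    then have "n dvd a + j * b" using B B1 by simp
    then have "j = k" using assms(3)[of j] B1(3) by (cases "j = k") auto
    then show ?thesis using B1 2 by simp
  qed
qed (use assms(1) in auto)

text \<open>The hypotheses run through what a zero-sum part can contain besides \<open>j\<close>
  copies of \<open>b\<close>: neither \<open>a\<close> nor \<open>c\<close>, one of them, or
  both.\<close>

lemma block_atom_add_add_replicate:
  fixes a b c :: nat
  assumes "n dvd a + c + k * b" "\<And>j. 0 < j \<Longrightarrow> j \<le> k \<Longrightarrow> \<not> n dvd j * b"
    and "\<And>j. j \<le> k \<Longrightarrow> \<not> n dvd a + j * b" "\<And>j. j \<le> k \<Longrightarrow> \<not> n dvd c + j * b"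
    and "\<And>j. j < k \<Longrightarrow> \<not> n dvd a + c + j * b"
  shows "block_atom n (add_mset a (add_mset c (replicate_mset k b)))"
proof (rule block_atomI)
  fix B assume B: "B \<subseteq># add_mset a (add_mset c (replicate_mset k b))" "n dvd \<Sum>\<^sub># B" "B \<noteq> {#}"
  have "B \<subseteq># {#a, c#} + replicate_mset k b" using B(1) by simp
  then obtain B1 j where B1: "B = B1 + replicate_mset j b" "B1 \<subseteq># {#a, c#}" "j \<le> k"
    by (rule subset_mset_plus_replicateE)
  have "{#a, c#} = {#a#} + {#c#}" by (simp add: add_mset_commute)
  then have "B1 \<subseteq># {#a#} + {#c#}" using B1(2) by (simp only:)
  then obtain C1 C2 where C: "B1 = C1 + C2" "C1 \<subseteq># {#a#}" "C2 \<subseteq># {#c#}"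
    by (rule subset_mset_plus_split)
  have "C1 = {#} \<or> C1 = {#a#}" "C2 = {#} \<or> C2 = {#c#}"
    using C(2,3) by (auto simp: subset_mset.le_less dest!: mset_subset_size)
  then consider "B1 = {#}" | "B1 = {#a#}" | "B1 = {#c#}" | "B1 = {#a, c#}" using C(1) by auto
  then show "B = add_mset a (add_mset c (replicate_mset k b))"
  proof cases
    case 1
    then have "j > 0" "n dvd j * b" using B B1 by auto
    then show ?thesis using assms(2) B1(3) by blast
  next
    case 4
    then have "n dvd a + c + j * b" using B B1 by (simp add: add.assoc)
    then have "j = k" using assms(5)[of j] B1(3) by (cases "j = k") auto
    then show ?thesis using B1 4 by simp
  qed (use B B1 assms(3,4) in auto)
qed (use assms(1) in \<open>auto simp: add.assoc\<close>)

lemma dvd_add_mult_diff_iff: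
  fixes n e a j :: nat
  assumes "e \<le> n"
  shows "n dvd a + j * (n - e) \<longleftrightarrow> int n dvd int a - int j * int e"
proof -
  obtain f where "n = e + f" using assms by (metis le_iff_add)
  then have "int (a + j * (n - e)) = (int a - int j * int e) + int n * int j"
    by (simp add: algebra_simps)
  then show ?thesis by (metis dvd_add_left_iff dvd_triv_left int_dvd_int_iff)
qed

text \<open>Here \<open>n - e\<close> stands for the residue -e. The sum differs from the integer a
  - j e by a multiple of \<open>n\<close>, and that integer is nonzero of absolute value below
  \<open>n\<close>.\<close>

lemma not_dvd_add_mult_diff:
  fixes n e a j :: nat
  assumes "e \<le> n" "a \<noteq> j * e" "a < j * e + n" "j * e < a + n"
  shows "\<not> n dvd a + j * (n - e)"
proof
  assume "n dvd a + j * (n - e)"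
  then have "int n dvd int a - int j * int e" using dvd_add_mult_diff_iff[OF assms(1)] by blast
  moreover have "int a < int j * int e + int n" "int j * int e < int a + int n"
    using assms(3,4) by (simp_all flip: of_nat_mult of_nat_add)
  moreover have "int a - int j * int e \<noteq> 0" using assms(2) by (simp flip: of_nat_mult)
  ultimately show False using dvd_imp_le_int[of "int a - int j * int e" "int n"] by linarith
qed

lemma cong_1_cases:
  fixes b d :: nat
  assumes "[b = 1] (mod d)" "1 \<le> b" "b \<le> 2 * d + 1"
  shows "b = 1 \<or> b = 1 + d \<or> b = 1 + 2 * d"
proof (cases "d = 0")
  case False
  have "d dvd b - 1" using assms by (simp add: cong_altdef_nat)
  then obtain j where j: "b - 1 = d * j" by blast
  then have "d * j \<le> d * 2" using assms(3) by linarith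
  then have "j \<le> 2" using False by simp
  then have "j = 0 \<or> j = 1 \<or> j = 2" by linarith
  then show ?thesis using j assms(2) by auto
qed (use assms in simp)

locale chf_with_generator =
  fixes n d :: nat and G :: "nat set"
  assumes G: "G \<subseteq> {1..n}" "1 \<in> G" "block_chf d n G" and n_le: "n \<le> 2 * d + 4" and d_ge: "d \<ge> 100"
begin

lemmas quotient_cong = block_atom_quotient_cong[OF G]

lemma cases_of_mem:
  "a \<in> G \<Longrightarrow> a dvd n \<or> a = 1 + d \<and> coprime a n \<or> a = 1 + 2 * d \<and> coprime a n \<or>
    a = 2 + 2 * d \<and> gcd a n = 2"
  using element_cases[OF G n_le] d_ge by simp

lemma ex_non_divisor:
  assumes "\<not> block_chf 0 n G"
  obtains a where "a \<in> G" "\<not> a dvd n"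
  using half_factorial_divisors[OF G n_le] d_ge assms by fastforce

text \<open>The atom consisting of \<open>a\<close> and \<open>a\<close> copies of -1 has integer
  sum \<open>a * n\<close>.\<close>

lemma cong_if_minus_1:
  assumes "a \<in> G" "n - 1 \<in> G" "a < n"
  shows "[a = 1] (mod d)"
proof (rule quotient_cong)
  have a: "a \<ge> 1" using assms(1) G(1) by auto
  show sum: "\<Sum>\<^sub># (add_mset a (replicate_mset a (n - 1))) = a * n"
    using assms(3) by (cases n) auto
  show "block_atom n (add_mset a (replicate_mset a (n - 1)))"
  proof (rule block_atom_add_replicate)
    show "n dvd a + a * (n - 1)" using sum by simp
    show "\<not> n dvd j * (n - 1)" if "0 < j" "j \<le> a" for j
      using not_dvd_add_mult_diff[of 1 n 0 j] that assms(3) by simp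
    show "\<not> n dvd a + j * (n - 1)" if "j < a" for j
      using not_dvd_add_mult_diff[of 1 n a j] that assms(3) by simp
  qed
qed (use assms in auto)

text \<open>For \<open>b = 2 * k\<close> the atom made of \<open>b\<close> and \<open>k\<close>
  copies of -2 has sum \<open>k * n\<close>. For \<open>b = 2 * k + 1\<close> a further 1 repairs
  the parity, and with \<open>k + 1\<close> copies of -2 the sum is \<open>(k + 1) * n\<close>. Both
  quotients lie in 1..d and so must be 1. The bound \<open>d + 2\<close> on \<open>b\<close> covers
  all proper divisors of \<open>n\<close>.\<close>

lemma small_if_minus_2:
  assumes "b \<in> G" "n - 2 \<in> G" "b \<le> d + 2" "n \<ge> d + 5"
  shows "b = 1 \<or> b = 2"
proof (cases "even b")
  case True
  then obtain k where k: "b = 2 * k" by blast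
  have b: "b \<ge> 1" using assms(1) G(1) by auto
  have "[k = 1] (mod d)"
  proof (rule quotient_cong)
    obtain f where f: "n = f + 2" using assms(4) nat_le_iff_add[of 2 n] by auto
    show sum: "\<Sum>\<^sub># (add_mset b (replicate_mset k (n - 2))) = k * n"
      by (simp add: k f algebra_simps)
    show "block_atom n (add_mset b (replicate_mset k (n - 2)))"
    proof (rule block_atom_add_replicate)
      show "n dvd b + k * (n - 2)" using sum by simp
      show "\<not> n dvd j * (n - 2)" if "0 < j" "j \<le> k" for j
        using not_dvd_add_mult_diff[of 2 n 0 j] that assms(3,4) k by simp
      show "\<not> n dvd b + j * (n - 2)" if "j < k" for j
        using not_dvd_add_mult_diff[of 2 n b j] that assms(3,4) k by simp
    qed
  qed (use assms in auto)
  then have "k = 1" using cong_interval_eq[of k 1 d] b k assms(3) d_ge by simp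
  then show ?thesis using k by simp
next
  case False
  then obtain k where k: "b = 2 * k + 1" by (metis oddE)
  have "[k + 1 = 1] (mod d)"
  proof (cases "k = 0")
    case False
    show ?thesis
    proof (rule quotient_cong)
      obtain f where f: "n = f + 2" using assms(4) nat_le_iff_add[of 2 n] by auto
      show sum: "\<Sum>\<^sub># (add_mset b (add_mset 1 (replicate_mset (k + 1) (n - 2)))) = (k + 1) * n"
        by (simp add: k f algebra_simps)
      show "block_atom n (add_mset b (add_mset 1 (replicate_mset (k + 1) (n - 2))))"
      proof (rule block_atom_add_add_replicate)
        show "n dvd b + 1 + (k + 1) * (n - 2)" using sum by (simp add: add.assoc)
        show "\<not> n dvd j * (n - 2)" if "0 < j" "j \<le> k + 1" for j
          using not_dvd_add_mult_diff[of 2 n 0 j] that assms(3,4) k by simp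
        show "\<not> n dvd b + j * (n - 2)" if "j \<le> k + 1" for j
          by (rule not_dvd_add_mult_diff) (use that assms(3,4) k in presburger)+
        show "\<not> n dvd 1 + j * (n - 2)" if "j \<le> k + 1" for j
          by (rule not_dvd_add_mult_diff) (use that assms(3,4) k in presburger)+
        show "\<not> n dvd b + 1 + j * (n - 2)" if "j < k + 1" for j
          using not_dvd_add_mult_diff[of 2 n "b + 1" j] that assms(3,4) k by simp
      qed
    qed (use assms G(2) in auto)
  qed simp
  then have "k + 1 = 1" using cong_interval_eq[of "k + 1" 1 d] k assms(3) d_ge by simp
  then show ?thesis using k by simp
qed

lemma classify_n_minus_2:
  assumes "\<not> block_chf 0 n G" "n = d + 2"
  shows "n - 1 \<in> G" "G \<subseteq> {1, n - 1, n}"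
proof -
  obtain a where a: "a \<in> G" "\<not> a dvd n" using ex_non_divisor[OF assms(1)] .
  then have "a \<le> n" using G(1) by auto
  then show m1: "n - 1 \<in> G" using cases_of_mem[OF a(1)] a assms(2) d_ge by auto
  show "G \<subseteq> {1, n - 1, n}"
  proof
    fix b assume b: "b \<in> G"
    then have "1 \<le> b" "b \<le> n" using G(1) by auto
    then show "b \<in> {1, n - 1, n}"
      using cong_if_minus_1[OF b m1] cong_1_cases[of b d] assms(2) d_ge by (cases "b = n") auto
  qed
qed

text \<open>Of the exceptional residues, \<open>1 + d\<close> is n / 2 and \<open>2 + 2 * d\<close>
  is \<open>n\<close>, both divisors; only \<open>1 + 2 * d\<close>, that is -1, is left. Once -1
  occurs, all residues below \<open>n\<close> are 1 modulo \<open>d\<close>, which readmits n /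
  2.\<close>

lemma classify_half_n_minus_2:
  assumes "\<not> block_chf 0 n G" "n = 2 * d + 2"
  shows "n - 1 \<in> G" "G \<subseteq> {1, n - 1, n div 2, n}"
proof -
  obtain a where a: "a \<in> G" "\<not> a dvd n" using ex_non_divisor[OF assms(1)] .
  have "1 + d dvd n" unfolding assms(2) by (metis dvd_triv_right add.commute distrib_left_numeral mult_2 nat_mult_1_right)
  then have "a = 1 + 2 * d" using cases_of_mem[OF a(1)] a assms(2) by auto
  then show m1: "n - 1 \<in> G" using a assms(2) by auto
  show "G \<subseteq> {1, n - 1, n div 2, n}"
  proof
    fix b assume b: "b \<in> G"
    then have "1 \<le> b" "b \<le> n" using G(1) by auto
    then show "b \<in> {1, n - 1, n div 2, n}"
      using cong_if_minus_1[OF b m1] cong_1_cases[of b d] assms(2) d_ge by (cases "b = n") auto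
  qed
qed

lemma proper_divisor_le:
  assumes "b dvd n" "b \<noteq> n"
  shows "b \<le> d + 2"
proof -
  obtain k where k: "n = b * k" using assms(1) by blast
  have "n > 0" using G by auto
  then have "k \<noteq> 0" "k \<noteq> 1" using k assms(2) by auto
  then have "b * 2 \<le> n" unfolding k by (intro mult_le_mono2) linarith
  then show ?thesis using n_le by simp
qed

text \<open>Two non-divisors survive, and they describe one configuration: since
  \<open>2 * (d + 1) = n - 1\<close>, the residue 1 is -2 times \<open>d + 1\<close>, so passing to
  the generator \<open>d + 1\<close> turns the second alternative into the first.\<close>

lemma classify_half_n_minus_3:
  assumes "\<not> block_chf 0 n G" "n = 2 * d + 3"
  shows "n - 2 \<in> G \<or> d + 1 \<in> G \<and> coprime (d + 1) n"
proof -
  obtain a where a: "a \<in> G" "\<not> a dvd n" using ex_non_divisor[OF assms(1)] .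
  have "gcd a n \<noteq> 2"
  proof
    assume "gcd a n = 2"
    then have "2 dvd n" by (metis gcd_dvd2)
    then show False using assms(2) by presburger
  qed
  then show ?thesis using cases_of_mem[OF a(1)] a assms(2) by auto
qed

lemma classify_half_n_minus_3_minus_2:
  assumes "n - 2 \<in> G" "n = 2 * d + 3"
  shows "G \<subseteq> {1, n - 2, n}"
proof
  fix b assume b: "b \<in> G"
  have "odd n" using assms(2) by simp
  then have "\<not> gcd b n = 2" by (metis even_numeral gcd_dvd2 dvd_refl)
  then consider "b = n" | "b dvd n" "b \<noteq> n" | "b = 1 + d" "coprime b n" | "b = 1 + 2 * d"
    using cases_of_mem[OF b] by blast
  then show "b \<in> {1, n - 2, n}"
  proof cases
    case 2
    then have "b = 1 \<or> b = 2"
      using small_if_minus_2[OF b assms(1) proper_divisor_le] assms(2) d_ge by simp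
    then show ?thesis using 2 \<open>odd n\<close> by auto
  next
    case 3
    then show ?thesis
      using small_if_minus_2[OF b assms(1)] assms(2) d_ge by simp
  qed (use assms in auto)
qed

text \<open>Coprimality excludes 3 as a divisor of \<open>n\<close>. With
  \<open>k = n div 3\<close>, an atom made of \<open>k + 1\<close> copies of -3 and one or two
  copies of 1, according to \<open>n\<close> modulo 3, has sum \<open>k * n\<close>; but
  \<open>k\<close> lies strictly between 1 and \<open>d + 1\<close>.\<close>

lemma not_minus_3:
  assumes "n = 2 * d + 4" "n - 3 \<in> G" "coprime (n - 3) n"
  shows False
proof -
  define k where "k = n div 3"
  have n100: "n \<ge> 100" using assms(1) d_ge by simp
  have jb: "\<not> n dvd j * (n - 3)" if "0 < j" "j \<le> k + 1" for j
  proof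
    assume "n dvd j * (n - 3)"
    then have "n dvd j" using assms(3) by (simp add: coprime_dvd_mult_left_iff coprime_commute)
    then show False using that n100 by (auto simp: k_def dest!: dvd_imp_le)
  qed
  have "n mod 3 \<noteq> 0"
  proof
    assume "n mod 3 = 0"
    then have "3 dvd n" by presburger
    then have "3 dvd n - 3" by (simp add: dvd_diff_nat)
    with \<open>3 dvd n\<close> assms(3) have "is_unit (3::nat)" by (metis coprime_common_divisor)
    then show False by simp
  qed
  then have "n = 3 * k + 2 \<or> n = 3 * k + 1" unfolding k_def by presburger
  then consider "n = 3 * k + 2" | "n = 3 * k + 1" by blast
  then have "[k = 1] (mod d)"
  proof cases
    case 1
    show ?thesis
    proof (rule quotient_cong)
      obtain f where f: "n = f + 3" "3 * k = f + 1" using 1 n100 by (intro that[of "n - 3"]) auto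
      have "k * n = 3 * k + k * f" using f by (simp add: algebra_simps)
      then show sum: "\<Sum>\<^sub># (add_mset 1 (replicate_mset (k + 1) (n - 3))) = k * n"
        using f by (simp add: algebra_simps)
      show "block_atom n (add_mset 1 (replicate_mset (k + 1) (n - 3)))"
      proof (rule block_atom_add_replicate)
        show "n dvd 1 + (k + 1) * (n - 3)" using sum by simp
        show "\<not> n dvd 1 + j * (n - 3)" if "j < k + 1" for j
          by (rule not_dvd_add_mult_diff) (use that 1 n100 in presburger)+
      qed (use jb in auto)
    qed (use assms G(2) in auto)
  next
    case 2
    show ?thesis
    proof (rule quotient_cong)
      obtain f where f: "n = f + 3" "3 * k = f + 2" using 2 n100 by (intro that[of "n - 3"]) auto
      have "k * n = 3 * k + k * f" using f by (simp add: algebra_simps)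
      then show sum: "\<Sum>\<^sub># (add_mset 1 (add_mset 1 (replicate_mset (k + 1) (n - 3)))) = k * n"
        using f by (simp add: algebra_simps)
      then have dvd: "n dvd 1 + 1 + (k + 1) * (n - 3)" by simp
      have ne: "\<not> n dvd 1 + j * (n - 3)" if "j \<le> k + 1" for j
      proof (cases "j = k + 1")
        case True
        \<comment> \<open>For \<open>j = k + 1\<close> the sum is one less than a multiple of
          \<open>n\<close>, a case that the estimate by absolute values need not cover.\<close>
        have "n dvd 1" if "n dvd 1 + (k + 1) * (n - 3)"
          using dvd dvd_add_left_iff[OF that, of 1] by (simp add: add.assoc)
        then show ?thesis using True n100 by auto
      next
        case False
        then have "j \<le> k" using that by simp
        then show ?thesis by (intro not_dvd_add_mult_diff) (use 2 n100 in presburger)+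
      qed
      show "block_atom n (add_mset 1 (add_mset 1 (replicate_mset (k + 1) (n - 3))))"
      proof (rule block_atom_add_add_replicate)
        show "\<not> n dvd 1 + 1 + j * (n - 3)" if "j < k + 1" for j
          by (rule not_dvd_add_mult_diff) (use that 2 n100 in presburger)+
      qed (use jb ne dvd in auto)
    qed (use assms G(2) in auto)
  qed
  then have "k = 1" by (rule cong_interval_eq) (use assms(1) d_ge in \<open>auto simp: k_def\<close>)
  then show False using n100 by (simp add: k_def)
qed

text \<open>Here \<open>c\<close> is n / 2 - 1 and odd. Since \<open>1 + (c + 2) * c\<close> is the
  square of \<open>c + 1 = n / 2\<close>, and n / 2 is even, \<open>c + 2\<close> copies of
  \<open>c\<close> balance a single 1. The quotient \<open>e + 1\<close> of that sum by
  \<open>n\<close> is about n / 4, too small to be congruent to 1 without being equal to it.\<close>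

lemma not_half_minus_1:
  assumes "n = 2 * d + 4" "1 + d \<in> G" "coprime (1 + d) n"
  shows False
proof -
  define c where "c = 1 + d"
  have "even n" using assms(1) by simp
  then have "odd c" using assms(3) unfolding c_def by (metis coprime_common_divisor_nat odd_one dvd_refl even_numeral nat_dvd_1_iff_1 numeral_eq_one_iff semiring_norm(85))
  then obtain e where e: "c = 2 * e + 1" by (metis oddE)
  have n: "n = 2 * c + 2" using assms(1) by (simp add: c_def)
  have cop: "n dvd j * c \<longleftrightarrow> n dvd j" for j
    using coprime_dvd_mult_left_iff[of n c j] assms(3)[folded c_def] by (simp add: coprime_commute)
  have "[e + 1 = 1] (mod d)"
  proof (rule quotient_cong)
    show sum: "\<Sum>\<^sub># (add_mset 1 (replicate_mset (c + 2) c)) = (e + 1) * n"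
      by (simp add: e n algebra_simps)
    show "block_atom n (add_mset 1 (replicate_mset (c + 2) c))"
    proof (rule block_atom_add_replicate)
      show tot: "n dvd 1 + (c + 2) * c" using sum by simp
      show "\<not> n dvd j * c" if "0 < j" "j \<le> c + 2" for j
        using that n e d_ge unfolding cop by (auto simp: c_def dest!: dvd_imp_le)
      show "\<not> n dvd 1 + j * c" if "j < c + 2" for j
      proof
        assume dvd: "n dvd 1 + j * c"
        define i where "i = c + 2 - j"
        have i: "c + 2 = j + i" "i > 0" using that by (simp_all add: i_def)
        have "1 + (c + 2) * c = (1 + j * c) + i * c" unfolding i(1) by (simp only: distrib_right add.assoc)
        then have "n dvd i * c" using tot dvd_add_right_iff[OF dvd, of "i * c"] by (simp only:)
        then have "n dvd i" by (simp add: cop)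
        then have "n \<le> i" using i(2) by (simp add: dvd_imp_le)
        then show False using i(1) n d_ge by (simp add: c_def)
      qed
    qed
    show "set_mset (add_mset 1 (replicate_mset (c + 2) c)) \<subseteq> G" using assms(2) G(2) by (simp add: c_def)
  qed
  then have "e + 1 = 1" by (rule cong_interval_eq) (use e d_ge in \<open>auto simp: c_def\<close>)
  then show False using e d_ge by (simp add: c_def)
qed

text \<open>The exceptional residues are n - 3, n / 2 - 1 and n - 2, and the first two are
  impossible. With -2 present, proper divisors are at most 2.\<close>

lemma classify_half_n_minus_4:
  assumes "\<not> block_chf 0 n G" "n = 2 * d + 4"
  shows "n - 2 \<in> G" "G \<subseteq> {1, n - 2, 2, n}"
proof -
  have cs: "b dvd n \<or> b = n - 2" if b: "b \<in> G" for b
    using cases_of_mem[OF b] not_minus_3 not_half_minus_1 assms(2) b by auto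
  obtain a where a: "a \<in> G" "\<not> a dvd n" using ex_non_divisor[OF assms(1)] .
  then show m2: "n - 2 \<in> G" using cs by blast
  show "G \<subseteq> {1, n - 2, 2, n}"
  proof
    fix b assume b: "b \<in> G"
    show "b \<in> {1, n - 2, 2, n}"
    proof (cases "b dvd n \<and> b \<noteq> n")
      case True
      then have "b = 1 \<or> b = 2"
        using small_if_minus_2[OF b m2 proper_divisor_le] assms(2) d_ge by simp
      then show ?thesis by auto
    qed (use cs[OF b] in auto)
  qed
qed

end

section \<open>Admissible sets\<close>

lemma cong_add_multiple: "a = N + k * (N * d) \<Longrightarrow> [a = N] (mod N * d)" for a N d k :: nat
  by (simp only: cong_def mod_mult_self1)

lemma block_atom_singleton_set:
  assumes "block_atom n A" "n > 0" "set_mset A \<subseteq> {b}"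
  shows "A = replicate_mset (n div gcd b n) b"
proof -
  define k where "k = n div gcd b n"
  have A: "A = replicate_mset (size A) b" by (rule set_mset_subset_singletonD[OF assms(3)])
  have "n dvd size A * b" using block_atom_dvd[OF assms(1)] by (subst (asm) A) simp
  then have "k dvd size A" using dvd_mult_gcd_iff[OF assms(2)] by (simp add: k_def)
  moreover have "size A > 0" using block_atom_nonempty[OF assms(1)] by (simp add: nonempty_has_size)
  ultimately have "k \<le> size A" by (rule dvd_imp_le)
  then have "replicate_mset k b \<subseteq># A" by (subst A) (simp add: replicate_mset_msubseteq_iff)
  moreover have "n dvd \<Sum>\<^sub># (replicate_mset k b)" "replicate_mset k b \<noteq> {#}"
    using block_atom_replicate[OF assms(2), of b]
    by (auto simp: k_def dest: block_atom_dvd block_atom_nonempty)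
  ultimately have "replicate_mset k b = A" by (rule block_atomD[OF assms(1)])
  then show ?thesis by (simp add: k_def)
qed

lemma block_atom_mem_n:
  assumes "block_atom n A" "n \<in># A"
  shows "A = {#n#}"
  using block_atomD[OF assms(1), of "{#n#}"] assms(2) by simp

lemma block_atom_mem_pair:
  assumes "block_atom n A" "a \<in># A" "b \<in># A" "a \<noteq> b" "a + b = n"
  shows "A = {#a, b#}"
proof -
  have "{#a, b#} \<subseteq># A" using assms(2-4)
    by (auto simp: subseteq_mset_def Suc_le_eq)
  then show ?thesis using block_atomD[OF assms(1), of "{#a, b#}"] assms(5) by simp
qed

lemma block_atom_mem_double:
  assumes "block_atom n A" "2 \<le> count A a" "2 * a = n"
  shows "A = {#a, a#}"
proof -
  have "{#a, a#} \<subseteq># A" using assms(2) by (auto simp: subseteq_mset_def)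
  moreover have "n dvd \<Sum>\<^sub># {#a, a#}" using assms(3) by (simp flip: mult_2)
  ultimately show ?thesis using block_atomD[OF assms(1), of "{#a, a#}"] by simp
qed

lemma sum_mset_two_elements:
  fixes a b :: nat
  assumes "set_mset A \<subseteq> {a, b}" "a \<noteq> b"
  shows "\<Sum>\<^sub># A = count A a * a + count A b * b"
  using sum_mset_eq_sum_count[of "{a, b}" A] assms by simp

lemma block_atom_replicate_subset:
  assumes "block_atom n A" "set_mset A \<subseteq> {a, b}" "a \<noteq> b" "i \<le> count A a" "j \<le> count A b"
    and "0 < i + j" "n dvd i * a + j * b"
  shows "A = replicate_mset i a + replicate_mset j b"
proof -
  have "replicate_mset i a + replicate_mset j b \<subseteq># A"
    using assms(3-5) by (auto simp: subseteq_mset_def)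
  then show ?thesis using block_atomD[OF assms(1)] assms(6,7) by force
qed

text \<open>The possible atoms are the zero class, a pair 1, -1, and \<open>n\<close> copies of 1 or
  of -1. All have integer sum \<open>n\<close> except the last, whose sum is
  \<open>n * (n - 1) = n + n * (n - 2)\<close>.\<close>

lemma block_chf_pm1:
  assumes "n \<ge> 3" "G \<subseteq> {1, n - 1, n}"
  shows "block_chf (n - 2) n G"
proof (rule block_chf_weights[where N = n and w = "\<lambda>a. a"])
  show "n > 0" using assms by simp
  fix A assume A: "block_atom n A" "set_mset A \<subseteq> G"
  consider "n \<in># A" | "1 \<in># A" "n - 1 \<in># A" | "set_mset A \<subseteq> {1}" | "set_mset A \<subseteq> {n - 1}"
    using A(2) assms(2) by blast
  then show "[(\<Sum>a\<in>#A. a) = n] (mod n * (n - 2))"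
  proof cases
    case 1
    then show ?thesis using block_atom_mem_n[OF A(1)] by simp
  next
    case 2
    then have "A = {#1, n - 1#}" using block_atom_mem_pair[OF A(1), of 1 "n - 1"] assms(1) by simp
    then show ?thesis using assms(1) by simp
  next
    case 3
    then have "A = replicate_mset n 1" using block_atom_singleton_set[OF A(1), of 1] assms(1) by simp
    then show ?thesis by simp
  next
    case 4
    have "gcd (n - 1) n = 1"
      using assms(1) by (metis coprime_diff_one_left_nat coprime_iff_gcd_eq_1 less_le_trans zero_less_numeral)
    then have "A = replicate_mset n (n - 1)"
      using block_atom_singleton_set[OF A(1) _ 4] assms(1) by simp
    moreover obtain f where f: "n = f + 2" using assms(1) by (intro that[of "n - 2"]) simp
    then have "n * (n - 1) = n + n * (n - 2)" by (simp add: algebra_simps)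
    ultimately show ?thesis by (simp add: cong_def)
  qed
qed

text \<open>Besides the atoms over 1, -1 and zero there are two copies of \<open>m\<close>, and one
  \<open>m\<close> with \<open>m\<close> copies of 1 or of -1. The sums that differ from
  \<open>n = 2 * m\<close> are \<open>m * n\<close>, for \<open>m\<close> and copies of -1, and
  \<open>n * (n - 1)\<close>, for copies of -1 alone; they exceed \<open>n\<close> by one and two
  periods \<open>n * (m - 1)\<close>.\<close>

lemma block_chf_pm1_half:
  assumes "m \<ge> 3" "G \<subseteq> {1, 2 * m - 1, m, 2 * m}"
  shows "block_chf (m - 1) (2 * m) G"
proof (rule block_chf_weights[where N = "2 * m" and w = "\<lambda>a. a"])
  let ?n = "2 * m"
  show "?n > 0" using assms by simp
  have big: "[m * ?n = ?n] (mod ?n * (m - 1))" "[(2 * m) * (2 * m - 1) = ?n] (mod ?n * (m - 1))"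
  proof -
    obtain f where f: "m = f + 1" using assms(1) by (intro that[of "m - 1"]) simp
    have "m * ?n = ?n + ?n * (m - 1)" "(2 * m) * (2 * m - 1) = ?n + 2 * (?n * (m - 1))"
      by (simp_all add: f algebra_simps)
    then show "[m * ?n = ?n] (mod ?n * (m - 1))" "[(2 * m) * (2 * m - 1) = ?n] (mod ?n * (m - 1))"
      using cong_add_multiple[of "m * ?n" ?n 1 "m - 1"] cong_add_multiple[of "2 * m * (2 * m - 1)" ?n 2 "m - 1"]
      by (simp_all only: mult_1 mult_1_right)
  qed
  fix A assume A: "block_atom ?n A" "set_mset A \<subseteq> G"
  have two: "A = {#m, m#}" if "2 \<le> count A m" using block_atom_mem_double[OF A(1) that] by simp
  consider "?n \<in># A" | "1 \<in># A" "?n - 1 \<in># A" | "2 \<le> count A m" | "set_mset A \<subseteq> {1}" | "set_mset A \<subseteq> {?n - 1}"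
    | "set_mset A \<subseteq> {1, m}" "count A m = 1" | "set_mset A \<subseteq> {?n - 1, m}" "count A m = 1"
  proof -
    have "count A m = 0 \<or> count A m = 1 \<or> 2 \<le> count A m" by linarith
    then show thesis using A(2) assms(2) that by (auto simp: count_eq_zero_iff)
  qed
  then show "[(\<Sum>a\<in>#A. a) = ?n] (mod ?n * (m - 1))"
  proof cases
    case 1
    then show ?thesis using block_atom_mem_n[OF A(1)] by simp
  next
    case 2
    then have "A = {#1, ?n - 1#}" using block_atom_mem_pair[OF A(1), of 1 "?n - 1"] assms(1) by simp
    then show ?thesis using assms(1) by simp
  next
    case 3
    then show ?thesis using two by (simp add: mult_2)
  next
    case 4
    then have "A = replicate_mset ?n 1" using block_atom_singleton_set[OF A(1), of 1] assms(1) by simp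
    then show ?thesis by simp
  next
    case 5
    have "gcd (?n - 1) ?n = 1"
      using assms(1) by (metis coprime_diff_one_left_nat coprime_iff_gcd_eq_1 \<open>?n > 0\<close>)
    then have "A = replicate_mset ?n (?n - 1)"
      using block_atom_singleton_set[OF A(1) _ 5] assms(1) by simp
    then show ?thesis using big by simp
  next
    case 6
    have "\<Sum>\<^sub># A = count A 1 + m" using sum_mset_two_elements[OF 6(1)] 6(2) assms(1) by simp
    then have "?n dvd count A 1 + m" using block_atom_dvd[OF A(1)] by simp
    then have "?n \<le> count A 1 + m" using assms(1) by (intro dvd_imp_le) auto
    then have "A = replicate_mset m 1 + replicate_mset 1 m"
      using assms(1) 6 by (intro block_atom_replicate_subset[OF A(1) 6(1)]) (auto simp flip: mult_2)
    then show ?thesis by (simp add: mult_2)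
  next
    case 7
    have ne: "?n - 1 \<noteq> m" using assms(1) by simp
    have "\<Sum>\<^sub># A = count A (?n - 1) * (?n - 1) + m"
      using sum_mset_two_elements[OF 7(1) ne] 7(2) by simp
    then have "?n dvd m + count A (?n - 1) * (?n - 1)" using block_atom_dvd[OF A(1)] by (simp add: add.commute)
    then have "m \<le> count A (?n - 1)"
      using not_dvd_add_mult_diff[of 1 ?n m "count A (?n - 1)"] assms(1) by fastforce
    moreover have sum: "m * (?n - 1) + m = m * ?n" using assms(1) by (cases m) (simp_all add: algebra_simps)
    ultimately have "A = replicate_mset m (?n - 1) + replicate_mset 1 m"
      using assms(1) 7 by (intro block_atom_replicate_subset[OF A(1) 7(1) ne]) auto
    then have "\<Sum>\<^sub># A = m * ?n" using sum by simp
    then show ?thesis using big by simp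
  qed
qed

lemma gcd_minus_2: "2 \<le> n \<Longrightarrow> gcd (n - 2) n = (if even n then 2 else 1)" for n :: nat
proof -
  assume "2 \<le> n"
  then have "gcd (n - 2) n = gcd n 2" by (metis gcd.commute gcd_diff1_nat gcd_diff2_nat)
  then show ?thesis by (metis coprime_iff_gcd_eq_1 coprime_right_2_iff_odd gcd.commute gcd_nat.absorb_iff1)
qed

lemma block_atom_1_1_minus_2:
  assumes "block_atom n A" "2 \<le> count A 1" "n - 2 \<in># A" "n \<ge> 4"
  shows "\<Sum>\<^sub># A = n"
proof -
  have "count A (n - 2) > 0" using assms(3) by simp
  then have "{#1, 1, n - 2#} \<subseteq># A" using assms(2,4) by (auto simp: subseteq_mset_def Suc_le_eq)
  moreover have sum: "\<Sum>\<^sub># {#1, 1, n - 2#} = n" using assms(4) by simp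
  ultimately have "{#1, 1, n - 2#} = A" using block_atomD[OF assms(1), of "{#1, 1, n - 2#}"] by simp
  then show ?thesis using sum by simp
qed

text \<open>An atom containing -2 and two 1s is just these three. With a single 1 the number of
  copies of -2 is \<open>d + 2\<close> and the sum is \<open>n + n * d\<close>; with none it is
  \<open>n\<close>, and the sum is \<open>n + 2 * (n * d)\<close>. The other atoms have sum
  \<open>n\<close>.\<close>

lemma block_chf_1_minus_2:
  assumes "d \<ge> 1" "n = 2 * d + 3" "G \<subseteq> {1, n - 2, n}"
  shows "block_chf d n G"
proof (rule block_chf_weights[where N = n and w = "\<lambda>a. a"])
  show "n > 0" using assms by simp
  fix A assume A: "block_atom n A" "set_mset A \<subseteq> G"
  have ne: "1 \<noteq> n - 2" using assms(1,2) by simp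
  consider "n \<in># A" | "2 \<le> count A 1" "n - 2 \<in># A" | "set_mset A \<subseteq> {1}" | "set_mset A \<subseteq> {n - 2}"
    | "set_mset A \<subseteq> {1, n - 2}" "count A 1 = 1"
  proof -
    have "count A 1 = 0 \<or> count A 1 = 1 \<or> 2 \<le> count A 1" by linarith
    then show thesis using A(2) assms(3) that by (auto simp: count_eq_zero_iff)
  qed
  then show "[(\<Sum>a\<in>#A. a) = n] (mod n * d)"
  proof cases
    case 1
    then show ?thesis using block_atom_mem_n[OF A(1)] by simp
  next
    case 2
    then show ?thesis using block_atom_1_1_minus_2[OF A(1)] assms(1,2) by simp
  next
    case 3
    then have "A = replicate_mset n 1" using block_atom_singleton_set[OF A(1), of 1] assms(2) by simp
    then show ?thesis by simp
  next
    case 4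
    have "A = replicate_mset n (n - 2)"
      using block_atom_singleton_set[OF A(1) _ 4] gcd_minus_2[of n] assms(2) by simp
    moreover have "n * (n - 2) = n + n * d * 2" by (simp add: assms(2) algebra_simps)
    ultimately show ?thesis by (simp add: cong_def)
  next
    case 5
    have "\<Sum>\<^sub># A = 1 + count A (n - 2) * (n - 2)"
      using sum_mset_two_elements[OF 5(1) ne] 5(2) by simp
    then have "n dvd 1 + count A (n - 2) * (n - 2)" using block_atom_dvd[OF A(1)] by simp
    then have "d + 2 \<le> count A (n - 2)"
      using not_dvd_add_mult_diff[of 2 n 1 "count A (n - 2)"] assms(2) by (rule_tac ccontr) (simp; presburger)
    moreover have sum: "1 * 1 + (d + 2) * (n - 2) = n + n * d" by (simp add: assms(2) algebra_simps)
    then have "n dvd 1 * 1 + (d + 2) * (n - 2)" by simp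
    ultimately have "A = replicate_mset 1 1 + replicate_mset (d + 2) (n - 2)"
      using 5 by (intro block_atom_replicate_subset[OF A(1) 5(1) ne]) auto
    then have "\<Sum>\<^sub># A = n + n * d" using sum by simp
    then show ?thesis by (simp add: cong_def)
  qed
qed

text \<open>Since \<open>n\<close> is even, a single 1 cannot be balanced by copies of -2 alone. The
  only atom of sum other than \<open>n\<close> consists of n / 2 copies of -2, with sum
  \<open>n + n * d\<close>.\<close>

lemma block_chf_1_2_minus_2:
  assumes "d \<ge> 1" "n = 2 * d + 4" "G \<subseteq> {1, n - 2, 2, n}"
  shows "block_chf d n G"
proof (rule block_chf_weights[where N = n and w = "\<lambda>a. a"])
  show "n > 0" using assms by simp
  fix A assume A: "block_atom n A" "set_mset A \<subseteq> G"
  have ne: "1 \<noteq> n - 2" using assms(1,2) by simp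
  consider "n \<in># A" | "2 \<in># A" "n - 2 \<in># A" | "2 \<le> count A 1" "n - 2 \<in># A" | "set_mset A \<subseteq> {1, 2}" | "set_mset A \<subseteq> {n - 2}"
    | "set_mset A \<subseteq> {1, n - 2}" "count A 1 = 1"
  proof -
    have "count A 1 = 0 \<or> count A 1 = 1 \<or> 2 \<le> count A 1" by linarith
    then show thesis using A(2) assms(3) that by (auto simp: count_eq_zero_iff)
  qed
  then show "[(\<Sum>a\<in>#A. a) = n] (mod n * d)"
  proof cases
    case 1
    then show ?thesis using block_atom_mem_n[OF A(1)] by simp
  next
    case 2
    then have "A = {#2, n - 2#}" using block_atom_mem_pair[OF A(1), of 2 "n - 2"] assms(1,2) by simp
    then have "\<Sum>\<^sub># A = n" using assms(2) by simp
    then show ?thesis by simp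
  next
    case 3
    then show ?thesis using block_atom_1_1_minus_2[OF A(1)] assms(1,2) by simp
  next
    case 4
    \<comment> \<open>As many 2s are taken as fit into a sum of \<open>n\<close>, at most n / 2 = d
      + 2; the 1s can fill the rest because the total is at least \<open>n\<close>.\<close>
    define j where "j = min (count A 2) (d + 2)"
    have "\<Sum>\<^sub># A = count A 1 + count A 2 * 2" using sum_mset_two_elements[OF 4] by simp
    moreover have "n \<le> \<Sum>\<^sub># A"
    proof (rule dvd_imp_le[OF block_atom_dvd[OF A(1)]])
      show "0 < \<Sum>\<^sub># A"
      proof -
        obtain B b where "A = add_mset b B" using block_atom_nonempty[OF A(1)] by (cases A) auto
        then show ?thesis using 4 by auto
      qed
    qed
    ultimately have "n - 2 * j \<le> count A 1" by (auto simp: j_def min_def assms(2))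
    moreover have sum: "(n - 2 * j) * 1 + j * 2 = n" by (simp add: j_def min_def assms(2))
    ultimately have "A = replicate_mset (n - 2 * j) 1 + replicate_mset j 2"
      using \<open>n > 0\<close> by (intro block_atom_replicate_subset[OF A(1) 4]) (auto simp: j_def)
    then have "\<Sum>\<^sub># A = n" using sum by simp
    then show ?thesis by simp
  next
    case 5
    have "A = replicate_mset (n div 2) (n - 2)"
      using block_atom_singleton_set[OF A(1) _ 5] gcd_minus_2[of n] assms(2) by simp
    moreover have "(n div 2) * (n - 2) = n + n * d" by (simp add: assms(2) algebra_simps)
    ultimately show ?thesis by (simp add: cong_def)
  next
    case 6
    have "\<Sum>\<^sub># A = 1 + count A (n - 2) * (n - 2)"
      using sum_mset_two_elements[OF 6(1) ne] 6(2) by simp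
    then have "n dvd 1 + count A (n - 2) * (n - 2)" using block_atom_dvd[OF A(1)] by simp
    moreover have "2 dvd n" and ev: "2 dvd n - 2" using assms(2) by simp_all
    ultimately have "2 dvd 1 + count A (n - 2) * (n - 2)" by (meson dvd_trans)
    moreover have "2 dvd count A (n - 2) * (n - 2)" using ev by (rule dvd_mult)
    ultimately have "2 dvd (1::nat)" by (simp only: dvd_add_left_iff)
    then show ?thesis by simp
  qed
qed

lemma dvd_sum_mset:
  fixes k :: nat
  assumes "\<And>a. a \<in># A \<Longrightarrow> k dvd a"
  shows "k dvd \<Sum>\<^sub># A"
  using assms by (induction A) auto

text \<open>Apart from \<open>m\<close>, all residues involved are even, and so is \<open>n\<close>;
  hence the odd residue \<open>m\<close> occurs an even number of times, and two copies already form
  an atom.\<close>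

lemma block_atom_half_cases:
  assumes h: "gcd h n = 2" "0 < h" "h < n" and n: "n = 2 * m" "odd m"
    and A: "block_atom n A" "set_mset A \<subseteq> {h, n - h, m, n}"
  shows "A = {#n#} \<or> A = {#m, m#} \<or> A = {#h, n - h#} \<or> A = replicate_mset m h \<or> A = replicate_mset m (n - h)"
proof -
  have n0: "n > 0" using h by simp
  have "even h" using h(1) by (metis gcd_dvd1)
  then have ev: "even h" "even (n - h)" using n(1) by auto
  have g: "gcd (n - h) n = 2" using h(1,3) by (metis gcd.commute gcd_diff2_nat gcd_diff1_nat less_imp_le)
  have "h \<noteq> n - h"
  proof
    assume "h = n - h"
    then have "h = m" using h(3) n(1) by linarith
    then show False using ev(1) n(2) by simp
  qed
  show ?thesis
  proof (cases "n \<in># A \<or> (h \<in># A \<and> n - h \<in># A) \<or> 2 \<le> count A m")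
    case True
    then show ?thesis
      using block_atom_mem_n[OF A(1)] block_atom_mem_pair[OF A(1), of h "n - h"]
        block_atom_mem_double[OF A(1), of m] h(3) n(1) \<open>h \<noteq> n - h\<close> by auto
  next
    case False
    then have cnt: "count A m \<le> 1" by simp
    define A' where "A' = filter_mset (\<lambda>a. a \<noteq> m) A"
    have A': "A = replicate_mset (count A m) m + A'"
      by (auto simp: A'_def multiset_eq_iff)
    have "even (\<Sum>\<^sub># A')"
    proof (rule dvd_sum_mset)
      show "2 dvd a" if "a \<in># A'" for a using that A(2) ev False by (auto simp: A'_def)
    qed
    moreover have "even (\<Sum>\<^sub># A)" using block_atom_dvd[OF A(1)] n(1) by auto
    moreover have "\<Sum>\<^sub># A = count A m * m + \<Sum>\<^sub># A'" by (subst A') simp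
    ultimately have "even (count A m * m)" by simp
    then have "count A m = 0" using cnt n(2) by (cases "count A m") auto
    then have "set_mset A \<subseteq> {h} \<or> set_mset A \<subseteq> {n - h}"
      using A(2) False by (auto simp: count_eq_zero_iff)
    then show ?thesis
      using block_atom_singleton_set[OF A(1) n0, of h] block_atom_singleton_set[OF A(1) n0, of "n - h"] h(1) g n(1)
      by auto
  qed
qed

section \<open>Block monoids without a generator\<close>

text \<open>The residue \<open>h\<close> has the same order as 2, and \<open>w\<close> measures it
  as 2 and -h as -2. All atoms have weight \<open>n\<close> except \<open>m\<close> copies of -h,
  with weight \<open>m * (n - 2)\<close>. The presence of \<open>n - h\<close> is recorded so that
  its absence yields half-factoriality.\<close>

lemma sum_weights_half:
  assumes h: "gcd h n = 2" "0 < h" "h < n" and n: "n = 2 * m" "odd m" "m \<ge> 3"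
    and A: "block_atom n A" "set_mset A \<subseteq> {h, n - h, m, n}"
  defines "w \<equiv> \<lambda>a. if a = h then 2 else if a = n - h then n - 2 else a"
  shows "(\<Sum>a\<in>#A. w a) = n \<or> n - h \<in># A \<and> (\<Sum>a\<in>#A. w a) = n + n * (m - 2)"
proof -
  have "even h" using h(1) by (metis gcd_dvd1)
  then have "h \<noteq> m" using n(2) by auto
  then have ne: "h \<noteq> m" "n - h \<noteq> m" "n - h \<noteq> h" "n \<noteq> h" "n \<noteq> n - h" "m \<noteq> h" "m \<noteq> n - h"
    using \<open>h \<noteq> m\<close> n(1,3) h(2,3) by arith+
  have w: "w h = 2" "w (n - h) = n - 2" "w m = m" "w n = n" using ne by (auto simp: w_def)
  obtain f where f: "m = f + 2" using n(3) by (intro that[of "m - 2"]) simp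
  have "m * (n - 2) = n + n * (m - 2)" unfolding n(1) by (simp add: f algebra_simps)
  then show ?thesis
    using block_atom_half_cases[OF h n(1,2) A] n(1,3) w by (elim disjE) auto
qed

lemma block_chf_half:
  assumes h: "gcd h n = 2" "0 < h" "h < n" and n: "n = 2 * m" "odd m" "m \<ge> 3"
    and G: "G \<subseteq> {h, n - h, m, n}"
  shows "block_chf (m - 2) n G"
proof (rule block_chf_weights[where N = n])
  show "n > 0" using h by simp
  fix A assume A: "block_atom n A" "set_mset A \<subseteq> G"
  show "[(\<Sum>a\<in>#A. if a = h then 2 else if a = n - h then n - 2 else a) = n] (mod n * (m - 2))"
    using sum_weights_half[OF h n A(1) subset_trans[OF A(2) G]]
    by (elim disjE conjE) (simp, simp only: cong_def mod_mult_self2 mod_add_self2)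
qed

lemma half_factorial_half:
  assumes h: "gcd h n = 2" "0 < h" "h < n" and n: "n = 2 * m" "odd m" "m \<ge> 3"
    and G: "G \<subseteq> {h, m, n}"
  shows "block_chf 0 n G"
proof (rule block_chf_weights[where N = n])
  show "n > 0" using h by simp
  have "even h" using h(1) by (metis gcd_dvd1)
  then have "h \<noteq> m" using n(2) by auto
  then have "n - h \<noteq> h" "n - h \<noteq> m" "n - h \<noteq> n" using n(1) h(2,3) by arith+
  fix A assume A: "block_atom n A" "set_mset A \<subseteq> G"
  then have "n - h \<notin># A" using G \<open>n - h \<noteq> h\<close> \<open>n - h \<noteq> m\<close> \<open>n - h \<noteq> n\<close> by auto
  moreover have "set_mset A \<subseteq> {h, n - h, m, n}" using A(2) G by blast
  ultimately show "[(\<Sum>a\<in>#A. if a = h then 2 else if a = n - h then n - 2 else a) = n] (mod n * 0)"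
    using sum_weights_half[OF h n A(1)] by simp
qed

text \<open>For each element, gcd or order must exceed \<open>d\<close>, or \<open>G\<close> would
  be half-factorial. As \<open>n \<le> 2 * d + 4\<close> and gcd 1 is excluded, only zero, n / 2 and
  elements of order n / 2 remain. Generation of the group forces an element \<open>h\<close> of gcd
  2 and odd n / 2 in \<open>G\<close>; failure of half-factoriality forces a second element of gcd
  2, and comparing indices identifies it as -h.\<close>

lemma classify_no_generator:
  assumes G: "G \<subseteq> {1..n}" and chf: "block_chf d n G" and not_hf: "\<not> block_chf 0 n G"
    and n_le: "n \<le> 2 * d + 4" and d_ge: "d \<ge> 100" and n_ge: "n \<ge> 200"
    and no_gen: "\<And>a. a \<in> G \<Longrightarrow> gcd a n \<noteq> 1"
    and gen: "\<And>t. t dvd n \<Longrightarrow> (\<And>a. a \<in> G \<Longrightarrow> t dvd a) \<Longrightarrow> t = 1"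
  shows "n = 2 * d + 4 \<and> odd (n div 2) \<and>
    (\<exists>h. gcd h n = 2 \<and> 0 < h \<and> h < n \<and> G - {n} = {h, n - h, n div 2})"
proof -
  have n_pos: "n > 0" using n_ge by simp
  have cs: "gcd a n = 2 \<or> a = n \<or> n = 2 * a" if a: "a \<in> G" for a
  proof -
    define r where "r = gcd a n"
    obtain m where m: "n = r * m" by (metis r_def gcd_dvd2 dvdE)
    have r: "r > 0" using n_pos by (simp add: r_def)
    have "n div r = m" using m r by simp
    then have big: "d < r \<or> d < m"
      using block_chf_small_order[OF n_pos a chf] not_hf unfolding r_def by linarith
    obtain q where q: "a = r * q" by (metis r_def gcd_dvd1 dvdE)
    have "1 \<le> a" "a \<le> n" using a G by auto
    then have "q \<noteq> 0" "r * q \<le> r * m" using q m by auto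
    then have "q > 0" "q \<le> m" using r by simp_all
    have "r \<noteq> 1" using no_gen[OF a] by (simp add: r_def)
    then consider "r = 2" | "r \<ge> 3" using r by linarith
    then show ?thesis
    proof cases
      case 2
      then have "3 * m \<le> n" unfolding m by (rule mult_le_mono1)
      then have "d < r" using big n_le d_ge by linarith
      have "m < 3"
      proof (rule ccontr)
        assume "\<not> m < 3"
        then have "r * 3 \<le> n" unfolding m by (intro mult_le_mono2) simp
        then show False using \<open>d < r\<close> n_le d_ge by linarith
      qed
      then have "m = 1 \<or> (m = 2 \<and> q = 1) \<or> (m = 2 \<and> q = 2)" using \<open>q > 0\<close> \<open>q \<le> m\<close> by linarith
      then show ?thesis using m q \<open>q > 0\<close> \<open>q \<le> m\<close> by auto
    qed (simp add: r_def)
  qed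
  have "\<exists>h\<in>G. gcd h n = 2"
  proof (rule ccontr)
    assume none: "\<not> (\<exists>h\<in>G. gcd h n = 2)"
    then have all: "a = n \<or> n = 2 * a" if "a \<in> G" for a using cs[OF that] none that by blast
    \<comment> \<open>Otherwise \<open>G\<close> lies in the subgroup of order at most 2, all of
      whose elements are multiples of \<open>t\<close>.\<close>
    define t where "t = (if even n then n div 2 else n)"
    have "t dvd n" by (auto simp: t_def)
    moreover have "t dvd a" if "a \<in> G" for a using all[OF that] \<open>t dvd n\<close> by (auto simp: t_def)
    ultimately have "t = 1" by (rule gen)
    then show False using n_ge by (auto simp: t_def split: if_splits)
  qed
  then obtain h where h: "h \<in> G" "gcd h n = 2" by blast
  have hb: "0 < h" "h < n"
  proof -
    have "1 \<le> h" "h \<le> n" using G h(1) by auto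
    moreover have "h \<noteq> n" using h(2) n_ge by auto
    ultimately show "0 < h" "h < n" by auto
  qed
  have "2 dvd n" "2 dvd h" using h(2) by (metis gcd_dvd2, metis gcd_dvd1)
  define m where "m = n div 2"
  have nm: "n = 2 * m" using \<open>2 dvd n\<close> by (simp add: m_def)
  have "m \<in> G \<and> odd m"
  proof (rule ccontr)
    assume not: "\<not> (m \<in> G \<and> odd m)"
    have "2 dvd a" if a: "a \<in> G" for a
      using cs[OF a]
    proof (elim disjE)
      assume "gcd a n = 2"
      then show ?thesis by (metis gcd_dvd1)
    next
      assume "n = 2 * a"
      then have "a = m" using nm by simp
      then show ?thesis using not a by blast
    qed (use \<open>2 dvd n\<close> in simp)
    then have "(2::nat) = 1" by (rule gen[OF \<open>2 dvd n\<close>])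
    then show False by simp
  qed
  then have m: "m \<in> G" "odd m" by auto
  have other: "n = 2 * d + 4 \<and> a = n - h" if a: "a \<in> G" "gcd a n = 2" "a \<noteq> h" for a
  proof -
    have ab: "1 \<le> a" "a \<le> n" using a(1) G by auto
    have "a \<noteq> n" using a(2) n_ge by auto
    obtain y where y: "1 \<le> y" "y \<le> m" "[y * h = a] (mod n)" "[y = 1] (mod d)"
      using ex_index_same_gcd[OF n_pos h(1) a(1) chf] h(2) a(2) by (auto simp: m_def)
    have "y \<noteq> 1"
    proof
      assume "y = 1"
      then have "[h = a] (mod n)" using y(3) by simp
      then show False using cong_interval_eq[of h a n] hb ab a(3) by simp
    qed
    then have "y = 1 + d"
      using cong_1_cases[OF y(4,1)] y(2) n_le nm d_ge by linarith
    \<comment> \<open>Now \<open>y\<close> is \<open>m\<close> or \<open>m - 1\<close>. The first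
      makes \<open>a\<close> zero because \<open>m * h\<close> is, the second makes it -h.\<close>
    then have "m = d + 1 \<or> m = d + 2" using y(2) n_le nm by linarith
    then show ?thesis
    proof
      assume "m = d + 1"
      then have "y = m" using \<open>y = 1 + d\<close> by simp
      moreover have "n dvd m * h" using \<open>2 dvd h\<close> nm by (auto simp: mult.commute elim!: dvdE)
      ultimately have "n dvd a" using cong_dvd_iff[OF y(3)] by simp
      then show ?thesis using ab \<open>a \<noteq> n\<close> by (auto dest!: dvd_imp_le)
    next
      assume md: "m = d + 2"
      then have "m = y + 1" using \<open>y = 1 + d\<close> by simp
      then have "m * h = y * h + h" by simp
      moreover have "n dvd m * h" using \<open>2 dvd h\<close> nm by (auto simp: mult.commute elim!: dvdE)
      ultimately have "n dvd a + h"
        using cong_dvd_iff[OF cong_add[OF y(3) cong_refl[of h]]] by simp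
      then obtain k where k: "a + h = n * k" by blast
      have "n * k < n * 2" using k ab hb \<open>a \<noteq> n\<close> by linarith
      moreover have "k \<noteq> 0" using k hb by (cases k) auto
      ultimately have "k = 1" by simp
      then show ?thesis using k md nm by simp
    qed
  qed
  have "\<not> G \<subseteq> {h, m, n}"
    using half_factorial_half[OF h(2) hb nm m(2)] not_hf nm n_ge by auto
  then obtain a where a: "a \<in> G" "a \<noteq> h" "a \<noteq> m" "a \<noteq> n" by blast
  then have "gcd a n = 2" using cs[OF a(1)] nm by auto
  then have n: "n = 2 * d + 4" "n - h \<in> G" using other[OF a(1) _ a(2)] a(1) by auto
  have "G - {n} = {h, n - h, m}"
  proof
    show "G - {n} \<subseteq> {h, n - h, m}"
    proof
      fix b assume b: "b \<in> G - {n}"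
      then have "gcd b n = 2 \<or> b = m" using cs[of b] nm by auto
      then show "b \<in> {h, n - h, m}" using other[of b] b by auto
    qed
    show "{h, n - h, m} \<subseteq> G - {n}" using h(1) n(2) m(1) hb nm n_ge by auto
  qed
  then show ?thesis using n(1) m(2) h(2) hb by (auto simp: m_def)
qed

section \<open>Transfer to Krull monoids\<close>

text \<open>\<open>\<Theta>\<close> is a transfer homomorphism onto the monoid of zero-sum multisets
  over \<open>G\<close>: every such multiset is attained, only units have empty image, and
  \<open>split\<close> lifts a splitting of the image to one of the element itself. Lengths of
  factorizations are preserved by such a map.\<close>

locale block_transfer = comm_monoid_cancel H for H (structure) +
  fixes \<Theta> :: "'a \<Rightarrow> nat multiset" and n :: nat and G :: "nat set"
  assumes mult: "\<And>a b. a \<in> carrier H \<Longrightarrow> b \<in> carrier H \<Longrightarrow> \<Theta> (a \<otimes> b) = \<Theta> a + \<Theta> b"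
    and zero_sum: "\<And>a. a \<in> carrier H \<Longrightarrow> n dvd \<Sum>\<^sub># (\<Theta> a)"
    and support: "\<And>a. a \<in> carrier H \<Longrightarrow> set_mset (\<Theta> a) \<subseteq> G"
    and unit: "\<And>a. a \<in> carrier H \<Longrightarrow> \<Theta> a = {#} \<Longrightarrow> a \<in> Units H"
    and surj: "\<And>B. set_mset B \<subseteq> G \<Longrightarrow> n dvd \<Sum>\<^sub># B \<Longrightarrow> \<exists>a\<in>carrier H. \<Theta> a = B"
    and split: "\<And>a B C. a \<in> carrier H \<Longrightarrow> \<Theta> a = B + C \<Longrightarrow> n dvd \<Sum>\<^sub># B \<Longrightarrow>
      \<exists>b\<in>carrier H. \<exists>c\<in>carrier H. a = b \<otimes> c \<and> \<Theta> b = B \<and> \<Theta> c = C"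
begin

lemma transfer_one: "\<Theta> \<one> = {#}"
  using mult[of \<one> \<one>] by simp

lemma transfer_unit_iff: "a \<in> carrier H \<Longrightarrow> \<Theta> a = {#} \<longleftrightarrow> a \<in> Units H"
proof
  assume "a \<in> Units H" "a \<in> carrier H"
  then have "\<Theta> (a \<otimes> inv a) = \<Theta> a + \<Theta> (inv a)" by (intro mult) auto
  then show "\<Theta> a = {#}" using \<open>a \<in> Units H\<close> transfer_one by simp
qed (rule unit)

lemma irreducible_iff:
  assumes a: "a \<in> carrier H"
  shows "Divisibility.irreducible H a \<longleftrightarrow> block_atom n (\<Theta> a)"
proof
  assume irr: "Divisibility.irreducible H a"
  show "block_atom n (\<Theta> a)"
  proof (rule block_atomI)
    show "\<Theta> a \<noteq> {#}" using irr a transfer_unit_iff by (simp add: Divisibility.irreducible_def)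
    show "n dvd \<Sum>\<^sub># (\<Theta> a)" using zero_sum[OF a] .
    fix B assume B: "B \<subseteq># \<Theta> a" "n dvd \<Sum>\<^sub># B" "B \<noteq> {#}"
    have "\<Theta> a = B + (\<Theta> a - B)" using B(1) by simp
    then obtain b c where bc: "b \<in> carrier H" "c \<in> carrier H" "a = b \<otimes> c" "\<Theta> b = B"
      using split[OF a _ B(2)] by blast
    have "b \<notin> Units H" using transfer_unit_iff[OF bc(1)] bc(4) B(3) by simp
    moreover have "b divides a" using bc by (auto simp: factor_def)
    ultimately have "a divides b" using irr bc(1)
      unfolding Divisibility.irreducible_def properfactor_def by blast
    then obtain e where "e \<in> carrier H" "b = a \<otimes> e" by (auto simp: factor_def)
    then have "\<Theta> b = \<Theta> a + \<Theta> e" using mult a by simp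
    then have "\<Theta> a \<subseteq># B" using bc(4) by simp
    then show "B = \<Theta> a" using B(1) by (rule subset_mset.antisym[rotated])
  qed
next
  assume at: "block_atom n (\<Theta> a)"
  show "Divisibility.irreducible H a"
    unfolding Divisibility.irreducible_def
  proof (intro conjI ballI impI)
    show "a \<notin> Units H" using block_atom_nonempty[OF at] transfer_unit_iff[OF a] by simp
    fix b assume b: "b \<in> carrier H" and pf: "properfactor H b a"
    then obtain c where c: "c \<in> carrier H" "a = b \<otimes> c" by (auto simp: properfactor_def factor_def)
    then have sum: "\<Theta> a = \<Theta> b + \<Theta> c" using mult b by simp
    show "b \<in> Units H"
    proof (rule ccontr)
      assume "b \<notin> Units H"
      then have "\<Theta> b \<noteq> {#}" using transfer_unit_iff[OF b] by simp
      then have "\<Theta> b = \<Theta> a" using block_atomD[OF at _ zero_sum[OF b]] sum by simp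
      then have "c \<in> Units H" using sum unit[OF c(1)] by simp
      then have "b = a \<otimes> inv c" using c b by (simp add: m_assoc)
      then have "a divides b" using \<open>c \<in> Units H\<close> by (auto simp: factor_def)
      then show False using pf by (simp add: properfactor_def)
    qed
  qed
qed

lemma transfer_factors:
  assumes "set fs \<subseteq> carrier H" "\<forall>x\<in>set fs. Divisibility.irreducible H x"
  shows "block_fact n G (mset (map \<Theta> fs)) \<and>
    \<Sum>\<^sub># (mset (map \<Theta> fs)) = \<Theta> (foldr (\<otimes>) fs \<one>)"
  using assms
proof (induction fs)
  case (Cons f fs)
  then show ?case
    using irreducible_iff[of f] support[of f] mult[of f "foldr (\<otimes>) fs \<one>"] multlist_closed[of fs] by simp
qed (simp add: transfer_one)

text \<open>Atoms are peeled off with \<open>split\<close>. The induction ends at a single atom, not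
  at the empty multiset, because a unit other than the identity is not the exact product of an empty
  list.\<close>

lemma lift_block_fact:
  assumes "F \<noteq> {#}" "block_fact n G F" "a \<in> carrier H" "\<Sum>\<^sub># F = \<Theta> a"
  shows "\<exists>fs. set fs \<subseteq> carrier H \<and> factors H fs a \<and> length fs = size F"
  using assms
proof (induction F arbitrary: a)
  case (add A F)
  then have A: "block_atom n A" "block_fact n G F" by auto
  show ?case
  proof (cases "F = {#}")
    case True
    then have "\<Theta> a = A" using add.prems(4) by simp
    then have "factors H [a] a" using irreducible_iff[OF add.prems(3)] A(1) add.prems(3)
      by (simp add: factors_def)
    then show ?thesis using add.prems(3) True by (intro exI[of _ "[a]"]) simp
  next
    case False
    have "\<Theta> a = A + \<Sum>\<^sub># F" using add.prems(4) by simp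
    then obtain b c where bc: "b \<in> carrier H" "c \<in> carrier H" "a = b \<otimes> c" "\<Theta> b = A" "\<Theta> c = \<Sum>\<^sub># F"
      using split[OF add.prems(3) _ block_atom_dvd[OF A(1)]] by blast
    obtain fs where fs: "set fs \<subseteq> carrier H" "factors H fs c" "length fs = size F"
      using add.IH[OF False A(2) bc(2) bc(5)[symmetric]] by blast
    have "factors H (b # fs) a"
      using fs(2) irreducible_iff[OF bc(1)] bc(3,4) A(1) by (simp add: factors_def)
    then show ?thesis using fs bc(1) by (intro exI[of _ "b # fs"]) simp
  qed
qed simp

lemma length_set_eq:
  assumes a: "a \<in> carrier H"
  shows "length_set H a = {size F | F. block_fact n G F \<and> \<Sum>\<^sub># F = \<Theta> a}"
proof (cases "a \<in> Units H")
  case True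
  then have empty: "\<Theta> a = {#}" using transfer_unit_iff[OF a] by simp
  have "F = {#}" if "block_fact n G F" "\<Sum>\<^sub># F = {#}" for F
    using that by (cases F) (auto dest: block_atom_nonempty)
  then have "{size F | F. block_fact n G F \<and> \<Sum>\<^sub># F = {#}} = {0}" by force
  then show ?thesis using True by (simp add: length_set_def empty)
next
  case False
  then have ne: "\<Theta> a \<noteq> {#}" using transfer_unit_iff[OF a] by simp
  show ?thesis
  proof (intro equalityI subsetI)
    fix l assume "l \<in> length_set H a"
    then obtain fs where fs: "l = length fs" "set fs \<subseteq> carrier H" "factors H fs a"
      using False by (auto simp: length_set_def)
    then have "block_fact n G (mset (map \<Theta> fs))" "\<Sum>\<^sub># (mset (map \<Theta> fs)) = \<Theta> a"
      using transfer_factors[OF fs(2)] by (auto simp: factors_def)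
    moreover have "l = size (mset (map \<Theta> fs))" using fs(1) by simp
    ultimately show "l \<in> {size F | F. block_fact n G F \<and> \<Sum>\<^sub># F = \<Theta> a}" by blast
  next
    fix l assume "l \<in> {size F | F. block_fact n G F \<and> \<Sum>\<^sub># F = \<Theta> a}"
    then obtain F where F: "l = size F" "block_fact n G F" "\<Sum>\<^sub># F = \<Theta> a" by blast
    then have "F \<noteq> {#}" using ne by auto
    then obtain fs where "set fs \<subseteq> carrier H" "factors H fs a" "l = length fs"
      using lift_block_fact[OF _ F(2) a F(3)] F(1) by auto
    then show "l \<in> length_set H a" using False by (auto simp: length_set_def)
  qed
qed

lemma congruence_half_factorial_iff: "congruence_half_factorial d H \<longleftrightarrow> block_chf d n G"
proof
  assume chf: "congruence_half_factorial d H"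
  show "block_chf d n G"
    unfolding block_chf_def
  proof (intro allI impI)
    fix F F' assume F: "block_fact n G F" "block_fact n G F'" "\<Sum>\<^sub># F = \<Sum>\<^sub># F'"
    have "set_mset (\<Sum>\<^sub># F) \<subseteq> G" using F(1) by (auto simp: block_fact_def)
    moreover have "n dvd \<Sum>\<^sub># (\<Sum>\<^sub># F)"
      using F(1) by (induction F) (auto dest: block_atom_dvd)
    ultimately obtain a where a: "a \<in> carrier H" "\<Theta> a = \<Sum>\<^sub># F" using surj by blast
    then have "size F \<in> length_set H a" "size F' \<in> length_set H a"
      using F by (auto simp: length_set_eq[OF a(1)])
    then show "[size F = size F'] (mod d)"
      using chf a(1) by (auto simp: congruence_half_factorial_def)
  qed
next
  assume "block_chf d n G"
  then show "congruence_half_factorial d H"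
    unfolding congruence_half_factorial_def
    by (auto simp: length_set_eq intro: block_chfD)
qed

lemma half_factorial_if_block:
  assumes "block_chf 0 n G"
  shows "half_factorial H"
  unfolding half_factorial_def
proof
  fix a assume a: "a \<in> carrier H"
  obtain F where F: "block_fact n G F" "\<Sum>\<^sub># F = \<Theta> a"
    using ex_block_fact[OF support[OF a] zero_sum[OF a]] by blast
  have "length_set H a = {size F}"
  proof (intro equalityI subsetI)
    fix l assume "l \<in> length_set H a"
    then obtain F' where F': "l = size F'" "block_fact n G F'" "\<Sum>\<^sub># F' = \<Theta> a"
      unfolding length_set_eq[OF a] by blast
    have "\<Sum>\<^sub># F = \<Sum>\<^sub># F'" using F(2) F'(3) by simp
    then have "[size F = size F'] (mod 0)" by (rule block_chfD[OF assms F(1) F'(2)])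
    then show "l \<in> {size F}" using F'(1) by simp
  next
    fix l assume "l \<in> {size F}"
    then show "l \<in> length_set H a" unfolding length_set_eq[OF a] using F by blast
  qed
  then show "card (length_set H a) = 1" by simp
qed

end

section \<open>Effective divisors as multisets of primes, and the class group\<close>

definition frag_of_mset :: "'p multiset \<Rightarrow> ('p \<Rightarrow>\<^sub>0 int)" where
  "frag_of_mset M = (\<Sum>p\<in>#M. frag_of p)"

lemma frag_of_mset_simps [simp]:
  "frag_of_mset {#} = 0" "frag_of_mset (add_mset p M) = frag_of p + frag_of_mset M"
  "frag_of_mset (M + M') = frag_of_mset M + frag_of_mset M'"
  by (simp_all add: frag_of_mset_def)

lemma lookup_frag_of_mset: "Poly_Mapping.lookup (frag_of_mset M) p = int (count M p)"
  by (induction M) (auto simp: lookup_add)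

lemma inj_frag_of_mset: "frag_of_mset M = frag_of_mset M' \<longleftrightarrow> M = M'"
  by (metis lookup_frag_of_mset multiset_eqI of_nat_eq_iff)

lemma keys_frag_of_mset: "Poly_Mapping.keys (frag_of_mset M) = set_mset M"
  by (auto simp: in_keys_iff lookup_frag_of_mset)

lemma ex_frag_of_mset:
  assumes "\<And>p. 0 \<le> Poly_Mapping.lookup x p"
  shows "\<exists>M. x = frag_of_mset M"
proof -
  define M where "M = Abs_multiset (\<lambda>p. nat (Poly_Mapping.lookup x p))"
  have "finite {p. 0 < nat (Poly_Mapping.lookup x p)}"
    by (rule finite_subset[OF _ finite_keys[of x]]) (auto simp: in_keys_iff)
  then have "count M p = nat (Poly_Mapping.lookup x p)" for p by (simp add: M_def count_Abs_multiset)
  then have "x = frag_of_mset M"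
    using assms by (intro poly_mapping_eqI) (simp add: lookup_frag_of_mset)
  then show ?thesis ..
qed

lemma ex_frag_diff: "\<exists>M M'. x = frag_of_mset M - frag_of_mset M' \<and> set_mset M \<union> set_mset M' \<subseteq> Poly_Mapping.keys x"
  for x :: "'p \<Rightarrow>\<^sub>0 int"
proof -
  define pos where "pos = Abs_multiset (\<lambda>p. nat (Poly_Mapping.lookup x p))"
  define neg where "neg = Abs_multiset (\<lambda>p. nat (- Poly_Mapping.lookup x p))"
  have "finite {p. 0 < nat (Poly_Mapping.lookup x p)}" "finite {p. 0 < nat (- Poly_Mapping.lookup x p)}"
    by (rule finite_subset[OF _ finite_keys[of x]]; auto simp: in_keys_iff)+
  then have c: "count pos p = nat (Poly_Mapping.lookup x p)" "count neg p = nat (- Poly_Mapping.lookup x p)" for p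
    by (simp_all add: pos_def neg_def count_Abs_multiset)
  have "x = frag_of_mset pos - frag_of_mset neg"
    by (intro poly_mapping_eqI) (simp add: lookup_minus lookup_frag_of_mset c)
  moreover have "set_mset pos \<union> set_mset neg \<subseteq> Poly_Mapping.keys x"
  proof
    fix p assume "p \<in> set_mset pos \<union> set_mset neg"
    then have "count pos p > 0 \<or> count neg p > 0" by auto
    then show "p \<in> Poly_Mapping.keys x" by (auto simp: c in_keys_iff)
  qed
  ultimately show ?thesis by blast
qed

locale divisor_hom = comm_monoid_cancel H for H (structure) +
  fixes P :: "'p set" and \<phi> :: "'a \<Rightarrow> ('p \<Rightarrow>\<^sub>0 int)"
  assumes divisor_hom: "divisor_homomorphism H P \<phi>"
begin

abbreviation F where "F \<equiv> free_Abelian_group P"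
abbreviation C where "C \<equiv> class_group H P \<phi>"

definition N where "N = {\<phi> a - \<phi> b | a b. a \<in> carrier H \<and> b \<in> carrier H}"
definition cl where "cl x = N #>\<^bsub>F\<^esub> x"
definition prime_classes where "prime_classes = cl ` frag_of ` P"

lemma C_def: "C = F Mod N"
  by (simp add: class_group_def N_def)

lemma keys_phi: "a \<in> carrier H \<Longrightarrow> Poly_Mapping.keys (\<phi> a) \<subseteq> P"
  and phi_nonneg: "a \<in> carrier H \<Longrightarrow> 0 \<le> Poly_Mapping.lookup (\<phi> a) p"
  using divisor_hom by (auto simp: divisor_homomorphism_def free_abelian_monoid_def hom_def Pi_def)

lemma phi_mult: "a \<in> carrier H \<Longrightarrow> b \<in> carrier H \<Longrightarrow> \<phi> (a \<otimes> b) = \<phi> a + \<phi> b"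
  using divisor_hom by (auto simp: divisor_homomorphism_def free_abelian_monoid_def hom_def)

lemma phi_one: "\<phi> \<one> = 0"
  using phi_mult[of \<one> \<one>] by simp

text \<open>An effective difference of principal divisors is divisibility in the free monoid, which
  a divisor homomorphism reflects; cancellation identifies the image of the quotient with
  \<open>x\<close>.\<close>

lemma divides_if_phi_diff:
  assumes "a \<in> carrier H" "b \<in> carrier H" "\<phi> b = \<phi> a + x" "Poly_Mapping.keys x \<subseteq> P"
    "\<And>p. 0 \<le> Poly_Mapping.lookup x p"
  shows "\<exists>c\<in>carrier H. b = a \<otimes> c \<and> \<phi> c = x"
proof -
  have "\<phi> a divides\<^bsub>free_abelian_monoid P\<^esub> \<phi> b"
    unfolding factor_def using assms(3-5) by (intro bexI[of _ x]) (simp_all add: free_abelian_monoid_def)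
  then have "a divides b"
    using divisor_hom assms(1,2) by (auto simp: divisor_homomorphism_def)
  then obtain c where c: "c \<in> carrier H" "b = a \<otimes> c" by (auto simp: factor_def)
  then have "\<phi> a + \<phi> c = \<phi> a + x" using phi_mult[OF assms(1) c(1)] assms(3) by simp
  then show ?thesis using c by auto
qed

lemma unit_if_phi_zero:
  assumes "a \<in> carrier H" "\<phi> a = 0"
  shows "a \<in> Units H"
proof -
  obtain c where "c \<in> carrier H" "\<one> = a \<otimes> c"
    using divides_if_phi_diff[OF assms(1) one_closed, of 0] assms(2) phi_one by auto
  then show ?thesis using assms(1) by (metis m_comm unit_factor Units_one_closed)
qed

lemma subgroup_N: "subgroup N F"
proof (rule group.subgroupI[OF group_free_Abelian_group])
  show "N \<subseteq> carrier F" using keys_phi by (fastforce simp: N_def dest: subsetD[OF keys_diff])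
  show "N \<noteq> {}" using one_closed by (auto simp: N_def)
  fix x assume "x \<in> N"
  then obtain a b where ab: "x = \<phi> a - \<phi> b" "a \<in> carrier H" "b \<in> carrier H" by (auto simp: N_def)
  have "Poly_Mapping.keys x \<subseteq> P" using keys_phi ab by (fastforce dest: subsetD[OF keys_diff])
  then show "inv\<^bsub>F\<^esub> x \<in> N" using ab by (auto simp: N_def)
  fix y assume "y \<in> N"
  then obtain a' b' where ab': "y = \<phi> a' - \<phi> b'" "a' \<in> carrier H" "b' \<in> carrier H" by (auto simp: N_def)
  have "x + y = \<phi> (a \<otimes> a') - \<phi> (b \<otimes> b')" using ab ab' by (simp add: phi_mult)
  then show "x \<otimes>\<^bsub>F\<^esub> y \<in> N" using ab ab' by (auto simp: N_def)
qed

lemma normal_N: "N \<lhd> F"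
  using comm_group.subgroup_imp_normal[OF abelian_free_Abelian_group subgroup_N] .

lemma group_C: "group C"
  unfolding C_def by (rule normal.factorgroup_is_group[OF normal_N])

lemma carrier_C: "carrier C = cl ` carrier F"
  unfolding C_def by (auto simp: carrier_FactGroup cl_def)

lemma cl_in_C: "Poly_Mapping.keys x \<subseteq> P \<Longrightarrow> cl x \<in> carrier C"
  by (simp add: carrier_C)

lemma cl_add:
  assumes "Poly_Mapping.keys x \<subseteq> P" "Poly_Mapping.keys y \<subseteq> P"
  shows "cl (x + y) = cl x \<otimes>\<^bsub>C\<^esub> cl y"
  using normal.r_coset_hom_Mod[OF normal_N] assms by (auto simp: hom_def cl_def C_def)

lemma cl_eq_one_iff:
  assumes "Poly_Mapping.keys x \<subseteq> P"
  shows "cl x = \<one>\<^bsub>C\<^esub> \<longleftrightarrow> x \<in> N"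
proof -
  have x: "x \<in> carrier F" using assms by simp
  have "cl x = N \<longleftrightarrow> x \<in> N"
    using group.coset_join1[OF group_free_Abelian_group _ x subgroup_N]
      group.coset_join2[OF group_free_Abelian_group x subgroup_N] group.rcos_self[OF group_free_Abelian_group x subgroup_N]
    by (auto simp: cl_def)
  then show ?thesis by (simp add: C_def)
qed

text \<open>A trivial class only says that the divisor is a difference of two principal ones. For an
  effective divisor this is divisibility, so the quotient exists in \<open>H\<close> and the divisor
  is itself principal.\<close>

lemma cl_eq_one_iff_phi:
  assumes "set_mset M \<subseteq> P"
  shows "cl (frag_of_mset M) = \<one>\<^bsub>C\<^esub> \<longleftrightarrow> (\<exists>a\<in>carrier H. \<phi> a = frag_of_mset M)"
proof -
  have k: "Poly_Mapping.keys (frag_of_mset M) \<subseteq> P" using assms by (simp add: keys_frag_of_mset)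
  have "frag_of_mset M \<in> N \<longleftrightarrow> (\<exists>a\<in>carrier H. \<phi> a = frag_of_mset M)"
  proof
    assume "frag_of_mset M \<in> N"
    then obtain a b where ab: "frag_of_mset M = \<phi> a - \<phi> b" "a \<in> carrier H" "b \<in> carrier H"
      by (auto simp: N_def)
    then have "\<phi> a = \<phi> b + frag_of_mset M" by simp
    then show "\<exists>a\<in>carrier H. \<phi> a = frag_of_mset M"
      using divides_if_phi_diff[OF ab(3,2) _ k] by (auto simp: lookup_frag_of_mset)
  next
    assume "\<exists>a\<in>carrier H. \<phi> a = frag_of_mset M"
    then obtain a where "a \<in> carrier H" "frag_of_mset M = \<phi> a - \<phi> \<one>" by (auto simp: phi_one)
    then show "frag_of_mset M \<in> N" using one_closed by (auto simp: N_def)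
  qed
  then show ?thesis using cl_eq_one_iff[OF k] by simp
qed

lemma nonzero_prime_classes_eq: "nonzero_prime_classes H P \<phi> = prime_classes - {\<one>\<^bsub>C\<^esub>}"
proof -
  have "(\<exists>p\<in>P. frag_of p \<in> g) \<longleftrightarrow> g \<in> prime_classes" if g: "g \<in> carrier C" for g
  proof
    assume "\<exists>p\<in>P. frag_of p \<in> g"
    then obtain p where p: "p \<in> P" "frag_of p \<in> g" by blast
    obtain x where x: "x \<in> carrier F" "g = cl x" using g carrier_C by auto
    then have "g = cl (frag_of p)"
      using group.repr_independence[OF group_free_Abelian_group _ x(1) subgroup_N] p(2)
      by (auto simp: cl_def)
    then show "g \<in> prime_classes" using p(1) by (auto simp: prime_classes_def)
  next
    assume "g \<in> prime_classes"
    then obtain p where "p \<in> P" "g = cl (frag_of p)" by (auto simp: prime_classes_def)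
    then show "\<exists>p\<in>P. frag_of p \<in> g"
      using group.rcos_self[OF group_free_Abelian_group _ subgroup_N, of "frag_of p"]
      by (auto simp: cl_def)
  qed
  moreover have "prime_classes \<subseteq> carrier C" by (auto simp: prime_classes_def intro!: cl_in_C)
  ultimately show ?thesis by (auto simp: nonzero_prime_classes_def)
qed

end

text \<open>The generator \<open>c\<close> fixes the coordinates: a class is written as
  \<open>c\<close> to an exponent in 1..n, with \<open>n\<close> for the zero class. It stays a
  parameter so that coordinates can be changed; if \<open>c\<close> itself contains primes, 1 is an
  exponent of a prime class.\<close>

locale divisor_hom_generator = divisor_hom H P \<phi> for H (structure) and P :: "'p set" and \<phi> +
  fixes c :: "('p \<Rightarrow>\<^sub>0 int) set" and n :: nat
  assumes c_in: "c \<in> carrier C" and n_pos: "n > 0"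
    and ord_c: "group.ord C c = n" and order_C: "order C = n"
begin

interpretation C: group C by (rule group_C)

definition exponents where "exponents = {k \<in> {1..n}. c [^]\<^bsub>C\<^esub> k \<in> prime_classes}"

lemma inj_pow: "inj_on (\<lambda>k. c [^]\<^bsub>C\<^esub> k) {1..n}"
  using C.ord_inj'[OF c_in] by (simp add: ord_c)

lemma carrier_eq_pow: "carrier C = (\<lambda>k. c [^]\<^bsub>C\<^esub> k) ` {1..n}"
proof (rule sym, rule card_subset_eq)
  show "finite (carrier C)" using order_C n_pos by (simp add: order_def card_ge_0_finite)
  show "(\<lambda>k. c [^]\<^bsub>C\<^esub> k) ` {1..n} \<subseteq> carrier C" using c_in by auto
  show "card ((\<lambda>k. c [^]\<^bsub>C\<^esub> k) ` {1..n}) = card (carrier C)"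
    using card_image[OF inj_pow] order_C by (simp add: order_def)
qed

definition z where "z p = (SOME k. k \<in> {1..n} \<and> c [^]\<^bsub>C\<^esub> k = cl (frag_of p))"

lemma z: "p \<in> P \<Longrightarrow> z p \<in> {1..n} \<and> c [^]\<^bsub>C\<^esub> z p = cl (frag_of p)"
proof -
  assume "p \<in> P"
  then have "cl (frag_of p) \<in> carrier C" by (intro cl_in_C) simp
  then have "\<exists>k. k \<in> {1..n} \<and> c [^]\<^bsub>C\<^esub> k = cl (frag_of p)" unfolding carrier_eq_pow by auto
  then show ?thesis unfolding z_def by (rule someI_ex)
qed

lemma z_image: "z ` P = exponents"
proof (intro equalityI subsetI)
  fix k assume "k \<in> exponents"
  then obtain p where p: "k \<in> {1..n}" "p \<in> P" "c [^]\<^bsub>C\<^esub> k = cl (frag_of p)"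
    by (auto simp: exponents_def prime_classes_def)
  then have "k = z p" using z[OF p(2)] inj_onD[OF inj_pow, of k "z p"] by auto
  then show "k \<in> z ` P" using p(2) by blast
qed (use z in \<open>auto simp: exponents_def prime_classes_def\<close>)

lemma cl_frag_of_mset:
  assumes "set_mset M \<subseteq> P"
  shows "cl (frag_of_mset M) = c [^]\<^bsub>C\<^esub> (\<Sum>p\<in>#M. z p)"
  using assms
proof (induction M)
  case empty
  have "cl 0 = \<one>\<^bsub>C\<^esub>" using cl_eq_one_iff[of 0] subgroup.one_closed[OF subgroup_N] by simp
  then show ?case by simp
next
  case (add p M)
  then have "cl (frag_of p + frag_of_mset M) = cl (frag_of p) \<otimes>\<^bsub>C\<^esub> cl (frag_of_mset M)"
    by (intro cl_add) (auto simp: keys_frag_of_mset)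
  also have "\<dots> = c [^]\<^bsub>C\<^esub> z p \<otimes>\<^bsub>C\<^esub> c [^]\<^bsub>C\<^esub> (\<Sum>p\<in>#M. z p)" using add z by simp
  also have "\<dots> = c [^]\<^bsub>C\<^esub> (\<Sum>p\<in>#add_mset p M. z p)" using C.nat_pow_mult[OF c_in] by simp
  finally show ?case by simp
qed

lemma zero_sum_iff:
  assumes "set_mset M \<subseteq> P"
  shows "n dvd (\<Sum>p\<in>#M. z p) \<longleftrightarrow> (\<exists>a\<in>carrier H. \<phi> a = frag_of_mset M)"
  using cl_eq_one_iff_phi[OF assms] cl_frag_of_mset[OF assms] C.pow_eq_id[OF c_in, of "\<Sum>p\<in>#M. z p"] ord_c by simp

definition divisor where "divisor a = (SOME M. \<phi> a = frag_of_mset M)"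
definition \<Theta> where "\<Theta> a = image_mset z (divisor a)"

lemma divisor: "a \<in> carrier H \<Longrightarrow> \<phi> a = frag_of_mset (divisor a)"
  unfolding divisor_def using ex_frag_of_mset[OF phi_nonneg] by (rule someI_ex)

lemma divisor_eqI: "a \<in> carrier H \<Longrightarrow> \<phi> a = frag_of_mset M \<Longrightarrow> divisor a = M"
  using divisor inj_frag_of_mset by metis

lemma divisor_subset: "a \<in> carrier H \<Longrightarrow> set_mset (divisor a) \<subseteq> P"
  using keys_phi[of a] by (simp add: divisor keys_frag_of_mset)

lemma lift_exponents:
  assumes "set_mset B \<subseteq> exponents"
  shows "\<exists>M. set_mset M \<subseteq> P \<and> image_mset z M = B"
  using assms
proof (induction B)
  case (add k B)
  then have "\<exists>M. set_mset M \<subseteq> P \<and> image_mset z M = B" and "k \<in> z ` P" using z_image by auto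
  then obtain M p where "set_mset M \<subseteq> P" "image_mset z M = B" "p \<in> P" "k = z p" by blast
  then show ?case by (intro exI[of _ "add_mset p M"]) simp
qed auto

text \<open>A splitting of the multiset of exponents comes from a splitting of the underlying
  primes. Its zero-sum part is a principal divisor, and the complementary divisor is principal by
  divisibility.\<close>

sublocale block_transfer H \<Theta> n exponents
proof
  show "\<Theta> (a \<otimes> b) = \<Theta> a + \<Theta> b" if "a \<in> carrier H" "b \<in> carrier H" for a b
  proof -
    have "divisor (a \<otimes> b) = divisor a + divisor b"
      using that by (intro divisor_eqI) (simp_all add: phi_mult flip: divisor)
    then show ?thesis by (simp add: \<Theta>_def)
  qed
  show "n dvd \<Sum>\<^sub># (\<Theta> a)" if "a \<in> carrier H" for a
    using zero_sum_iff[OF divisor_subset[OF that]] divisor[OF that] that by (auto simp: \<Theta>_def)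
  show "set_mset (\<Theta> a) \<subseteq> exponents" if "a \<in> carrier H" for a
    using divisor_subset[OF that] z_image by (auto simp: \<Theta>_def)
  show "a \<in> Units H" if "a \<in> carrier H" "\<Theta> a = {#}" for a
    using that divisor[OF that(1)] by (intro unit_if_phi_zero) (simp_all add: \<Theta>_def)
  show "\<exists>a\<in>carrier H. \<Theta> a = B" if B: "set_mset B \<subseteq> exponents" "n dvd \<Sum>\<^sub># B" for B
  proof -
    obtain M where M: "set_mset M \<subseteq> P" "image_mset z M = B" using lift_exponents[OF B(1)] by blast
    then obtain a where a: "a \<in> carrier H" "\<phi> a = frag_of_mset M" using zero_sum_iff[OF M(1)] B(2) by auto
    then show ?thesis using divisor_eqI[OF a] M(2) by (auto simp: \<Theta>_def)
  qed
  show "\<exists>b\<in>carrier H. \<exists>e\<in>carrier H. a = b \<otimes> e \<and> \<Theta> b = B \<and> \<Theta> e = D"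
    if a: "a \<in> carrier H" and eq: "\<Theta> a = B + D" and B: "n dvd \<Sum>\<^sub># B" for a B D
  proof -
    have "\<exists>M1 M2. divisor a = M1 + M2 \<and> B = image_mset z M1 \<and> D = image_mset z M2"
      using eq unfolding \<Theta>_def by (rule image_mset_eq_plusD)
    then obtain M1 M2 where M: "divisor a = M1 + M2" "B = image_mset z M1" "D = image_mset z M2"
      by blast
    have P: "set_mset M1 \<subseteq> P" "set_mset M2 \<subseteq> P" using divisor_subset[OF a] M(1) by auto
    obtain b where b: "b \<in> carrier H" "\<phi> b = frag_of_mset M1" using zero_sum_iff[OF P(1)] B M(2) by auto
    have "\<phi> a = \<phi> b + frag_of_mset M2" using divisor[OF a] M(1) b(2) by simp
    then obtain e where e: "e \<in> carrier H" "a = b \<otimes> e" "\<phi> e = frag_of_mset M2"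
      using divides_if_phi_diff[OF b(1) a] P(2) by (auto simp: keys_frag_of_mset lookup_frag_of_mset)
    show ?thesis
      using b e divisor_eqI[OF b] divisor_eqI[OF e(1,3)] M(2,3) by (auto simp: \<Theta>_def)
  qed
qed

text \<open>The generator \<open>c\<close> is the class of a difference of effective divisors
  \<open>M\<close> and \<open>M'\<close>, so the exponent sum of \<open>M\<close> is 1 plus that of
  \<open>M'\<close> modulo \<open>n\<close>. A common divisor of \<open>n\<close> and all exponents
  therefore divides 1.\<close>

lemma exponents_generate:
  assumes "t dvd n" "\<And>k. k \<in> exponents \<Longrightarrow> t dvd k"
  shows "t = 1"
proof -
  obtain x where x: "x \<in> carrier F" "c = cl x" using c_in carrier_C by auto
  obtain M M' where M: "x = frag_of_mset M - frag_of_mset M'"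
    and "set_mset M \<union> set_mset M' \<subseteq> Poly_Mapping.keys x"
    using ex_frag_diff[of x] by blast
  then have M_P: "set_mset M \<subseteq> P" "set_mset M' \<subseteq> P" using x(1) by auto
  have t: "t dvd (\<Sum>p\<in>#K. z p)" if "set_mset K \<subseteq> P" for K
    using that
  proof (induction K)
    case (add p K)
    then have "z p \<in> exponents" using z_image by auto
    then show ?case using add assms(2) by simp
  qed simp
  have "frag_of_mset M = x + frag_of_mset M'" using M by simp
  then have "cl (frag_of_mset M) = c \<otimes>\<^bsub>C\<^esub> cl (frag_of_mset M')"
    using cl_add[of x "frag_of_mset M'"] x M_P by (simp add: keys_frag_of_mset)
  then have "c [^]\<^bsub>C\<^esub> (\<Sum>p\<in>#M. z p) = c [^]\<^bsub>C\<^esub> (1 + (\<Sum>p\<in>#M'. z p))"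
    using cl_frag_of_mset[of M] cl_frag_of_mset[of M'] M_P C.nat_pow_mult[OF c_in, of 1 "\<Sum>p\<in>#M'. z p"] c_in by simp
  then have "c [^]\<^bsub>C\<^esub> int (\<Sum>p\<in>#M. z p) = c [^]\<^bsub>C\<^esub> int (1 + (\<Sum>p\<in>#M'. z p))"
    by (simp only: int_pow_int)
  then have "int n dvd int (1 + (\<Sum>p\<in>#M'. z p)) - int (\<Sum>p\<in>#M. z p)"
    using C.int_pow_eq[OF c_in] ord_c by (metis dvd_diff_commute)
  then have "int t dvd int (1 + (\<Sum>p\<in>#M'. z p)) - int (\<Sum>p\<in>#M. z p)"
    using assms(1) by (meson dvd_trans int_dvd_int_iff)
  moreover have "int t dvd int (\<Sum>p\<in>#M. z p)" "int t dvd int (\<Sum>p\<in>#M'. z p)"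
    using t M_P by (simp_all del: of_nat_sum_mset)
  ultimately have "int t dvd 1"
    by (metis (no_types, lifting) diff_add_cancel dvd_add dvd_add_left_iff of_nat_1 of_nat_add)
  then show ?thesis by simp
qed

end

section \<open>Classes as powers of a generator\<close>

context divisor_hom
begin

definition E where "E = prime_classes - {\<one>\<^bsub>C\<^esub>}"

lemma E_subset: "E \<subseteq> carrier C"
  by (auto simp: E_def prime_classes_def intro!: cl_in_C)

lemma ex_generator:
  assumes "cyclic_group C" "finite (carrier C)"
  shows "\<exists>c\<in>carrier C. group.ord C c = order C"
proof -
  interpret C: group C by (rule group_C)
  obtain c where c: "c \<in> carrier C" "carrier C = range (\<lambda>k::int. c [^]\<^bsub>C\<^esub> k)"
    using assms(1) C.cyclic_group by blast
  then have "generate C {c} = carrier C" using C.generate_pow[OF c(1)] by auto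
  then show ?thesis using C.generate_pow_card[OF c(1)] c(1) by (auto simp: order_def)
qed

end

context divisor_hom_generator
begin

interpretation C: group C by (rule group_C)

lemma pow_eq_iff: "k \<in> {1..n} \<Longrightarrow> l \<in> {1..n} \<Longrightarrow> c [^]\<^bsub>C\<^esub> k = c [^]\<^bsub>C\<^esub> l \<longleftrightarrow> k = l"
  using inj_pow by (auto dest: inj_onD)

lemma pow_n: "c [^]\<^bsub>C\<^esub> n = \<one>\<^bsub>C\<^esub>"
  using C.pow_eq_id[OF c_in, of n] ord_c by simp

lemma inv_pow: "k \<le> n \<Longrightarrow> inv\<^bsub>C\<^esub> (c [^]\<^bsub>C\<^esub> k) = c [^]\<^bsub>C\<^esub> (n - k)"
  using C.inv_equality[of "c [^]\<^bsub>C\<^esub> (n - k)" "c [^]\<^bsub>C\<^esub> k"] C.nat_pow_mult[OF c_in, of "n - k" k] c_in pow_n by simp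

lemma inv_c: "inv\<^bsub>C\<^esub> c = c [^]\<^bsub>C\<^esub> (n - 1)"
  using inv_pow[of 1] n_pos c_in by simp

lemma ord_pow: "group.ord C (c [^]\<^bsub>C\<^esub> k) = n div gcd k n"
proof (subst C.ord_unique)
  show "c [^]\<^bsub>C\<^esub> k \<in> carrier C" using c_in by simp
  have "(c [^]\<^bsub>C\<^esub> k) [^]\<^bsub>C\<^esub> j = \<one>\<^bsub>C\<^esub> \<longleftrightarrow> n dvd j * k" for j
    using C.pow_eq_id[OF c_in, of "k * j"] ord_c c_in by (simp add: C.nat_pow_pow mult.commute)
  then show "\<forall>j. ((c [^]\<^bsub>C\<^esub> k) [^]\<^bsub>C\<^esub> j = \<one>\<^bsub>C\<^esub>) = (n div gcd k n dvd j)"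
    using dvd_mult_gcd_iff[OF n_pos, of _ k] by simp
qed

lemma exponents_subset: "exponents \<subseteq> {1..n}"
  by (auto simp: exponents_def)

lemma E_eq_image: "E = (\<lambda>k. c [^]\<^bsub>C\<^esub> k) ` (exponents - {n})"
proof (intro equalityI subsetI)
  fix g assume g: "g \<in> E"
  then obtain k where k: "k \<in> {1..n}" "g = c [^]\<^bsub>C\<^esub> k" using E_subset carrier_eq_pow by auto
  then have "k \<noteq> n" "k \<in> exponents" using g pow_n by (auto simp: E_def exponents_def)
  then show "g \<in> (\<lambda>k. c [^]\<^bsub>C\<^esub> k) ` (exponents - {n})" using k by auto
next
  fix g assume "g \<in> (\<lambda>k. c [^]\<^bsub>C\<^esub> k) ` (exponents - {n})"
  then obtain k where k: "k \<in> exponents" "k \<noteq> n" "g = c [^]\<^bsub>C\<^esub> k" by blast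
  then have "g \<noteq> c [^]\<^bsub>C\<^esub> n" using pow_eq_iff[of k n] exponents_subset n_pos by auto
  then show "g \<in> E" using k by (simp add: E_def exponents_def pow_n)
qed

lemma pow_in_E_iff: "k \<in> {1..n} \<Longrightarrow> k \<noteq> n \<Longrightarrow> c [^]\<^bsub>C\<^esub> k \<in> E \<longleftrightarrow> k \<in> exponents"
  using pow_eq_iff[of k n] n_pos by (auto simp: E_def exponents_def pow_n)

lemma exponents_subset_if:
  assumes "E \<subseteq> (\<lambda>k. c [^]\<^bsub>C\<^esub> k) ` S" "S \<subseteq> {1..n}"
  shows "exponents \<subseteq> insert n S"
proof
  fix k assume k: "k \<in> exponents"
  show "k \<in> insert n S"
  proof (cases "k = n")
    case False
    then have "c [^]\<^bsub>C\<^esub> k \<in> E" using k E_eq_image by blast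
    then obtain l where "l \<in> S" "c [^]\<^bsub>C\<^esub> k = c [^]\<^bsub>C\<^esub> l" using assms(1) by blast
    moreover have "k \<in> {1..n}" using k exponents_subset by (rule subsetD[rotated])
    moreover have "l \<in> {1..n}" using \<open>l \<in> S\<close> assms(2) by (rule subsetD[rotated])
    ultimately show ?thesis using pow_eq_iff[of k l] by simp
  qed simp
qed

lemma ord_inv_c: "group.ord C (inv\<^bsub>C\<^esub> c) = n"
  using C.ord_inv[OF c_in] ord_c by simp

lemma ord_eq_2:
  assumes "g \<in> carrier C" "group.ord C g = 2" "even n"
  shows "g = c [^]\<^bsub>C\<^esub> (n div 2)"
proof -
  obtain k where k: "k \<in> {1..n}" "g = c [^]\<^bsub>C\<^esub> k" using assms(1) carrier_eq_pow by auto
  have "g [^]\<^bsub>C\<^esub> (2::nat) = \<one>\<^bsub>C\<^esub>" using C.pow_eq_id[OF assms(1), of 2] assms(2) by simp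
  then have "n dvd k * 2" using C.pow_eq_id[OF c_in, of "k * 2"] ord_c c_in k(2) by (simp add: C.nat_pow_pow)
  then obtain q where q: "k * 2 = n * q" by blast
  moreover have "k \<noteq> n" using assms(2) k(2) pow_n by auto
  then have "k < n" "k > 0" using k(1) by auto
  ultimately have lt: "n * q < n * 2" by linarith
  have "q \<noteq> 0" using q \<open>k > 0\<close> by (cases q) auto
  then have "q = 1" using lt by simp
  then have "n = k * 2" using q by simp
  then have "n div 2 = k" by (simp only: nonzero_mult_div_cancel_right)
  then show ?thesis using k(2) by simp
qed

lemma chf_generatorI:
  assumes "c \<in> E" "congruence_half_factorial d H" "n \<le> 2 * d + 4" "d \<ge> 100"
  shows "chf_with_generator n d exponents"
proof
  have "c [^]\<^bsub>C\<^esub> (1::nat) \<in> E" using assms(1) c_in by simp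
  then show "1 \<in> exponents" using n_pos by (auto simp: E_def exponents_def)
qed (use assms exponents_subset congruence_half_factorial_iff in auto)

text \<open>Here \<open>c\<close> serves only as a coordinate and contains no primes. That no prime
  class has order \<open>n\<close> means that no exponent is coprime to \<open>n\<close>.\<close>

lemma no_generator:
  assumes "\<not> half_factorial H" "congruence_half_factorial d H" "n \<le> 2 * d + 4" "n \<ge> 250"
    and none: "\<And>g. g \<in> E \<Longrightarrow> group.ord C g \<noteq> n"
  shows "n = 2 * d + 4 \<and> (\<exists>g1 g2 g3. distinct [g1, g2, g3] \<and> E = {g1, g2, g3} \<and>
    group.ord C g1 = n div 2 \<and> group.ord C g2 = n div 2 \<and> g1 = inv\<^bsub>C\<^esub> g2 \<and>
    group.ord C g3 = 2 \<and> \<not> 4 dvd n)"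
proof -
  have "gcd k n \<noteq> 1" if k: "k \<in> exponents" for k
  proof
    assume "gcd k n = 1"
    then have "k \<noteq> n" using assms(4) by auto
    then have "c [^]\<^bsub>C\<^esub> k \<in> E" using k E_eq_image by blast
    then show False using none ord_pow[of k] \<open>gcd k n = 1\<close> by simp
  qed
  moreover have "block_chf d n exponents" "\<not> block_chf 0 n exponents"
    using congruence_half_factorial_iff assms(2) half_factorial_if_block assms(1) by blast+
  moreover have "d \<ge> 100" "n \<ge> 200" using assms(3,4) by auto
  ultimately have n: "n = 2 * d + 4 \<and> odd (n div 2) \<and>
      (\<exists>h. gcd h n = 2 \<and> 0 < h \<and> h < n \<and> exponents - {n} = {h, n - h, n div 2})"
    by (intro classify_no_generator[OF exponents_subset] assms(3) exponents_generate)
  then obtain h where h: "gcd h n = 2" "0 < h" "h < n" "exponents - {n} = {h, n - h, n div 2}"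
    by blast
  have odd: "odd (n div 2)" using n by (rule conjunct1[OF conjunct2])
  have n: "n = 2 * d + 4" using n by (rule conjunct1)
  have "even h" using h(1) by (metis gcd_dvd1)
  then have ne: "h \<noteq> n div 2" using odd by auto
  have "even n" using n by simp
  then have ne': "h \<noteq> n - h" "n - h \<noteq> n div 2" using ne h(2,3) by presburger+
  have rng: "h \<in> {1..n}" "n - h \<in> {1..n}" "n div 2 \<in> {1..n}" using h(2,3) assms(4) by auto
  define g1 g2 g3 where "g1 = c [^]\<^bsub>C\<^esub> (n - h)" and "g2 = c [^]\<^bsub>C\<^esub> h" and "g3 = c [^]\<^bsub>C\<^esub> (n div 2)"
  have "gcd (n - h) n = gcd h n" using h(3) by (metis gcd.commute gcd_diff2_nat gcd_diff1_nat less_imp_le)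
  then have g: "gcd (n - h) n = 2" using h(1) by simp
  have "distinct [g1, g2, g3]"
    using pow_eq_iff[OF rng(2,1)] pow_eq_iff[OF rng(2,3)] pow_eq_iff[OF rng(1,3)] ne ne'
    by (simp add: g1_def g2_def g3_def)
  moreover have "E = {g1, g2, g3}"
    unfolding E_eq_image h(4) g1_def g2_def g3_def by blast
  moreover have "C.ord g1 = n div 2" "C.ord g2 = n div 2"
    by (simp_all only: g1_def g2_def ord_pow g h(1))
  moreover have "C.ord g3 = 2"
  proof -
    obtain m where m: "n = 2 * m" using \<open>even n\<close> by blast
    then have "gcd (n div 2) n = m" by simp
    then show ?thesis using m n_pos by (simp add: g3_def ord_pow)
  qed
  moreover have "g1 = inv\<^bsub>C\<^esub> g2" using inv_pow[of h] h(3) by (simp add: g1_def g2_def)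
  moreover have "\<not> 4 dvd n" using odd by presburger
  ultimately show ?thesis using n by blast
qed

end

context divisor_hom_generator
begin

interpretation C: group C by (rule group_C)

lemma inv_c_square: "n \<ge> 2 \<Longrightarrow> inv\<^bsub>C\<^esub> (c [^]\<^bsub>C\<^esub> (2::nat)) = c [^]\<^bsub>C\<^esub> (n - 2)"
  using inv_pow[of 2] by simp

lemma pow_1: "c [^]\<^bsub>C\<^esub> (1::nat) = c"
  using c_in by simp

lemma E_eq_imageI:
  assumes "S \<subseteq> exponents" "exponents \<subseteq> insert n S" "n \<notin> S"
  shows "E = (\<lambda>k. c [^]\<^bsub>C\<^esub> k) ` S"
proof -
  have "exponents - {n} = S" using assms by blast
  then show ?thesis using E_eq_image by simp
qed

lemma block_not_half_factorial: "\<not> half_factorial H \<Longrightarrow> \<not> block_chf 0 n exponents"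
  using half_factorial_if_block by blast

lemma congruence_half_factorialI:
  assumes "E \<subseteq> (\<lambda>k. c [^]\<^bsub>C\<^esub> k) ` S" "S \<subseteq> {1..n}" "\<And>G. G \<subseteq> insert n S \<Longrightarrow> block_chf d n G"
  shows "congruence_half_factorial d H"
  using assms(3)[OF exponents_subset_if[OF assms(1,2)]] congruence_half_factorial_iff by blast

lemma c_neq_inv:
  assumes "n \<ge> 3"
  shows "inv\<^bsub>C\<^esub> c \<noteq> c"
  using pow_eq_iff[of "n - 1" 1] assms by (simp add: inv_c c_in)

lemma classes_n_minus_2:
  assumes "c \<in> E" "\<not> half_factorial H" "congruence_half_factorial (n - 2) H" "n \<ge> 250"
  shows "E = {inv\<^bsub>C\<^esub> c, c}"
proof -
  interpret chf_with_generator n "n - 2" exponents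
    by (rule chf_generatorI) (use assms in auto)
  have "n = (n - 2) + 2" using assms(4) by simp
  note cl = classify_n_minus_2[OF block_not_half_factorial[OF assms(2)] this]
  have "E = (\<lambda>k. c [^]\<^bsub>C\<^esub> k) ` {n - 1, 1}"
    by (rule E_eq_imageI) (use cl G(2) assms(4) in auto)
  then show ?thesis by (simp add: inv_c pow_1 c_in)
qed

lemma classes_half_n_minus_2:
  assumes "c \<in> E" "\<not> half_factorial H" "congruence_half_factorial ((n - 2) div 2) H" "n \<ge> 250" "even n"
  shows "{g \<in> E. group.ord C g = n} = {inv\<^bsub>C\<^esub> c, c} \<and>
    (\<forall>g\<in>E. g \<noteq> inv\<^bsub>C\<^esub> c \<longrightarrow> g \<noteq> c \<longrightarrow> group.ord C g = 2)"
proof -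
  have n: "n = 2 * ((n - 2) div 2) + 2" using assms(4,5) by presburger
  interpret chf_with_generator n "(n - 2) div 2" exponents
    by (rule chf_generatorI) (use assms in auto)
  note cl = classify_half_n_minus_2[OF block_not_half_factorial[OF assms(2)] n]
  have "n - 1 \<in> exponents - {n}" "1 \<in> exponents - {n}" using cl(1) G(2) assms(4) by auto
  then have "c [^]\<^bsub>C\<^esub> (n - 1) \<in> E" "c [^]\<^bsub>C\<^esub> (1::nat) \<in> E" unfolding E_eq_image by blast+
  then have "inv\<^bsub>C\<^esub> c \<in> E" "c \<in> E" by (simp_all only: inv_c pow_1)
  moreover have other: "g = inv\<^bsub>C\<^esub> c \<or> g = c \<or> group.ord C g = 2" if "g \<in> E" for g
  proof -
    obtain k where k: "g = c [^]\<^bsub>C\<^esub> k" "k \<in> exponents" "k \<noteq> n"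
      using \<open>g \<in> E\<close> unfolding E_eq_image by blast
    then consider "k = 1" | "k = n - 1" | "k = n div 2" using cl(2) by auto
    then show ?thesis
    proof cases
      case 3
      have "gcd (n div 2) n = n div 2" using assms(5) by (intro gcd_nat.absorb1) auto
      then have "C.ord g = n div (n div 2)" using ord_pow[of "n div 2"] k(1) 3 by simp
      then show ?thesis using assms(4,5) by (auto elim!: evenE)
    qed (use k(1) inv_c pow_1 in auto)
  qed
  ultimately show ?thesis using ord_c ord_inv_c assms(4) by fastforce
qed

lemma classes_half_n_minus_3_aux:
  assumes "c \<in> E" "inv\<^bsub>C\<^esub> (c [^]\<^bsub>C\<^esub> (2::nat)) \<in> E" "congruence_half_factorial ((n - 3) div 2) H" "n \<ge> 250" "odd n"
  shows "E = {c, inv\<^bsub>C\<^esub> (c [^]\<^bsub>C\<^esub> (2::nat))} \<and> c \<noteq> inv\<^bsub>C\<^esub> (c [^]\<^bsub>C\<^esub> (2::nat)) \<and>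
    group.ord C (inv\<^bsub>C\<^esub> (c [^]\<^bsub>C\<^esub> (2::nat))) = n"
proof -
  have n: "n = 2 * ((n - 3) div 2) + 3" using assms(4,5) by presburger
  interpret chf_with_generator n "(n - 3) div 2" exponents
    by (rule chf_generatorI) (use assms in auto)
  have inv2: "inv\<^bsub>C\<^esub> (c [^]\<^bsub>C\<^esub> (2::nat)) = c [^]\<^bsub>C\<^esub> (n - 2)" using inv_c_square assms(4) by simp
  then have "n - 2 \<in> exponents" using assms(2,4) pow_in_E_iff[of "n - 2"] by simp
  note cl = this classify_half_n_minus_3_minus_2[OF this n]
  have "E = (\<lambda>k. c [^]\<^bsub>C\<^esub> k) ` {1, n - 2}"
    by (rule E_eq_imageI) (use cl G(2) assms(4) in auto)
  moreover have "c [^]\<^bsub>C\<^esub> (1::nat) \<noteq> c [^]\<^bsub>C\<^esub> (n - 2)"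
    using pow_eq_iff[of 1 "n - 2"] assms(4) by simp
  ultimately show ?thesis
    using ord_pow[of "n - 2"] gcd_minus_2[of n] assms(4,5) by (simp add: inv2 pow_1 c_in)
qed

text \<open>If -2 is not an exponent, then \<open>d + 1\<close> is, and it is coprime to
  \<open>n\<close> with \<open>2 * (d + 1) = n - 1\<close>. The class \<open>e\<close> with this
  exponent is a generator whose double is the inverse of \<open>c\<close>, so \<open>c\<close> plays
  the role of -2 for it.\<close>

lemma classes_half_n_minus_3:
  assumes "c \<in> E" "\<not> half_factorial H" "congruence_half_factorial ((n - 3) div 2) H" "n \<ge> 250" "odd n"
  obtains e where "e \<in> E" "group.ord C e = n" "inv\<^bsub>C\<^esub> (e [^]\<^bsub>C\<^esub> (2::nat)) \<in> E"
proof -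
  define d where "d = (n - 3) div 2"
  have n: "n = 2 * d + 3" using assms(4,5) unfolding d_def by presburger
  interpret chf_with_generator n d exponents
    by (rule chf_generatorI[OF assms(1) assms(3)[folded d_def]]) (use n assms(4) in linarith)+
  show thesis
    using classify_half_n_minus_3[OF block_not_half_factorial[OF assms(2)] n]
  proof (elim disjE conjE)
    assume "n - 2 \<in> exponents"
    then show thesis
      using that[of c] assms(1,4) ord_c inv_c_square pow_in_E_iff[of "n - 2"] by simp
  next
    assume d: "d + 1 \<in> exponents" "coprime (d + 1) n"
    define e where "e = c [^]\<^bsub>C\<^esub> (d + 1)"
    have "e \<in> E" using d(1) pow_in_E_iff[of "d + 1"] n by (simp add: e_def)
    moreover have "C.ord e = n" using ord_pow[of "d + 1"] d(2) by (simp add: e_def)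
    moreover have "inv\<^bsub>C\<^esub> (e [^]\<^bsub>C\<^esub> (2::nat)) = c"
    proof -
      have e2: "(d + 1) * 2 = n - 1" using n by simp
      have "e [^]\<^bsub>C\<^esub> (2::nat) = c [^]\<^bsub>C\<^esub> (n - 1)"
        unfolding e_def C.nat_pow_pow[OF c_in] by (simp only: e2)
      then show ?thesis using inv_pow[of "n - 1"] n pow_1 by simp
    qed
    ultimately show thesis using that assms(1) by blast
  qed
qed

lemma classes_half_n_minus_4:
  assumes "c \<in> E" "\<not> half_factorial H" "congruence_half_factorial ((n - 4) div 2) H" "n \<ge> 250" "even n"
  shows "inv\<^bsub>C\<^esub> (c [^]\<^bsub>C\<^esub> (2::nat)) \<in> E \<and>
    E \<subseteq> {c, inv\<^bsub>C\<^esub> (c [^]\<^bsub>C\<^esub> (2::nat)), c [^]\<^bsub>C\<^esub> (2::nat)}"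
proof -
  have n: "n = 2 * ((n - 4) div 2) + 4" using assms(4,5) by presburger
  interpret chf_with_generator n "(n - 4) div 2" exponents
    by (rule chf_generatorI) (use assms in auto)
  note cl = classify_half_n_minus_4[OF block_not_half_factorial[OF assms(2)] n]
  have inv2: "inv\<^bsub>C\<^esub> (c [^]\<^bsub>C\<^esub> (2::nat)) = c [^]\<^bsub>C\<^esub> (n - 2)" using inv_c_square assms(4) by simp
  have "c [^]\<^bsub>C\<^esub> (n - 2) \<in> E" using cl(1) assms(4) pow_in_E_iff[of "n - 2"] by simp
  moreover have "E \<subseteq> (\<lambda>k. c [^]\<^bsub>C\<^esub> k) ` {1, n - 2, 2}" unfolding E_eq_image using cl(2) by blast
  ultimately show ?thesis by (simp add: inv2 pow_1 c_in)
qed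

lemma chf_n_minus_2:
  assumes "E = {inv\<^bsub>C\<^esub> c, c}" "n \<ge> 250"
  shows "congruence_half_factorial (n - 2) H"
proof (rule congruence_half_factorialI[where S = "{n - 1, 1}"])
  show "E \<subseteq> (\<lambda>k. c [^]\<^bsub>C\<^esub> k) ` {n - 1, 1}" by (simp add: assms inv_c pow_1 c_in)
  show "block_chf (n - 2) n G" if "G \<subseteq> insert n {n - 1, 1}" for G
    using block_chf_pm1[of n G] that assms(2) by (simp add: insert_commute)
qed (use assms in auto)

lemma chf_half_n_minus_2:
  assumes "\<forall>g\<in>E. g \<noteq> inv\<^bsub>C\<^esub> c \<longrightarrow> g \<noteq> c \<longrightarrow> group.ord C g = 2" "n \<ge> 250" "even n"
  shows "congruence_half_factorial ((n - 2) div 2) H"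
proof (rule congruence_half_factorialI[where S = "{n - 1, 1, n div 2}"])
  show "E \<subseteq> (\<lambda>k. c [^]\<^bsub>C\<^esub> k) ` {n - 1, 1, n div 2}"
  proof
    fix g assume g: "g \<in> E"
    then have "g = inv\<^bsub>C\<^esub> c \<or> g = c \<or> g = c [^]\<^bsub>C\<^esub> (n div 2)"
      using assms(1) ord_eq_2[OF _ _ assms(3)] E_subset by blast
    then show "g \<in> (\<lambda>k. c [^]\<^bsub>C\<^esub> k) ` {n - 1, 1, n div 2}" using inv_c pow_1 by (metis imageI insertI1 insert_commute)
  qed
  obtain m where m: "n = 2 * m" using assms(3) by blast
  show "block_chf ((n - 2) div 2) n G" if "G \<subseteq> insert n {n - 1, 1, n div 2}" for G
  proof -
    have "G \<subseteq> {1, 2 * m - 1, m, 2 * m}" using that by (auto simp: m)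
    then have "block_chf (m - 1) (2 * m) G" using assms(2) m by (intro block_chf_pm1_half) auto
    moreover have "(n - 2) div 2 = m - 1" using m by simp
    ultimately show ?thesis using m by simp
  qed
qed (use assms in auto)

lemma chf_half_n_minus_3:
  assumes "E \<subseteq> {c, inv\<^bsub>C\<^esub> (c [^]\<^bsub>C\<^esub> (2::nat))}" "n \<ge> 250" "odd n"
  shows "congruence_half_factorial ((n - 3) div 2) H"
proof (rule congruence_half_factorialI[where S = "{1, n - 2}"])
  show "E \<subseteq> (\<lambda>k. c [^]\<^bsub>C\<^esub> k) ` {1, n - 2}"
    using assms(1,2) inv_c_square by (simp add: pow_1 c_in)
  have n: "(n - 3) div 2 \<ge> 1" "n = 2 * ((n - 3) div 2) + 3" using assms(2,3) by presburger+
  show "block_chf ((n - 3) div 2) n G" if "G \<subseteq> insert n {1, n - 2}" for G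
    by (rule block_chf_1_minus_2[OF n]) (use that in blast)
qed (use assms in auto)

lemma chf_half_n_minus_4:
  assumes "E \<subseteq> {c, inv\<^bsub>C\<^esub> (c [^]\<^bsub>C\<^esub> (2::nat)), c [^]\<^bsub>C\<^esub> (2::nat)}" "n \<ge> 250" "even n"
  shows "congruence_half_factorial ((n - 4) div 2) H"
proof (rule congruence_half_factorialI[where S = "{1, n - 2, 2}"])
  show "E \<subseteq> (\<lambda>k. c [^]\<^bsub>C\<^esub> k) ` {1, n - 2, 2}"
    using assms(1,2) inv_c_square by (simp add: pow_1 c_in)
  have n: "(n - 4) div 2 \<ge> 1" "n = 2 * ((n - 4) div 2) + 4" using assms(2,3) by presburger+
  show "block_chf ((n - 4) div 2) n G" if "G \<subseteq> insert n {1, n - 2, 2}" for G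
    by (rule block_chf_1_2_minus_2[OF n]) (use that in blast)
qed (use assms in auto)

text \<open>No assumption ties \<open>c\<close> to prime classes. In its coordinates
  \<open>g2\<close> has an exponent \<open>h\<close> of gcd 2, \<open>g1\<close> has
  \<open>n - h\<close>, and \<open>g3\<close> has n / 2, the exponent of the only class of order 2;
  \<open>\<not> 4 dvd n\<close> makes n / 2 odd.\<close>

lemma chf_half_n_minus_4':
  assumes "E = {g1, g2, g3}" "group.ord C g2 = n div 2" "g1 = inv\<^bsub>C\<^esub> g2"
    "group.ord C g3 = 2" "\<not> 4 dvd n" "even n" "n \<ge> 250"
  shows "congruence_half_factorial ((n - 4) div 2) H"
proof -
  define m where "m = n div 2"
  have nm: "n = 2 * m" "odd m" using assms(5,6) unfolding m_def by presburger+
  have E: "g2 \<in> carrier C" "g3 \<in> carrier C" using E_subset assms(1) by auto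
  then obtain h where h: "h \<in> {1..n}" "g2 = c [^]\<^bsub>C\<^esub> h" using carrier_eq_pow by auto
  have "n div gcd h n = m" using ord_pow[of h] assms(2) h(2) by (simp add: m_def)
  then have "n = gcd h n * m" by (metis dvd_mult_div_cancel gcd_dvd2)
  then have g: "gcd h n = 2" using nm assms(7) by (metis less_not_refl mult_right_cancel n_pos mult_0_right)
  have "h \<noteq> n" using g assms(7) by auto
  then have hn: "0 < h" "h < n" using h(1) by auto
  show ?thesis
  proof (rule congruence_half_factorialI[where S = "{h, n - h, m}"])
    show "E \<subseteq> (\<lambda>k. c [^]\<^bsub>C\<^esub> k) ` {h, n - h, m}"
      using inv_pow[of h] hn ord_eq_2[OF E(2) assms(4,6)] h(2) by (simp add: assms(1,3) m_def)
    show "{h, n - h, m} \<subseteq> {1..n}" using hn nm n_pos by auto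
    have "(n - 4) div 2 = m - 2" "m \<ge> 3" using nm assms(7) by auto
    then show "block_chf ((n - 4) div 2) n G" if "G \<subseteq> insert n {h, n - h, m}" for G
      using block_chf_half[OF g hn nm, of G] that by (simp add: insert_commute)
  qed
qed

end

theorem theorem2p3:
  fixes H :: "('a, 'm) monoid_scheme"
    and P :: "'p set"
    and \<phi> :: "'a \<Rightarrow> ('p \<Rightarrow>\<^sub>0 int)"
    and C :: "('p \<Rightarrow>\<^sub>0 int) set monoid"
    and E :: "('p \<Rightarrow>\<^sub>0 int) set set"
    and n :: nat
  assumes krull: "krull_monoid H"
    and div_theory: "divisor_theory H P \<phi>"
    and not_hf: "\<not> half_factorial H"
    and C_eq: "C = class_group H P \<phi>"
    and E_eq: "E = nonzero_prime_classes H P \<phi>"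
    and cyclic: "cyclic_group C"
    and finite_C: "finite (carrier C)"
    and order_C: "order C = n"
    and n_ge: "n \<ge> 250"
  shows
    "(congruence_half_factorial (n - 2) H \<longleftrightarrow>
        (\<exists>g1 g2. g1 \<noteq> g2 \<and> E = {g1, g2} \<and>
           group.ord C g1 = n \<and> group.ord C g2 = n \<and> g1 = inv\<^bsub>C\<^esub> g2))
   \<and> (even n \<longrightarrow>
       (congruence_half_factorial ((n - 2) div 2) H \<longleftrightarrow>
        (\<exists>g1 g2. g1 \<noteq> g2 \<and> {g \<in> E. group.ord C g = n} = {g1, g2} \<and> g1 = inv\<^bsub>C\<^esub> g2 \<and>
           (\<forall>g\<in>E. g \<noteq> g1 \<longrightarrow> g \<noteq> g2 \<longrightarrow> group.ord C g = 2))))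
   \<and> (odd n \<longrightarrow>
       (congruence_half_factorial ((n - 3) div 2) H \<longleftrightarrow>
        (\<exists>g1 g2. g1 \<noteq> g2 \<and> E = {g1, g2} \<and>
           group.ord C g1 = n \<and> group.ord C g2 = n \<and>
           (g1 = inv\<^bsub>C\<^esub> (g2 [^]\<^bsub>C\<^esub> (2::nat)) \<or> g2 = inv\<^bsub>C\<^esub> (g1 [^]\<^bsub>C\<^esub> (2::nat))))))
   \<and> (even n \<longrightarrow>
       (congruence_half_factorial ((n - 4) div 2) H \<longleftrightarrow>
        (\<exists>g1. group.ord C g1 = n \<and> g1 \<in> E \<and> inv\<^bsub>C\<^esub> (g1 [^]\<^bsub>C\<^esub> (2::nat)) \<in> E \<and>
           E \<subseteq> {g1, inv\<^bsub>C\<^esub> (g1 [^]\<^bsub>C\<^esub> (2::nat)), g1 [^]\<^bsub>C\<^esub> (2::nat)})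
        \<or> (\<exists>g1 g2 g3. distinct [g1, g2, g3] \<and> E = {g1, g2, g3} \<and>
             group.ord C g1 = n div 2 \<and> group.ord C g2 = n div 2 \<and> g1 = inv\<^bsub>C\<^esub> g2 \<and>
             group.ord C g3 = 2 \<and> \<not> 4 dvd n)))"
proof -
  interpret divisor_hom H P \<phi>
    using krull div_theory
    by (auto simp: krull_monoid_def divisor_theory_def divisor_hom_def divisor_hom_axioms_def)
  have C: "C = class_group H P \<phi>" and E: "divisor_hom.E H P \<phi> = E"
    by (simp_all add: C_eq E_eq E_def nonzero_prime_classes_eq)
  have gen: "divisor_hom_generator H P \<phi> c n" if "c \<in> carrier C" "group.ord C c = n" for c
    using that order_C n_ge
    by (auto simp: C_eq divisor_hom_generator_def divisor_hom_generator_axioms_def divisor_hom_axioms)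
  \<comment> \<open>An arbitrary generator provides coordinates where no class of order
    \<open>n\<close> need contain primes.\<close>
  obtain c0 where c0: "c0 \<in> carrier C" "group.ord C c0 = n"
    using ex_generator cyclic finite_C order_C unfolding C_eq by blast
  have E_C: "E \<subseteq> carrier C" using E_subset by (simp add: E C)
  have genE: "divisor_hom_generator H P \<phi> c n" if "c \<in> E" "group.ord C c = n" for c
    using gen that E_C by blast
  interpret C: group C using group_C by (simp add: C)
  note no_gen = divisor_hom_generator.no_generator[OF gen[OF c0], folded C, unfolded E, OF not_hf]
  \<comment> \<open>Without a prime class of order \<open>n\<close>, the modulus has to satisfy
    \<open>n = 2 * d + 4\<close>; the moduli of the first three parts do not.\<close>
  have some: "\<exists>g\<in>E. group.ord C g = n"
    if "congruence_half_factorial d H" "n \<le> 2 * d + 4" "n \<noteq> 2 * d + 4" for d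
    using no_gen[OF that(1,2) n_ge] that(3) by blast
  have part1: "congruence_half_factorial (n - 2) H \<longleftrightarrow>
        (\<exists>g1 g2. g1 \<noteq> g2 \<and> E = {g1, g2} \<and>
           group.ord C g1 = n \<and> group.ord C g2 = n \<and> g1 = inv\<^bsub>C\<^esub> g2)"
  proof
    assume chf: "congruence_half_factorial (n - 2) H"
    have "n \<le> 2 * (n - 2) + 4" "n \<noteq> 2 * (n - 2) + 4" using n_ge by linarith+
    then obtain c where c: "c \<in> E" "group.ord C c = n" using some[OF chf] by blast
    have "E = {inv\<^bsub>C\<^esub> c, c}"
      by (rule divisor_hom_generator.classes_n_minus_2[OF genE[OF c], folded C, unfolded E, OF c(1) not_hf chf n_ge])
    moreover have "inv\<^bsub>C\<^esub> c \<noteq> c"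
      using divisor_hom_generator.c_neq_inv[OF genE[OF c], folded C] n_ge by simp
    moreover have "group.ord C (inv\<^bsub>C\<^esub> c) = n"
      using divisor_hom_generator.ord_inv_c[OF genE[OF c], folded C] .
    ultimately show "\<exists>g1 g2. g1 \<noteq> g2 \<and> E = {g1, g2} \<and>
           group.ord C g1 = n \<and> group.ord C g2 = n \<and> g1 = inv\<^bsub>C\<^esub> g2"
      using c(2) by blast
  next
    assume "\<exists>g1 g2. g1 \<noteq> g2 \<and> E = {g1, g2} \<and>
           group.ord C g1 = n \<and> group.ord C g2 = n \<and> g1 = inv\<^bsub>C\<^esub> g2"
    then obtain c where c: "E = {inv\<^bsub>C\<^esub> c, c}" "group.ord C c = n" by blast
    then have "c \<in> E" by simp
    show "congruence_half_factorial (n - 2) H"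
      by (rule divisor_hom_generator.chf_n_minus_2[OF genE[OF \<open>c \<in> E\<close> c(2)], folded C, unfolded E, OF c(1) n_ge])
  qed
  have part2: "congruence_half_factorial ((n - 2) div 2) H \<longleftrightarrow>
        (\<exists>g1 g2. g1 \<noteq> g2 \<and> {g \<in> E. group.ord C g = n} = {g1, g2} \<and> g1 = inv\<^bsub>C\<^esub> g2 \<and>
           (\<forall>g\<in>E. g \<noteq> g1 \<longrightarrow> g \<noteq> g2 \<longrightarrow> group.ord C g = 2))" if even: "even n"
  proof
    assume chf: "congruence_half_factorial ((n - 2) div 2) H"
    have "n \<le> 2 * ((n - 2) div 2) + 4" "n \<noteq> 2 * ((n - 2) div 2) + 4" using even n_ge by presburger+
    then obtain c where c: "c \<in> E" "group.ord C c = n" using some[OF chf] by blast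
    have "{g \<in> E. group.ord C g = n} = {inv\<^bsub>C\<^esub> c, c} \<and>
        (\<forall>g\<in>E. g \<noteq> inv\<^bsub>C\<^esub> c \<longrightarrow> g \<noteq> c \<longrightarrow> group.ord C g = 2)"
      by (rule divisor_hom_generator.classes_half_n_minus_2[OF genE[OF c], folded C, unfolded E,
            OF c(1) not_hf chf n_ge even])
    moreover have "inv\<^bsub>C\<^esub> c \<noteq> c"
      using divisor_hom_generator.c_neq_inv[OF genE[OF c], folded C] n_ge by simp
    ultimately show "\<exists>g1 g2. g1 \<noteq> g2 \<and> {g \<in> E. group.ord C g = n} = {g1, g2} \<and> g1 = inv\<^bsub>C\<^esub> g2 \<and>
           (\<forall>g\<in>E. g \<noteq> g1 \<longrightarrow> g \<noteq> g2 \<longrightarrow> group.ord C g = 2)"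
      by (intro exI[of _ "inv\<^bsub>C\<^esub> c"] exI[of _ c]) simp
  next
    assume "\<exists>g1 g2. g1 \<noteq> g2 \<and> {g \<in> E. group.ord C g = n} = {g1, g2} \<and> g1 = inv\<^bsub>C\<^esub> g2 \<and>
           (\<forall>g\<in>E. g \<noteq> g1 \<longrightarrow> g \<noteq> g2 \<longrightarrow> group.ord C g = 2)"
    then obtain g1 c where g1: "g1 = inv\<^bsub>C\<^esub> c" and g: "{g \<in> E. group.ord C g = n} = {g1, c}"
      "\<forall>g\<in>E. g \<noteq> g1 \<longrightarrow> g \<noteq> c \<longrightarrow> group.ord C g = 2" by iprover
    note c = g[unfolded g1]
    have "c \<in> {g \<in> E. group.ord C g = n}" unfolding c(1) by simp
    then have c': "c \<in> E" "group.ord C c = n" by simp_all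
    show "congruence_half_factorial ((n - 2) div 2) H"
      by (rule divisor_hom_generator.chf_half_n_minus_2[OF genE[OF c'], folded C, unfolded E, OF c(2) n_ge even])
  qed
  have part3: "congruence_half_factorial ((n - 3) div 2) H \<longleftrightarrow>
        (\<exists>g1 g2. g1 \<noteq> g2 \<and> E = {g1, g2} \<and>
           group.ord C g1 = n \<and> group.ord C g2 = n \<and>
           (g1 = inv\<^bsub>C\<^esub> (g2 [^]\<^bsub>C\<^esub> (2::nat)) \<or> g2 = inv\<^bsub>C\<^esub> (g1 [^]\<^bsub>C\<^esub> (2::nat))))" if odd: "odd n"
  proof
    assume chf: "congruence_half_factorial ((n - 3) div 2) H"
    have "n \<le> 2 * ((n - 3) div 2) + 4" "n \<noteq> 2 * ((n - 3) div 2) + 4" using odd n_ge by presburger+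
    then obtain c where c: "c \<in> E" "group.ord C c = n" using some[OF chf] by blast
    obtain e where e: "e \<in> E" "group.ord C e = n" "inv\<^bsub>C\<^esub> (e [^]\<^bsub>C\<^esub> (2::nat)) \<in> E"
      by (rule divisor_hom_generator.classes_half_n_minus_3[OF genE[OF c], folded C, unfolded E,
            OF c(1) not_hf chf n_ge odd])
    \<comment> \<open>Coordinates are changed here: \<open>e\<close> may differ from
      \<open>c\<close>, and the class -2e contains primes in the coordinates of
      \<open>e\<close>.\<close>
    have "E = {e, inv\<^bsub>C\<^esub> (e [^]\<^bsub>C\<^esub> (2::nat))} \<and> e \<noteq> inv\<^bsub>C\<^esub> (e [^]\<^bsub>C\<^esub> (2::nat)) \<and>
        group.ord C (inv\<^bsub>C\<^esub> (e [^]\<^bsub>C\<^esub> (2::nat))) = n"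
      by (rule divisor_hom_generator.classes_half_n_minus_3_aux[OF genE[OF e(1,2)], folded C, unfolded E,
            OF e(1,3) chf n_ge odd])
    then show "\<exists>g1 g2. g1 \<noteq> g2 \<and> E = {g1, g2} \<and>
           group.ord C g1 = n \<and> group.ord C g2 = n \<and>
           (g1 = inv\<^bsub>C\<^esub> (g2 [^]\<^bsub>C\<^esub> (2::nat)) \<or> g2 = inv\<^bsub>C\<^esub> (g1 [^]\<^bsub>C\<^esub> (2::nat)))"
      using e(2) by blast
  next
    assume "\<exists>g1 g2. g1 \<noteq> g2 \<and> E = {g1, g2} \<and>
           group.ord C g1 = n \<and> group.ord C g2 = n \<and>
           (g1 = inv\<^bsub>C\<^esub> (g2 [^]\<^bsub>C\<^esub> (2::nat)) \<or> g2 = inv\<^bsub>C\<^esub> (g1 [^]\<^bsub>C\<^esub> (2::nat)))"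
    then obtain c where c: "c \<in> E" "group.ord C c = n"
      and sub: "E \<subseteq> {c, inv\<^bsub>C\<^esub> (c [^]\<^bsub>C\<^esub> (2::nat))}" by blast
    show "congruence_half_factorial ((n - 3) div 2) H"
      by (rule divisor_hom_generator.chf_half_n_minus_3[OF genE[OF c], folded C, unfolded E, OF sub n_ge odd])
  qed
  have part4: "congruence_half_factorial ((n - 4) div 2) H \<longleftrightarrow>
        (\<exists>g1. group.ord C g1 = n \<and> g1 \<in> E \<and> inv\<^bsub>C\<^esub> (g1 [^]\<^bsub>C\<^esub> (2::nat)) \<in> E \<and>
           E \<subseteq> {g1, inv\<^bsub>C\<^esub> (g1 [^]\<^bsub>C\<^esub> (2::nat)), g1 [^]\<^bsub>C\<^esub> (2::nat)})
        \<or> (\<exists>g1 g2 g3. distinct [g1, g2, g3] \<and> E = {g1, g2, g3} \<and>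
             group.ord C g1 = n div 2 \<and> group.ord C g2 = n div 2 \<and> g1 = inv\<^bsub>C\<^esub> g2 \<and>
             group.ord C g3 = 2 \<and> \<not> 4 dvd n)" (is "_ \<longleftrightarrow> ?one \<or> ?two") if even: "even n"
  proof
    assume chf: "congruence_half_factorial ((n - 4) div 2) H"
    have n: "n \<le> 2 * ((n - 4) div 2) + 4" using even n_ge by presburger
    show "?one \<or> ?two"
    proof (cases "\<exists>g\<in>E. group.ord C g = n")
      case True
      then obtain c where c: "c \<in> E" "group.ord C c = n" by blast
      have "inv\<^bsub>C\<^esub> (c [^]\<^bsub>C\<^esub> (2::nat)) \<in> E \<and>
          E \<subseteq> {c, inv\<^bsub>C\<^esub> (c [^]\<^bsub>C\<^esub> (2::nat)), c [^]\<^bsub>C\<^esub> (2::nat)}"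
        by (rule divisor_hom_generator.classes_half_n_minus_4[OF genE[OF c], folded C, unfolded E,
              OF c(1) not_hf chf n_ge even])
      then show ?thesis using c by blast
    next
      case False
      then have ?two using no_gen[OF chf n n_ge] by blast
      then show ?thesis ..
    qed
  next
    assume "?one \<or> ?two"
    then show "congruence_half_factorial ((n - 4) div 2) H"
    proof
      assume ?one
      then obtain c where c: "c \<in> E" "group.ord C c = n"
        and sub: "E \<subseteq> {c, inv\<^bsub>C\<^esub> (c [^]\<^bsub>C\<^esub> (2::nat)), c [^]\<^bsub>C\<^esub> (2::nat)}" by blast
      show ?thesis
        by (rule divisor_hom_generator.chf_half_n_minus_4[OF genE[OF c], folded C, unfolded E, OF sub n_ge even])
    next
      assume ?two
      then obtain g1 g2 g3 where g: "E = {g1, g2, g3}" "group.ord C g2 = n div 2" "g1 = inv\<^bsub>C\<^esub> g2"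
        "group.ord C g3 = 2" "\<not> 4 dvd n" by blast
      show ?thesis
        by (rule divisor_hom_generator.chf_half_n_minus_4'[OF gen[OF c0], folded C, unfolded E, OF g even n_ge])
    qed
  qed
  show ?thesis using part1 part2 part3 part4 by blast
qed

end
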